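(* Fix a graph $H$, a set of positive rational weights $\Lambda=\{\lambda_i : i\in V(H)\}$, and an even integer $m\ge 2$. Then (for each $d$) there is a partition of $\mathrm{Hom}(T_{m,d},H)$ into $|\mathcal{M}_\Lambda(H)|+1$ classes, $$\mathrm{Hom}(T_{m,d},H)=D_\Lambda(0)\cup\bigcup_{(A,B)\in\mathcal{M}_\Lambda(H)} D_\Lambda(A,B),$$ with the following properties: 1. $w_\Lambda(D_\Lambda(0))\le 2^{-\Omega(d)}Z_\Lambda(T_{m,d},H)$. 2. For each $(A,B)\in\mathcal{M}_\Lambda(H)$ and each $f\in D_\Lambda(A,B)$, the number of vertices $v\in\mathcal{E}$ with $f(v)\notin A$ is at most $(m-\Omega(1))^d$, and the number of vertices $v\in\mathcal{O}$ with $f(v)\notin B$ is at most $(m-\Omega(1))^d$; moreover, all but at most $(m-\Omega(1))^d$ vertices $w\in\mathcal{O}$ have the property that every color of $A$ appears in $\{f(z):z\in N_w\}$, and all but at most $(m-\Omega(1))^d$ vertices $w\in\mathcal{E}$ have the property that every color of $B$ appears in $\{f(z):z\in N_w\}$.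
   Context: For $d\ge1$ and even $m\ge 2$, the even discrete torus $T_{m,d}$ is the graph with vertex set $V=\{0,1,\dots,m-1\}^d$ in which two strings are adjacent iff they differ by exactly $1$ (mod $m$) in exactly one coordinate and agree in all others. It is bipartite with classes $\mathcal{E}$ (strings with even coordinate sum) and $\mathcal{O}$ (odd coordinate sum). $N_x$ denotes the set of neighbors of a vertex $x$. $H$ is a finite graph without multiple edges, possibly with loops. An $H$-coloring of $G$ is a map $f:V(G)\to V(H)$ with $f(u)f(v)\in E(H)$ whenever $uv\in E(G)$; $\mathrm{Hom}(G,H)$ is the set of these. Given positive weights $\Lambda=\{\lambda_i:i\in V(H)\}$, set $w_\Lambda(f)=\prod_{v\in V}\lambda_{f(v)}$ for $f\in\mathrm{Hom}(T_{m,d},H)$, $w_\Lambda(S)=\sum_{f\in S}w_\Lambda(f)$, $Z_\Lambda(T_{m,d},H)=w_\Lambda(\mathrm{Hom}(T_{m,d},H))$, and $\lambda_T=\sum_{k\in T}\lambda_k$ for $T\subseteq V(H)$. For $A,B\subseteq V(H)$, write $A\sim B$ if every vertex of $A$ is adjacent in $H$ to every vertex of $B$. Let $\eta_\Lambda(H)=\max\{\lambda_A\lambda_B: A,B\subseteq V(H), A\sim B\}$ and $\mathcal{M}_\Lambda(H)=\{(A,B): A,B\subseteq V(H), A\sim B, \lambda_A\lambda_B=\eta_\Lambda(H)\}$. Asymptotic notation refers to $d\to\infty$ with $m,H,\Lambda$ fixed: $2^{-\Omega(d)}$ denotes a quantity at most $2^{-cd}$ and $(m-\Omega(1))^d$ a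 quantity at most $(m-c)^d$, for some constant $c>0$ depending only on $m,H,\Lambda$, valid for all sufficiently large $d$. *)

theory Defs
  imports Complex_Main "HOL-Library.FuncSet" "HOL-Library.Disjoint_Sets"
    "HOL-Number_Theory.Cong"
begin

text \<open>An undirected graph is a pair of a vertex set and a set of unordered edges; a loop at
  \<open>u\<close> is the edge \<open>{u, u} = {u}\<close>. Edges being a set of sets, there are no multiple edges.\<close>

type_synonym 'a ugraph = "'a set \<times> 'a set set"

abbreviation verts :: "'a ugraph \<Rightarrow> 'a set" where
  "verts G \<equiv> fst G"

abbreviation edges :: "'a ugraph \<Rightarrow> 'a set set" where
  "edges G \<equiv> snd G"

definition finite_loop_graph :: "'a ugraph \<Rightarrow> bool" where
  "finite_loop_graph G \<longleftrightarrow>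
     finite (verts G) \<and> edges G \<subseteq> {{u, v} | u v. u \<in> verts G \<and> v \<in> verts G}"

definition nbhd :: "'a ugraph \<Rightarrow> 'a \<Rightarrow> 'a set" where
  "nbhd G x = {y. {x, y} \<in> edges G}"

text \<open>Colorings are extensional functions (\<open>undefined\<close> outside \<open>verts G\<close>), so that distinct
  elements of \<open>Hom G H\<close> are distinct as maps on \<open>verts G\<close>.\<close>

definition Hom :: "'a ugraph \<Rightarrow> 'h ugraph \<Rightarrow> ('a \<Rightarrow> 'h) set" where
  "Hom G H = {f \<in> verts G \<rightarrow>\<^sub>E verts H. \<forall>u v. {u, v} \<in> edges G \<longrightarrow> {f u, f v} \<in> edges H}"

text \<open>Strings of length \<open>d\<close> over \<open>{0, ..., m - 1}\<close> are extensional functions on \<open>{..<d}\<close>.\<close>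

definition torus_verts :: "nat \<Rightarrow> nat \<Rightarrow> (nat \<Rightarrow> nat) set" where
  "torus_verts m d = {..<d} \<rightarrow>\<^sub>E {..<m}"

definition torus_adj :: "nat \<Rightarrow> nat \<Rightarrow> (nat \<Rightarrow> nat) \<Rightarrow> (nat \<Rightarrow> nat) \<Rightarrow> bool" where
  "torus_adj m d x y \<longleftrightarrow>
     (\<exists>i<d. ([x i + 1 = y i] (mod m) \<or> [y i + 1 = x i] (mod m)) \<and>
            (\<forall>j<d. j \<noteq> i \<longrightarrow> x j = y j))"

definition torus :: "nat \<Rightarrow> nat \<Rightarrow> (nat \<Rightarrow> nat) ugraph" where
  "torus m d =
     (torus_verts m d,
      {{x, y} | x y. x \<in> torus_verts m d \<and> y \<in> torus_verts m d \<and> torus_adj m d x y})"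

definition even_class :: "nat \<Rightarrow> nat \<Rightarrow> (nat \<Rightarrow> nat) set" where
  "even_class m d = {x \<in> torus_verts m d. even (\<Sum>i<d. x i)}"

definition odd_class :: "nat \<Rightarrow> nat \<Rightarrow> (nat \<Rightarrow> nat) set" where
  "odd_class m d = {x \<in> torus_verts m d. odd (\<Sum>i<d. x i)}"

definition col_weight :: "('h \<Rightarrow> real) \<Rightarrow> 'a ugraph \<Rightarrow> ('a \<Rightarrow> 'h) \<Rightarrow> real" where
  "col_weight lam G f = (\<Prod>v\<in>verts G. lam (f v))"

definition set_weight :: "('h \<Rightarrow> real) \<Rightarrow> 'a ugraph \<Rightarrow> ('a \<Rightarrow> 'h) set \<Rightarrow> real" where
  "set_weight lam G S = (\<Sum>f\<in>S. col_weight lam G f)"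

definition partition_function :: "('h \<Rightarrow> real) \<Rightarrow> 'a ugraph \<Rightarrow> 'h ugraph \<Rightarrow> real" where
  "partition_function lam G H = set_weight lam G (Hom G H)"

definition fully_adjacent :: "'h ugraph \<Rightarrow> 'h set \<Rightarrow> 'h set \<Rightarrow> bool" where
  "fully_adjacent H A B \<longleftrightarrow> (\<forall>a\<in>A. \<forall>b\<in>B. {a, b} \<in> edges H)"

definition eta :: "('h \<Rightarrow> real) \<Rightarrow> 'h ugraph \<Rightarrow> real" where
  "eta lam H =
     Max {sum lam A * sum lam B | A B.
            A \<subseteq> verts H \<and> B \<subseteq> verts H \<and> fully_adjacent H A B}"

definition max_pairs :: "('h \<Rightarrow> real) \<Rightarrow> 'h ugraph \<Rightarrow> ('h set \<times> 'h set) set" where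
  "max_pairs lam H =
     {(A, B). A \<subseteq> verts H \<and> B \<subseteq> verts H \<and> fully_adjacent H A B \<and>
              sum lam A * sum lam B = eta lam H}"

end

theory Submission
  imports Defs "HOL-Analysis.Convex"
begin

text \<open>
  Every sub-probability \<open>q\<close> on colourings with \<open>q f \<ge> w f * exp (gain f) / eta ^ n\<close>, where
  \<open>n = m ^ d / 2\<close>, shows that the colourings of gain at least \<open>t\<close> have weight at most
  \<open>exp (- t) * eta ^ n \<le> exp (- t) * Z\<close>. Such a \<open>q\<close> is built vertex by vertex in the order of the
  distance to the origin, as a geometric mean of the proposals of the \<open>D\<close> neighbours; by AM-GM this
  is again a sub-probability. The proposal of an odd vertex \<open>v\<close> guesses the set of colours on its
  neighbourhood from the sets seen nearby at smaller distance, at a cost exponentially small in \<open>d\<close>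
  when the guess is right. A vertex whose neighbourhood does not exhibit an optimal pair, or two
  nearby vertices that exhibit different sets, yield a positive gain. Doing this for the order and
  for its reverse, a colouring of gain at most \<open>D\<close> has a locally constant phase outside an
  exponentially small proportion of the vertices, and the edge expansion of the torus makes
  the phase globally constant.
\<close>

section \<open>An ordered Shearer inequality\<close>

text \<open>The bounds wanted are \<open>(m - c)^d\<close> among \<open>m^d\<close> vertices, and
  passing from local to global constancy costs a factor polynomial in \<open>d\<close>. So the total
  price of guessing must be exponentially smaller than the number of vertices. This fixes the
  balance of the proof: the prior keeps a mass \<open>delta\<close>, exponentially small in
  \<open>D\<close>, for unexpected guesses. An expected guess then costs at most
  \<open>2 * delta\<close>, and any other at most \<open>- ln base\<close>, which is below
  \<open>eps * D\<close> with \<open>eps\<close> as small as desired. A bad or dull vertex gains a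
  fixed multiple of \<open>D\<close> and so pays for its own wrong guess. The obstacle is a change
  of phase between vertices that are each optimal in themselves: nothing is gained at either of
  them, yet the guess fails. There the common neighbour must take a colour from both sets, and the
  tilt \<open>theta * psi\<close> turns this restriction into a gain.\<close>

lemma sum_prod_root_le_prod_sum_root:
  fixes x :: "'j \<Rightarrow> 'a \<Rightarrow> real"
  assumes "finite J" "J \<noteq> {}" "finite K"
    and nonneg: "\<And>j a. j \<in> J \<Longrightarrow> a \<in> K \<Longrightarrow> 0 \<le> x j a"
  shows "(\<Sum>a\<in>K. \<Prod>j\<in>J. x j a powr (1 / card J)) \<le> (\<Prod>j\<in>J. (\<Sum>a\<in>K. x j a) powr (1 / card J))"
proof (cases "\<exists>j\<in>J. (\<Sum>a\<in>K. x j a) = 0")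
  case True
  then obtain j where j: "j \<in> J" "(\<Sum>a\<in>K. x j a) = 0" by blast
  then have "x j a = 0" if "a \<in> K" for a
    using that nonneg \<open>finite K\<close> by (simp add: sum_nonneg_eq_0_iff)
  then have "(\<Prod>j\<in>J. x j a powr (1 / card J)) = 0" if "a \<in> K" for a
    using that j \<open>finite J\<close> by (intro prod_zero) (auto intro!: bexI[of _ j])
  then show ?thesis by (simp add: prod_nonneg)
next
  case False
  \<comment> \<open>This is Hoelder's inequality with equal exponents: after division by the sums
    \<open>s j\<close> it is AM-GM at each \<open>a\<close>, and the normalised terms add up to
    1.\<close>
  define s where "s j = (\<Sum>a\<in>K. x j a)" for j
  have s: "s j > 0" if "j \<in> J" for j
    using False that sum_nonneg[of K "x j"] nonneg by (force simp: s_def less_le)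
  have card: "card J > 0" using assms by (simp add: card_gt_0_iff)
  have le: "(\<Prod>j\<in>J. x j a powr (1 / card J))
      \<le> (\<Prod>j\<in>J. s j powr (1 / card J)) * (\<Sum>j\<in>J. x j a / s j / card J)" if a: "a \<in> K" for a
  proof -
    have q: "x j a / s j \<ge> 0" if "j \<in> J" for j
      using nonneg[OF that a] s[OF that] by simp
    have "(\<Prod>j\<in>J. x j a powr (1 / card J)) =
        (\<Prod>j\<in>J. s j powr (1 / card J)) * (\<Prod>j\<in>J. (x j a / s j) powr (1 / card J))"
      unfolding prod.distrib[symmetric]
    proof (rule prod.cong)
      fix j assume "j \<in> J"
      then show "x j a powr (1 / card J) = s j powr (1 / card J) * (x j a / s j) powr (1 / card J)"
        using s[of j] q[of j] by (simp add: powr_mult[symmetric])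
    qed simp
    also have "(\<Prod>j\<in>J. (x j a / s j) powr (1 / card J)) = (\<Prod>j\<in>J. x j a / s j) powr (1 / card J)"
      using q by (simp add: prod_powr_distrib)
    also have "\<dots> \<le> (\<Sum>j\<in>J. x j a / s j / card J)"
      using assms q by (intro arith_geom_mean) auto
    finally show ?thesis
      by (simp add: mult_left_mono prod_nonneg)
  qed
  have "(\<Sum>a\<in>K. \<Prod>j\<in>J. x j a powr (1 / card J))
      \<le> (\<Sum>a\<in>K. (\<Prod>j\<in>J. s j powr (1 / card J)) * (\<Sum>j\<in>J. x j a / s j / card J))"
    by (intro sum_mono le)
  also have "\<dots> = (\<Prod>j\<in>J. s j powr (1 / card J)) * (\<Sum>j\<in>J. \<Sum>a\<in>K. x j a / s j / card J)"
    by (simp add: sum_distrib_left[symmetric] sum.swap[of _ K])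
  also have "(\<Sum>j\<in>J. \<Sum>a\<in>K. x j a / s j / card J) = (\<Sum>j\<in>J. 1 / card J)"
    using s by (intro sum.cong) (simp_all add: sum_divide_distrib[symmetric] s_def[symmetric] less_imp_neq[symmetric])
  also have "\<dots> = 1" using card by simp
  finally show ?thesis by (simp add: s_def)
qed

lemma sum_PiE_insert:
  assumes "w \<notin> U"
  shows "(\<Sum>g\<in>insert w U \<rightarrow>\<^sub>E K. F g) = (\<Sum>g\<in>U \<rightarrow>\<^sub>E K. \<Sum>a\<in>K. F (g(w := a)))"
proof -
  have "(\<Sum>g\<in>insert w U \<rightarrow>\<^sub>E K. F g) = (\<Sum>(a, g)\<in>K \<times> (U \<rightarrow>\<^sub>E K). F (g(w := a)))"
    unfolding PiE_insert_eq
    by (subst sum.reindex[OF inj_combinator[OF assms]]) (simp add: case_prod_beta' comp_def)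
  also have "\<dots> = (\<Sum>g\<in>U \<rightarrow>\<^sub>E K. \<Sum>a\<in>K. F (g(w := a)))"
    by (subst sum.cartesian_product[symmetric]) (rule sum.swap)
  finally show ?thesis .
qed

text \<open>
  A form of Shearer's lemma without entropy: \<open>Q j U\<close> is the probability that the code \<open>j\<close> assigns to
  the colours already revealed on \<open>U\<close>, and each vertex lies in the range of exactly \<open>D\<close> codes.
\<close>

lemma ordered_shearer:
  fixes Q :: "'j \<Rightarrow> 'a set \<Rightarrow> ('a \<Rightarrow> 'h) \<Rightarrow> real" and rk :: "'a \<Rightarrow> nat"
  assumes fin: "finite V" "finite J" "finite K" and D: "D > 0"
    and deg: "\<And>w. w \<in> V \<Longrightarrow> card {j \<in> J. w \<in> S j} = D"
    and nonneg: "\<And>j U g. j \<in> J \<Longrightarrow> 0 \<le> Q j U g"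
    and start: "\<And>j g. j \<in> J \<Longrightarrow> Q j {} g \<le> 1"
    and step_in: "\<And>j U w g. j \<in> J \<Longrightarrow> w \<in> S j \<Longrightarrow> w \<in> V \<Longrightarrow> U \<subseteq> V - {w} \<Longrightarrow>
        (\<And>x. x \<in> U \<Longrightarrow> rk x \<le> rk w) \<Longrightarrow> (\<Sum>a\<in>K. Q j (insert w U) (g(w := a))) \<le> Q j U g"
    and step_out: "\<And>j U w g a. j \<in> J \<Longrightarrow> w \<notin> S j \<Longrightarrow> w \<in> V \<Longrightarrow> U \<subseteq> V - {w} \<Longrightarrow>
        (\<And>x. x \<in> U \<Longrightarrow> rk x \<le> rk w) \<Longrightarrow> Q j (insert w U) (g(w := a)) \<le> Q j U g"
  shows "(\<Sum>g\<in>V \<rightarrow>\<^sub>E K. \<Prod>j\<in>J. Q j V g powr (1 / D)) \<le> 1"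
proof -
  have "(\<Sum>g\<in>U \<rightarrow>\<^sub>E K. \<Prod>j\<in>J. Q j U g powr (1 / D)) \<le> 1" if "finite U" "U \<subseteq> V" for U
    using that
  proof (induction rule: finite_ranking_induct[where f = rk])
    case empty
    have "(\<Prod>j\<in>J. Q j {} g powr (1 / D)) \<le> 1" for g
      using nonneg start by (intro prod_le_1) (auto intro!: powr_le1)
    then show ?case by simp
  next
    \<comment> \<open>The induction adds a vertex \<open>w\<close> of maximal rank, so the vertices
      are revealed in the order of \<open>rk\<close>.\<close>
    case (insert w U)
    show ?case
    proof (cases "w \<in> U")
      case True
      then show ?thesis using insert by (simp add: insert_absorb)
    next
      case False
      have U: "U \<subseteq> V - {w}" "w \<in> V" "\<And>x. x \<in> U \<Longrightarrow> rk x \<le> rk w"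
        using insert False by auto
      \<comment> \<open>Exactly \<open>D\<close> codes have \<open>w\<close> in their range, so
        their exponents \<open>1 / D\<close> sum to 1 and Hoelder's inequality takes the sum over
        the colour of \<open>w\<close> inside. The codes in \<open>J2\<close> do not increase,
        whatever that colour is.\<close>
      define J1 where "J1 = {j \<in> J. w \<in> S j}"
      define J2 where "J2 = {j \<in> J. w \<notin> S j}"
      have J: "J = J1 \<union> J2" "J1 \<inter> J2 = {}" "finite J1" "finite J2"
        using fin by (auto simp: J1_def J2_def)
      have card: "card J1 = D" using deg U by (simp add: J1_def)
      then have ne: "J1 \<noteq> {}" using D by auto
      have "(\<Sum>a\<in>K. \<Prod>j\<in>J. Q j (insert w U) (g(w := a)) powr (1 / D))
          \<le> (\<Prod>j\<in>J. Q j U g powr (1 / D))" for g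
      proof -
        have "(\<Sum>a\<in>K. \<Prod>j\<in>J. Q j (insert w U) (g(w := a)) powr (1 / D))
          \<le> (\<Sum>a\<in>K. (\<Prod>j\<in>J1. Q j (insert w U) (g(w := a)) powr (1 / D)) * (\<Prod>j\<in>J2. Q j U g powr (1 / D)))"
          unfolding J(1) using J(2-4)
          by (subst prod.union_disjoint)
             (auto intro!: sum_mono mult_left_mono prod_mono powr_mono2 prod_nonneg nonneg step_out U
                simp: J2_def)
        also have "\<dots> = (\<Sum>a\<in>K. \<Prod>j\<in>J1. Q j (insert w U) (g(w := a)) powr (1 / card J1)) *
            (\<Prod>j\<in>J2. Q j U g powr (1 / D))"
          by (simp add: sum_distrib_right card)
        also have "\<dots> \<le> (\<Prod>j\<in>J1. (\<Sum>a\<in>K. Q j (insert w U) (g(w := a))) powr (1 / card J1)) *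
            (\<Prod>j\<in>J2. Q j U g powr (1 / D))"
          using J fin ne nonneg
          by (intro mult_right_mono sum_prod_root_le_prod_sum_root) (auto intro!: prod_nonneg)
        also have "\<dots> \<le> (\<Prod>j\<in>J1. Q j U g powr (1 / card J1)) * (\<Prod>j\<in>J2. Q j U g powr (1 / D))"
          using U by (intro mult_right_mono prod_mono conjI powr_mono2 step_in)
            (auto intro!: prod_nonneg sum_nonneg nonneg simp: J1_def)
        also have "\<dots> = (\<Prod>j\<in>J. Q j U g powr (1 / D))"
          unfolding J(1) using J(2-4) by (simp add: prod.union_disjoint card)
        finally show ?thesis .
      qed
      then have "(\<Sum>g\<in>insert w U \<rightarrow>\<^sub>E K. \<Prod>j\<in>J. Q j (insert w U) g powr (1 / D))
          \<le> (\<Sum>g\<in>U \<rightarrow>\<^sub>E K. \<Prod>j\<in>J. Q j U g powr (1 / D))"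
        unfolding sum_PiE_insert[OF False] by (rule sum_mono)
      also have "\<dots> \<le> 1" using insert.IH U by auto
      finally show ?thesis .
    qed
  qed
  then show ?thesis using fin by blast
qed

text \<open>Specialises \<open>ordered_shearer\<close> to codes that draw a guess \<open>c\<close>
  from a prior and then colour \<open>S j\<close> vertex by vertex. Locality means that the prior
  sees only vertices ranked strictly below all of \<open>S j\<close>, and the kernel at
  \<open>x\<close> only those ranked strictly below \<open>x\<close>.\<close>

lemma mixture_code:
  fixes pr :: "'j \<Rightarrow> ('a \<Rightarrow> 'h) \<Rightarrow> 'c \<Rightarrow> real" and rk :: "'a \<Rightarrow> nat"
    and ker :: "'j \<Rightarrow> 'a \<Rightarrow> 'c \<Rightarrow> ('a \<Rightarrow> 'h) \<Rightarrow> 'h \<Rightarrow> real"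
  assumes fin: "finite V" "finite J" "finite K" "finite C" and D: "D > 0"
    and S: "\<And>j. j \<in> J \<Longrightarrow> S j \<subseteq> V"
    and deg: "\<And>w. w \<in> V \<Longrightarrow> card {j \<in> J. w \<in> S j} = D"
    and pr_nonneg: "\<And>j g c. j \<in> J \<Longrightarrow> c \<in> C \<Longrightarrow> 0 \<le> pr j g c"
    and pr_sum: "\<And>j g. j \<in> J \<Longrightarrow> (\<Sum>c\<in>C. pr j g c) \<le> 1"
    and ker_nonneg: "\<And>j x c g a. j \<in> J \<Longrightarrow> x \<in> S j \<Longrightarrow> c \<in> C \<Longrightarrow> 0 \<le> ker j x c g a"
    and ker_sum: "\<And>j x c g. j \<in> J \<Longrightarrow> x \<in> S j \<Longrightarrow> c \<in> C \<Longrightarrow> (\<Sum>a\<in>K. ker j x c g a) \<le> 1"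
    and pr_local: "\<And>j x y c g a. j \<in> J \<Longrightarrow> x \<in> S j \<Longrightarrow> y \<in> V \<Longrightarrow> rk x \<le> rk y \<Longrightarrow> c \<in> C \<Longrightarrow>
        pr j (g(y := a)) c = pr j g c"
    and ker_local: "\<And>j x y c g a. j \<in> J \<Longrightarrow> x \<in> S j \<Longrightarrow> y \<in> V \<Longrightarrow> rk x \<le> rk y \<Longrightarrow> c \<in> C \<Longrightarrow>
        ker j x c (g(y := a)) = ker j x c g"
    and ne: "\<And>j. j \<in> J \<Longrightarrow> S j \<noteq> {}"
  shows "(\<Sum>g\<in>V \<rightarrow>\<^sub>E K. \<Prod>j\<in>J. (\<Sum>c\<in>C. pr j g c * (\<Prod>x\<in>S j. ker j x c g (g x))) powr (1 / D)) \<le> 1"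
proof -
  \<comment> \<open>Until a vertex of \<open>S j\<close> is revealed the prior can still change, so
    the code has the value 1; \<open>pr_sum\<close> pays for the passage to the mixture at the first
    such vertex. From then on \<open>pr_local\<close> freezes the prior.\<close>
  define Q where "Q j U g = (if S j \<inter> U = {} then 1
      else (\<Sum>c\<in>C. pr j g c * (\<Prod>x\<in>S j \<inter> U. ker j x c g (g x))))" for j U g
  have finS: "finite (S j \<inter> U)" if "j \<in> J" for j U
    using S[OF that] fin finite_subset by blast
  have "(\<Sum>g\<in>V \<rightarrow>\<^sub>E K. \<Prod>j\<in>J. Q j V g powr (1 / D)) \<le> 1"
  proof (rule ordered_shearer[where rk = rk and S = S])
    show "0 \<le> Q j U g" if "j \<in> J" for j U g
      using that by (auto simp: Q_def intro!: sum_nonneg mult_nonneg_nonneg prod_nonneg pr_nonneg ker_nonneg)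
    show "Q j {} g \<le> 1" for j g by (simp add: Q_def)
    show "(\<Sum>a\<in>K. Q j (insert w U) (g(w := a))) \<le> Q j U g"
      if j: "j \<in> J" and w: "w \<in> S j" "w \<in> V" and U: "U \<subseteq> V - {w}"
        and rk: "\<And>x. x \<in> U \<Longrightarrow> rk x \<le> rk w" for j U w g
    proof -
      have eq: "Q j (insert w U) (g(w := a)) =
         (\<Sum>c\<in>C. pr j g c * (\<Prod>x\<in>S j \<inter> U. ker j x c g (g x)) * ker j w c g a)" for a
      proof -
        have "(\<Prod>x\<in>S j \<inter> insert w U. ker j x c (g(w := a)) ((g(w := a)) x)) =
           ker j w c g a * (\<Prod>x\<in>S j \<inter> U. ker j x c g (g x))" if c: "c \<in> C" for c
        proof -
          have ins: "S j \<inter> insert w U = insert w (S j \<inter> U)" using w by auto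
          have notin: "w \<notin> S j \<inter> U" using U by auto
          have "(\<Prod>x\<in>S j \<inter> U. ker j x c (g(w := a)) ((g(w := a)) x)) = (\<Prod>x\<in>S j \<inter> U. ker j x c g (g x))"
          proof (rule prod.cong)
            fix x assume x: "x \<in> S j \<inter> U"
            then have "x \<noteq> w" using U by auto
            then show "ker j x c (g(w := a)) ((g(w := a)) x) = ker j x c g (g x)"
              using x ker_local[OF j _ w(2) rk c, of x] by simp
          qed simp
          moreover have "ker j w c (g(w := a)) = ker j w c g"
            by (rule ker_local[OF j w(1) w(2) order_refl c])
          ultimately show ?thesis
            unfolding ins by (subst prod.insert[OF finS[OF j] notin]) simp
        qed
        moreover have "pr j (g(w := a)) c = pr j g c" if "c \<in> C" for c
          by (rule pr_local[OF j w order_refl that])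
        ultimately show ?thesis
          using w by (auto simp: Q_def mult_ac intro!: sum.cong)
      qed
      have "(\<Sum>a\<in>K. Q j (insert w U) (g(w := a))) =
         (\<Sum>c\<in>C. pr j g c * (\<Prod>x\<in>S j \<inter> U. ker j x c g (g x)) * (\<Sum>a\<in>K. ker j w c g a))"
        unfolding eq by (subst sum.swap) (simp add: sum_distrib_left)
      also have "\<dots> \<le> (\<Sum>c\<in>C. pr j g c * (\<Prod>x\<in>S j \<inter> U. ker j x c g (g x)) * 1)"
        using j w by (intro sum_mono mult_left_mono ker_sum mult_nonneg_nonneg prod_nonneg)
          (auto intro!: pr_nonneg ker_nonneg)
      also have "\<dots> \<le> Q j U g"
        using pr_sum[OF j] by (auto simp: Q_def)
      finally show ?thesis .
    qed
    show "Q j (insert w U) (g(w := a)) \<le> Q j U g"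
      if j: "j \<in> J" and w: "w \<notin> S j" "w \<in> V" and U: "U \<subseteq> V - {w}"
        and rk: "\<And>x. x \<in> U \<Longrightarrow> rk x \<le> rk w" for j U w g a
    proof (cases "S j \<inter> U = {}")
      case True
      then show ?thesis using w by (auto simp: Q_def)
    next
      case False
      then obtain x0 where x0: "x0 \<in> S j" "x0 \<in> U" by auto
      have "pr j (g(w := a)) c = pr j g c" if "c \<in> C" for c
        by (rule pr_local[OF j x0(1) w(2) rk[OF x0(2)] that])
      moreover have "(\<Prod>x\<in>S j \<inter> U. ker j x c (g(w := a)) ((g(w := a)) x)) = (\<Prod>x\<in>S j \<inter> U. ker j x c g (g x))"
        if c: "c \<in> C" for c
      proof (rule prod.cong)
        fix x assume x: "x \<in> S j \<inter> U"
        then have "x \<noteq> w" using U by auto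
        then show "ker j x c (g(w := a)) ((g(w := a)) x) = ker j x c g (g x)"
          using x ker_local[OF j _ w(2) rk c, of x] by simp
      qed simp
      moreover have "S j \<inter> insert w U = S j \<inter> U" using w by auto
      ultimately show ?thesis using False by (simp add: Q_def cong: sum.cong)
    qed
  qed (use fin D deg in auto)
  moreover have "S j \<inter> V = S j" if "j \<in> J" for j using S[OF that] by auto
  ultimately show ?thesis using ne by (simp add: Q_def cong: prod.cong sum.cong)
qed

section \<open>Codes on a ranked bipartite graph\<close>

lemma ln_one_minus_ge:
  fixes t :: real
  assumes "0 \<le> t" "t \<le> 1/2"
  shows "- 2 * t \<le> ln (1 - t)"
proof -
  have "- t - 2 * t\<^sup>2 \<le> ln (1 - t)"
    using assms by (intro ln_one_minus_pos_lower_bound) auto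
  moreover have "2 * t\<^sup>2 \<le> t"
    using assms mult_left_mono[of t "1/2" t] by (simp add: power2_eq_square)
  ultimately show ?thesis by linarith
qed

text \<open>For given \<open>A\<close> this is the heaviest partner, so optimal pairs are sought
  only in the form of a set \<open>A\<close> with its common neighbours.\<close>

definition common_nbrs :: "'h set \<Rightarrow> ('h \<Rightarrow> 'h \<Rightarrow> bool) \<Rightarrow> 'h set \<Rightarrow> 'h set" where
  "common_nbrs K adj A = {b \<in> K. \<forall>a\<in>A. adj a b}"

text \<open>The torus enters the coding argument only as a \<open>D\<close>-regular bipartite graph
  whose rank changes by one along every edge. Hence the same lemmas serve for the order by distance
  and for its reverse.\<close>

locale ranked_bipartite =
  fixes Ev Od :: "'a set" and N :: "'a \<Rightarrow> 'a set" and rho :: "'a \<Rightarrow> nat" and D :: nat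
    and K :: "'h set" and lam :: "'h \<Rightarrow> real" and adj :: "'h \<Rightarrow> 'h \<Rightarrow> bool"
  assumes fin: "finite Ev" "finite Od" "finite K"
    and disj: "Ev \<inter> Od = {}"
    and N_Od: "v \<in> Od \<Longrightarrow> N v \<subseteq> Ev"
    and N_Ev: "w \<in> Ev \<Longrightarrow> N w \<subseteq> Od"
    and N_sym: "x \<in> Ev \<union> Od \<Longrightarrow> y \<in> N x \<Longrightarrow> x \<in> N y"
    and card_N: "x \<in> Ev \<union> Od \<Longrightarrow> card (N x) = D"
    and D_pos: "0 < D"
    and rho_N: "x \<in> Ev \<union> Od \<Longrightarrow> y \<in> N x \<Longrightarrow> rho y = Suc (rho x) \<or> rho x = Suc (rho y)"
    and lam_pos: "a \<in> K \<Longrightarrow> 0 < lam a"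
begin

definition dn :: "'a \<Rightarrow> 'a set" where "dn x = {y \<in> N x. rho y < rho x}"
definition up :: "'a \<Rightarrow> 'a set" where "up x = {y \<in> N x. rho x < rho y}"
abbreviation CN :: "'h set \<Rightarrow> 'h set" where "CN \<equiv> common_nbrs K adj"
definition paths :: "'a \<Rightarrow> ('a \<times> 'a) set" where "paths v = Sigma (dn v) dn"
text \<open>Counts descending two-step paths by a property of their ends. These are the pairs that
  the prior compares: the colours below \<open>u\<close> are already known when the neighbours of
  \<open>v\<close> are coloured.\<close>

definition psum :: "('a \<Rightarrow> 'a \<Rightarrow> bool) \<Rightarrow> real" where
  "psum P = (\<Sum>v\<in>Od. \<Sum>y\<in>dn v. \<Sum>u\<in>dn y. of_bool (P v u))"
definition coloring :: "('a \<Rightarrow> 'h) \<Rightarrow> bool" where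
  "coloring f \<longleftrightarrow> (\<forall>x\<in>Ev \<union> Od. f x \<in> K \<and> (\<forall>y\<in>N x. adj (f x) (f y)))"

lemma finite_N: "x \<in> Ev \<union> Od \<Longrightarrow> finite (N x)"
  using card_N[of x] D_pos card.infinite by fastforce

lemma dn_subset: "dn x \<subseteq> N x" and up_subset: "up x \<subseteq> N x"
  by (auto simp: dn_def up_def)

lemma dn_Od: "v \<in> Od \<Longrightarrow> dn v \<subseteq> Ev" and up_Od: "v \<in> Od \<Longrightarrow> up v \<subseteq> Ev"
  and dn_Ev: "w \<in> Ev \<Longrightarrow> dn w \<subseteq> Od"
  using N_Od N_Ev dn_subset up_subset by blast+

lemma finite_dn: "x \<in> Ev \<union> Od \<Longrightarrow> finite (dn x)" and finite_up: "x \<in> Ev \<union> Od \<Longrightarrow> finite (up x)"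
  using finite_N dn_subset up_subset finite_subset by metis+

lemma N_eq: "x \<in> Ev \<union> Od \<Longrightarrow> N x = dn x \<union> up x"
proof -
  assume x: "x \<in> Ev \<union> Od"
  have "rho y < rho x \<or> rho x < rho y" if "y \<in> N x" for y
    using rho_N[OF x that] by auto
  then show ?thesis by (auto simp: dn_def up_def)
qed

lemma dn_up_disjoint: "dn x \<inter> up x = {}"
  by (auto simp: dn_def up_def)

lemma card_dn_up: "x \<in> Ev \<union> Od \<Longrightarrow> card (dn x) + card (up x) = D"
  using card_Un_disjoint[OF finite_dn finite_up dn_up_disjoint] N_eq card_N by simp

lemma card_dn_le: "x \<in> Ev \<union> Od \<Longrightarrow> card (dn x) \<le> D"
  using card_dn_up[of x] by linarith

lemma sum_N_Od: "(\<Sum>v\<in>Od. \<Sum>y\<in>N v. F y) = real D * (\<Sum>y\<in>Ev. F y)"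
proof -
  have "(\<Sum>v\<in>Od. \<Sum>y\<in>N v. F y) = (\<Sum>(v, y)\<in>Sigma Od N. F y)"
    using fin finite_N by (subst sum.Sigma) auto
  also have "\<dots> = (\<Sum>(y, v)\<in>Sigma Ev N. F y)"
    using N_Od N_Ev N_sym
    by (intro sum.reindex_bij_witness[of _ "\<lambda>(y, v). (v, y)" "\<lambda>(y, v). (v, y)"]) auto
  also have "\<dots> = (\<Sum>y\<in>Ev. \<Sum>v\<in>N y. F y)"
    using fin finite_N by (subst sum.Sigma) auto
  also have "\<dots> = real D * (\<Sum>y\<in>Ev. F y)"
    by (simp add: card_N sum_distrib_left)
  finally show ?thesis .
qed

lemma sum_N_Ev: "(\<Sum>v\<in>Ev. \<Sum>y\<in>N v. F y) = real D * (\<Sum>y\<in>Od. F y)"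
proof -
  have "(\<Sum>v\<in>Ev. \<Sum>y\<in>N v. F y) = (\<Sum>(v, y)\<in>Sigma Ev N. F y)"
    using fin finite_N by (subst sum.Sigma) auto
  also have "\<dots> = (\<Sum>(y, v)\<in>Sigma Od N. F y)"
    using N_Od N_Ev N_sym
    by (intro sum.reindex_bij_witness[of _ "\<lambda>(y, v). (v, y)" "\<lambda>(y, v). (v, y)"]) auto
  also have "\<dots> = (\<Sum>y\<in>Od. \<Sum>v\<in>N y. F y)"
    using fin finite_N by (subst sum.Sigma) auto
  also have "\<dots> = real D * (\<Sum>y\<in>Od. F y)"
    by (simp add: card_N sum_distrib_left)
  finally show ?thesis .
qed

lemma card_Ev_Od: "card Ev = card Od"
  using sum_N_Od[of "\<lambda>_. 1"] D_pos by (simp add: card_N)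

lemma psum_snd_le: "psum (\<lambda>v u. P u) \<le> (real D)\<^sup>2 * card {u \<in> Od. P u}"
proof -
  have "psum (\<lambda>v u. P u) \<le> (\<Sum>v\<in>Od. \<Sum>y\<in>N v. \<Sum>u\<in>N y. of_bool (P u))"
    unfolding psum_def
  proof (rule sum_mono)
    fix v assume v: "v \<in> Od"
    have "(\<Sum>y\<in>dn v. \<Sum>u\<in>dn y. of_bool (P u)) \<le> (\<Sum>y\<in>dn v. \<Sum>u\<in>N y. (of_bool (P u) :: real))"
    proof (intro sum_mono sum_mono2 dn_subset)
      show "finite (N y)" if "y \<in> dn v" for y
        using finite_N[of y] dn_Od[OF v] that by auto
    qed auto
    also have "\<dots> \<le> (\<Sum>y\<in>N v. \<Sum>u\<in>N y. of_bool (P u))"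
      using v finite_N dn_subset by (intro sum_mono2) (auto intro!: sum_nonneg)
    finally show "(\<Sum>y\<in>dn v. \<Sum>u\<in>dn y. of_bool (P u)) \<le> (\<Sum>y\<in>N v. \<Sum>u\<in>N y. (of_bool (P u) :: real))" .
  qed
  also have "\<dots> = real D * (real D * (\<Sum>u\<in>Od. of_bool (P u)))"
    by (simp only: sum_N_Od sum_N_Ev)
  also have "(\<Sum>u\<in>Od. of_bool (P u)) = real (card {u \<in> Od. P u})"
    using fin by (simp add: Collect_conj_eq)
  finally show ?thesis by (simp add: power2_eq_square)
qed

lemma psum_fst_le: "psum (\<lambda>v u. P v) \<le> (real D)\<^sup>2 * card {v \<in> Od. P v}"
proof -
  have "psum (\<lambda>v u. P v) = (\<Sum>v\<in>Od. real (\<Sum>y\<in>dn v. card (dn y)) * of_bool (P v))"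
    by (simp add: psum_def sum_distrib_right)
  also have "\<dots> \<le> (\<Sum>v\<in>Od. (real D)\<^sup>2 * of_bool (P v))"
  proof (intro sum_mono mult_right_mono)
    fix v assume v: "v \<in> Od"
    have "real (\<Sum>y\<in>dn v. card (dn y)) \<le> real (\<Sum>y\<in>dn v. D)"
      using v dn_Od card_dn_le by (intro of_nat_mono sum_mono) auto
    also have "\<dots> \<le> (real D)\<^sup>2"
      using v card_dn_le[of v] by (simp add: power2_eq_square mult_right_mono)
    finally show "real (\<Sum>y\<in>dn v. card (dn y)) \<le> (real D)\<^sup>2" .
  qed simp
  also have "\<dots> = (real D)\<^sup>2 * card {u \<in> Od. P u}"
    using fin by (simp add: sum_distrib_left[symmetric] Collect_conj_eq)
  finally show ?thesis .
qed

lemma psum_mono: "(\<And>v u. v \<in> Od \<Longrightarrow> u \<in> Od \<Longrightarrow> P v u \<Longrightarrow> Q v u) \<Longrightarrow> psum P \<le> psum Q"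
  unfolding psum_def using dn_Od dn_Ev by (intro sum_mono) (metis of_bool_less_eq_iff subsetD)

lemma psum_disj: "psum (\<lambda>v u. P v u \<or> Q v u) \<le> psum P + psum Q"
  unfolding psum_def sum.distrib[symmetric] by (intro sum_mono) auto

lemma psum_nonneg: "0 \<le> psum P"
  unfolding psum_def by (intro sum_nonneg) auto

end

text \<open>\<open>delta\<close> is the prior mass spread evenly over all guesses and
  \<open>theta\<close> the strength of the tilt. \<open>kap\<close> bounds the relative weight of a
  single colour from below; excluding a colour from a set then lowers the logarithm of its weight by
  at least \<open>kap\<close> (\<open>ln_sum_lam_strict_mono\<close>).\<close>

locale coding = ranked_bipartite Ev Od N rho D K lam adj
  for Ev Od :: "'a set" and N rho D and K :: "'h set" and lam adj +
  fixes delta theta kap :: real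
  assumes delta: "0 < delta" "delta \<le> 1/2" and theta: "0 \<le> theta" "theta \<le> 1/2"
    and kap: "0 < kap" "kap \<le> 1" and kap_le: "a \<in> K \<Longrightarrow> kap * sum lam K \<le> lam a"
begin

text \<open>
  A colouring is coded one vertex at a time, first \<open>Ev\<close> by increasing rank, then \<open>Od\<close>. Each
  vertex \<open>v\<close> of \<open>Od\<close> proposes a distribution on the colours of its neighbours: a mixture over
  guesses \<open>(A, B)\<close> for the colour sets of \<open>dn v\<close> and \<open>up v\<close>, the prior being concentrated on
  \<open>A = B =\<close> the set already seen below a random vertex two steps down. The tilt by \<open>psi\<close> lowers
  the weight of a colour at \<open>x\<close> in proportion to the number of lower neighbours of \<open>x\<close> below which
  that colour was not seen; it is what makes a disagreement between the guesses of two nearby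
  vertices profitable. A vertex \<open>w\<close> of \<open>Ev\<close> proposes for its neighbours the weights \<open>lam\<close> on
  the colours compatible with what is already known, and bets a little on a guess for the colour
  set of \<open>N w\<close>.
\<close>

definition psi :: "('a \<Rightarrow> 'h) \<Rightarrow> 'a \<Rightarrow> 'h \<Rightarrow> real" where
  "psi g x a = card {u \<in> dn x. a \<notin> g ` dn u} / D"

definition reach :: "('a \<Rightarrow> 'h) \<Rightarrow> 'a \<Rightarrow> 'h set \<Rightarrow> real" where
  "reach g v A = card {p \<in> paths v. g ` dn (snd p) = A} / card (paths v)"

text \<open>There are \<open>4 ^ card K\<close> guesses \<open>(A, B)\<close>.\<close>

definition base :: real where "base = delta / 4 ^ card K"

definition prior :: "'a \<Rightarrow> ('a \<Rightarrow> 'h) \<Rightarrow> 'h set \<times> 'h set \<Rightarrow> real" where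
  "prior x g = (\<lambda>(A, B). base + (1 - delta) *
     (if x \<in> Od then of_bool (A = B) * reach g x A else of_bool (A = K \<and> B = K)))"

text \<open>A weight of total 0 is sent to 0 by \<open>x / 0 = 0\<close>, which keeps the sum at
  most 1 in every case.\<close>

definition normalize_wt :: "('h \<Rightarrow> real) \<Rightarrow> 'h \<Rightarrow> real" where
  "normalize_wt mu a = mu a / sum mu K"

definition ker :: "'a \<Rightarrow> 'a \<Rightarrow> 'h set \<times> 'h set \<Rightarrow> ('a \<Rightarrow> 'h) \<Rightarrow> 'h \<Rightarrow> real" where
  "ker j x = (\<lambda>(A, B) g.
     if j \<in> Od then
       if rho x < rho j then normalize_wt (\<lambda>a. if a \<in> A then lam a * (1 - theta * psi g x a) else 0)
       else normalize_wt (\<lambda>a. if a \<in> B then lam a else 0)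
     else normalize_wt (\<lambda>a. if a \<in> CN (g ` N x) \<inter> A then lam a else 0))"

definition code :: "('a \<Rightarrow> 'h) \<Rightarrow> 'a \<Rightarrow> real" where
  "code g x = (\<Sum>c\<in>Pow K \<times> Pow K. prior x g c * (\<Prod>y\<in>N x. ker x y c g (g y)))"

text \<open>\<open>sum rho Ev\<close> bounds every rank in \<open>Ev\<close>, so \<open>Od\<close>
  follows as one block. It needs no inner order, since no prior or kernel looks at a colour on
  \<open>Od\<close>.\<close>

definition rk :: "'a \<Rightarrow> nat" where
  "rk x = (if x \<in> Od then Suc (sum rho Ev) else rho x)"

lemma rk_less: "w \<in> Ev \<Longrightarrow> v \<in> Od \<Longrightarrow> rk w < rk v"
  using fin disj member_le_sum[of w Ev rho] by (auto simp: rk_def less_Suc_eq_le)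

lemma rk_Ev: "w \<in> Ev \<Longrightarrow> rk w = rho w"
  using disj by (auto simp: rk_def)

lemma rk_le_cases: "x \<in> Ev \<Longrightarrow> y \<in> Ev \<union> Od \<Longrightarrow> rk x \<le> rk y \<Longrightarrow> y \<in> Od \<or> rho x \<le> rho y"
  using rk_Ev[of x] rk_Ev[of y] by auto

lemma psi_nonneg: "0 \<le> psi g x a" and psi_le_1: "x \<in> Ev \<union> Od \<Longrightarrow> psi g x a \<le> 1"
proof -
  show "0 \<le> psi g x a" by (simp add: psi_def)
  assume x: "x \<in> Ev \<union> Od"
  have "card {u \<in> dn x. a \<notin> g ` dn u} \<le> card (dn x)"
    using finite_dn[OF x] by (intro card_mono) auto
  also have "\<dots> \<le> D" by (rule card_dn_le[OF x])
  finally show "psi g x a \<le> 1" using D_pos by (simp add: psi_def)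
qed

lemma finite_paths: "v \<in> Ev \<union> Od \<Longrightarrow> finite (paths v)"
  unfolding paths_def using finite_dn dn_Od dn_Ev by (intro finite_SigmaI) blast+

lemma reach_nonneg: "0 \<le> reach g v A" by (simp add: reach_def)

lemma sum_reach_le: "v \<in> Ev \<union> Od \<Longrightarrow> finite \<A> \<Longrightarrow> (\<Sum>A\<in>\<A>. reach g v A) \<le> 1"
proof -
  assume v: "v \<in> Ev \<union> Od" and \<A>: "finite \<A>"
  have "(\<Sum>A\<in>\<A>. card {p \<in> paths v. g ` dn (snd p) = A}) = card (\<Union>A\<in>\<A>. {p \<in> paths v. g ` dn (snd p) = A})"
    using finite_paths[OF v] \<A> by (subst card_UN_disjoint) auto
  also have "\<dots> \<le> card (paths v)"
    using finite_paths[OF v] by (intro card_mono) auto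
  finally have "real (\<Sum>A\<in>\<A>. card {p \<in> paths v. g ` dn (snd p) = A}) \<le> card (paths v)"
    by (rule of_nat_mono)
  then show ?thesis
    by (auto simp: reach_def sum_divide_distrib[symmetric] divide_le_eq_1)
qed

lemma base_pos: "0 < base" using delta by (simp add: base_def)

lemma sum_normalize_wt: "(\<Sum>a\<in>K. normalize_wt mu a) \<le> 1"
  by (cases "sum mu K = 0") (simp_all add: normalize_wt_def sum_divide_distrib[symmetric])

lemma normalize_wt_nonneg: "(\<And>a. a \<in> K \<Longrightarrow> 0 \<le> mu a) \<Longrightarrow> 0 \<le> mu a \<Longrightarrow> 0 \<le> normalize_wt mu a"
  by (auto simp: normalize_wt_def intro!: divide_nonneg_nonneg sum_nonneg)

lemma theta_psi: "x \<in> Ev \<union> Od \<Longrightarrow> 0 \<le> theta * psi g x a" "x \<in> Ev \<union> Od \<Longrightarrow> theta * psi g x a \<le> 1/2"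
  using theta psi_nonneg[of g x a] psi_le_1[of x g a] mult_mono[of theta "1/2" "psi g x a" 1] by auto

lemma ker_nonneg:
  assumes "j \<in> Ev \<union> Od" "x \<in> N j" "c \<in> Pow K \<times> Pow K"
  shows "0 \<le> ker j x c g a"
proof -
  have x: "x \<in> Ev \<union> Od" using assms N_Od N_Ev by blast
  obtain A B where c: "c = (A, B)" "A \<subseteq> K" "B \<subseteq> K" using assms by auto
  have l: "0 \<le> lam a" if "a \<in> K" for a using lam_pos[OF that] by simp
  have t: "theta * psi g x a \<le> 1" for a using theta_psi[OF x, of g a] by simp
  show ?thesis
    using c l t unfolding ker_def c(1)
    by (auto intro!: normalize_wt_nonneg mult_nonneg_nonneg simp: common_nbrs_def)
qed

lemma prior_sum:
  assumes "x \<in> Ev \<union> Od"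
  shows "(\<Sum>c\<in>Pow K \<times> Pow K. prior x g c) \<le> 1"
proof -
  have finP: "finite (Pow K)" using fin by simp
  have c: "(\<Sum>c\<in>Pow K \<times> Pow K. base) = delta"
    using fin by (simp add: base_def card_cartesian_product card_Pow power_mult_distrib[symmetric])
  have eq: "(\<Sum>c\<in>Pow K \<times> Pow K. prior x g c) = delta + (1 - delta) *
     (\<Sum>(A,B)\<in>Pow K \<times> Pow K. if x \<in> Od then of_bool (A = B) * reach g x A else of_bool (A = K \<and> B = K))"
    unfolding sum_distrib_left
    by (subst (2) c[symmetric], subst sum.distrib[symmetric]) (intro sum.cong, auto simp: prior_def)
  have "(\<Sum>(A,B)\<in>Pow K \<times> Pow K. if x \<in> Od then of_bool (A = B) * reach g x A else of_bool (A = K \<and> B = K))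
      \<le> 1"
  proof (cases "x \<in> Od")
    case True
    have "(\<Sum>(A,B)\<in>Pow K \<times> Pow K. of_bool (A = B) * reach g x A) =
       (\<Sum>A\<in>Pow K. \<Sum>B\<in>Pow K. if A = B then reach g x A else 0)"
      by (subst sum.cartesian_product) (auto intro!: sum.cong)
    also have "\<dots> = (\<Sum>A\<in>Pow K. reach g x A)"
      using finP by (intro sum.cong) (auto simp: sum.delta')
    also have "\<dots> \<le> 1" using assms finP by (rule sum_reach_le)
    finally show ?thesis using True by simp
  next
    case False
    have "(\<Sum>(A,B)\<in>Pow K \<times> Pow K. of_bool (A = K \<and> B = K) :: real) =
        (\<Sum>c\<in>Pow K \<times> Pow K. if c = (K, K) then 1 else 0)"
      by (intro sum.cong) auto
    also have "\<dots> = 1" using finP by (subst sum.delta) auto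
    finally show ?thesis using False by simp
  qed
  moreover have "delta + (1 - delta) * s \<le> 1" if "s \<le> 1" for s
  proof -
    have "(1 - delta) * s \<le> 1 - delta" using that delta by (intro mult_left_le) auto
    then show ?thesis by linarith
  qed
  ultimately show ?thesis unfolding eq by blast
qed

lemma image_dn_upd: "u \<in> Od \<Longrightarrow> y \<in> Od \<or> rho u \<le> rho y \<Longrightarrow> (g(y := a)) ` dn u = g ` dn u"
  using dn_Od[of u] disj by (intro image_cong) (auto simp: dn_def)

lemma sum_code_le_1: "(\<Sum>g\<in>Ev \<union> Od \<rightarrow>\<^sub>E K. \<Prod>x\<in>Ev \<union> Od. code g x powr (1 / D)) \<le> 1"
  unfolding code_def
proof (rule mixture_code[where rk = rk])
  show "card {j \<in> Ev \<union> Od. w \<in> N j} = D" if w: "w \<in> Ev \<union> Od" for w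
  proof -
    have "{j \<in> Ev \<union> Od. w \<in> N j} = N w"
      using N_sym w N_Od N_Ev by blast
    then show ?thesis using card_N[OF w] by simp
  qed
  show "0 \<le> prior j g c" for j g c
    using delta base_pos reach_nonneg by (auto simp: prior_def split: prod.splits)
  show "(\<Sum>a\<in>K. ker j x c g a) \<le> 1" for j x c g
    by (cases c) (simp add: ker_def sum_normalize_wt)
  show "prior j (g(y := a)) c = prior j g c"
    if j: "j \<in> Ev \<union> Od" and x: "x \<in> N j" and y: "y \<in> Ev \<union> Od" and rk: "rk x \<le> rk y" for j x y c g a
  proof (cases "j \<in> Od")
    case True
    have xE: "x \<in> Ev" using True x N_Od by auto
    \<comment> \<open>Here \<open>rho u\<close> is at most \<open>rho j - 2\<close>, while every
      neighbour \<open>x\<close> of \<open>j\<close> has rank at least \<open>rho j - 1\<close>. So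
      colouring \<open>x\<close>, or anything later, does not affect the set seen below
      \<open>u\<close>.\<close>
    have "y \<in> Od \<or> rho u \<le> rho y" if "w \<in> dn j" "u \<in> dn w" for w u
    proof -
      have "y \<in> Od \<or> rho x \<le> rho y" using rk_le_cases[OF xE y rk] .
      moreover have "rho j \<le> Suc (rho x)" using rho_N[OF j x] by auto
      ultimately show ?thesis using that by (auto simp: dn_def)
    qed
    moreover have "u \<in> Od" if "w \<in> dn j" "u \<in> dn w" for w u
      using that True dn_Od dn_Ev by blast
    ultimately have "(g(y := a)) ` dn (snd p) = g ` dn (snd p)" if "p \<in> paths j" for p
      using that by (intro image_dn_upd) (force simp: paths_def)+
    then have "reach (g(y := a)) j A = reach g j A" for A
      by (simp add: reach_def cong: conj_cong)
    then show ?thesis by (auto simp: prior_def split: prod.splits)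
  next
    case False
    then show ?thesis by (auto simp: prior_def split: prod.splits)
  qed
  show "ker j x c (g(y := a)) = ker j x c g"
    if j: "j \<in> Ev \<union> Od" and x: "x \<in> N j" and y: "y \<in> Ev \<union> Od" and rk: "rk x \<le> rk y" for j x y c g a
  proof (cases "j \<in> Od")
    case True
    have xE: "x \<in> Ev" using True x N_Od by auto
    have "y \<in> Od \<or> rho x \<le> rho y" using rk_le_cases[OF xE y rk] .
    then have "(g(y := a)) ` dn u = g ` dn u" if "u \<in> dn x" for u
      using that dn_Ev[OF xE] by (intro image_dn_upd) (auto simp: dn_def)
    then have "psi (g(y := a)) x = psi g x"
      by (simp add: psi_def fun_eq_iff cong: conj_cong)
    then show ?thesis using True by (auto simp: ker_def split: prod.splits cong: if_cong)
  next
    case False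
    then have xO: "x \<in> Od" using j x N_Ev by auto
    have "y \<in> Od" using rk rk_less[of y x] xO y by auto
    then have "y \<notin> N x" using N_Od[OF xO] disj by auto
    then have "(g(y := a)) ` N x = g ` N x" by (intro image_cong) auto
    then show ?thesis using False by (auto simp: ker_def split: prod.splits)
  qed
  show "N j \<noteq> {}" if "j \<in> Ev \<union> Od" for j
    using card_N[OF that] D_pos by auto
qed (use fin N_Od N_Ev D_pos ker_nonneg prior_sum in auto)

end

section \<open>Lower bounds for the logarithm of a code at a given colouring\<close>

context coding begin

lemma sum_lam_pos: "A \<subseteq> K \<Longrightarrow> A \<noteq> {} \<Longrightarrow> 0 < sum lam A"
  using fin finite_subset lam_pos by (intro sum_pos) blast+

lemma sum_lam_mono: "B \<subseteq> A \<Longrightarrow> A \<subseteq> K \<Longrightarrow> sum lam B \<le> sum lam A"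
  using fin finite_subset lam_pos by (intro sum_mono2) (auto simp: less_imp_le subset_iff)

lemma ln_sum_lam_mono: "B \<subseteq> A \<Longrightarrow> A \<subseteq> K \<Longrightarrow> B \<noteq> {} \<Longrightarrow> ln (sum lam B) \<le> ln (sum lam A)"
  using sum_lam_mono[of B A] sum_lam_pos[of B] sum_lam_pos[of A] by (subst ln_le_cancel_iff) auto

text \<open>The missing colour carries at least the proportion \<open>kap\<close> of the weight of
  \<open>A\<close>, and \<open>ln (1 - kap)\<close> is at most \<open>- kap\<close>.\<close>

lemma ln_sum_lam_strict_mono:
  assumes "B \<subset> A" "A \<subseteq> K" "B \<noteq> {}"
  shows "ln (sum lam B) \<le> ln (sum lam A) - kap"
proof -
  obtain a where a: "a \<in> A" "a \<notin> B" using assms by blast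
  have finA: "finite A" using fin assms finite_subset by blast
  have B: "0 < sum lam B" and A: "0 < sum lam A"
    using assms sum_lam_pos[of A] sum_lam_pos[of B] by auto
  have "sum lam B \<le> sum lam (A - {a})" using assms a by (intro sum_lam_mono) auto
  also have "\<dots> = sum lam A - lam a" using finA a by (simp add: sum_diff1)
  also have "\<dots> \<le> sum lam A - kap * sum lam A"
  proof -
    have "kap * sum lam A \<le> kap * sum lam K"
      using kap assms by (intro mult_left_mono sum_lam_mono) auto
    also have "\<dots> \<le> lam a" using kap_le a assms by auto
    finally show ?thesis by simp
  qed
  finally have le: "sum lam B \<le> sum lam A * (1 - kap)" by (simp add: algebra_simps)
  then have "0 < sum lam A * (1 - kap)" using B by linarith
  then have "0 < 1 - kap" using A zero_less_mult_pos by blast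
  then have "ln (sum lam B) \<le> ln (sum lam A) + ln (1 - kap)"
    using le A B by (subst ln_mult_pos[symmetric]) auto
  also have "ln (1 - kap) \<le> - kap" using ln_le_minus_one[OF \<open>0 < 1 - kap\<close>] by simp
  finally show ?thesis by simp
qed

lemma sum_restrict_K: "A \<subseteq> K \<Longrightarrow> (\<Sum>b\<in>K. if b \<in> A then F b else 0) = sum F A"
  using fin by (simp add: sum.inter_restrict[symmetric] Int_absorb1)

text \<open>The gain comes from the normalisation: the tilt lowers the total weight of
  \<open>A\<close> by \<open>theta * s\<close>, and each lower neighbour \<open>u\<close> that
  misses a colour of \<open>A\<close> adds to \<open>s\<close> at least \<open>kap / D\<close> times
  that weight. The price is the tilt of the colour \<open>a\<close> itself, at most
  \<open>2 * theta * psi g x a\<close>.\<close>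

lemma tilted_wt:
  fixes g :: "'a \<Rightarrow> 'h"
  assumes x: "x \<in> Ev" and A: "A \<subseteq> K" "a \<in> A"
  defines "mu \<equiv> (\<lambda>b. if b \<in> A then lam b * (1 - theta * psi g x b) else 0)"
  shows "0 < normalize_wt mu a"
    and "ln (lam a) - ln (sum lam A) - 2 * theta * psi g x a +
          theta * kap * card {u \<in> dn x. \<not> A \<subseteq> g ` dn u} / D \<le> ln (normalize_wt mu a)"
proof -
  define s where "s = (\<Sum>b\<in>A. lam b * psi g x b)"
  define l where "l = sum lam A"
  have finA: "finite A" using fin A finite_subset by blast
  have l: "0 < l" unfolding l_def using A by (intro sum_lam_pos) auto
  have xV: "x \<in> Ev \<union> Od" using x by simp
  have la: "0 < lam a" using A lam_pos by auto
  have s0: "0 \<le> s" unfolding s_def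
    using A lam_pos psi_nonneg by (intro sum_nonneg mult_nonneg_nonneg) (auto simp: less_imp_le subset_iff)
  have "s \<le> (\<Sum>b\<in>A. lam b * 1)" unfolding s_def
    using A lam_pos psi_le_1[OF xV] by (intro sum_mono mult_left_mono) (auto simp: less_imp_le subset_iff)
  then have "s \<le> l" by (simp add: l_def)
  then have ts: "theta * s \<le> l / 2" using theta s0 mult_mono[of theta "1/2" s l] by simp
  have ts0: "0 \<le> theta * s" using theta s0 by simp
  have sum: "sum mu K = l - theta * s"
    unfolding mu_def sum_restrict_K[OF A(1)] s_def l_def
    by (simp add: algebra_simps sum_subtractf sum_distrib_left)
  have eq: "normalize_wt mu a = lam a * (1 - theta * psi g x a) / (l - theta * s)"
    using A by (simp add: normalize_wt_def sum) (simp add: mu_def)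
  have p: "0 < 1 - theta * psi g x a" using theta_psi[OF xV, of g a] by simp
  have q: "0 < l - theta * s" using ts l by linarith
  show "0 < normalize_wt mu a" unfolding eq using p q la by simp
  have "ln (l - theta * s) \<le> ln l - theta * (s / l)"
  proof -
    have "l - theta * s = l * (1 - theta * (s / l))" using l by (simp add: field_simps)
    moreover have r: "0 < 1 - theta * (s / l)" using q l by (simp add: field_simps)
    ultimately have "ln (l - theta * s) = ln l + ln (1 - theta * (s / l))"
      using l by (simp add: ln_mult_pos)
    also have "ln (1 - theta * (s / l)) \<le> - (theta * (s / l))"
      using ln_le_minus_one[OF r] by simp
    finally show ?thesis by simp
  qed
  moreover have "ln (normalize_wt mu a) = ln (lam a) + ln (1 - theta * psi g x a) - ln (l - theta * s)"
    unfolding eq using p q la by (simp add: ln_div ln_mult_pos)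
  moreover have "- 2 * (theta * psi g x a) \<le> ln (1 - theta * psi g x a)"
    using theta_psi[OF xV, of g a] by (intro ln_one_minus_ge) auto
  moreover have "theta * (kap * card {u \<in> dn x. \<not> A \<subseteq> g ` dn u} / D) \<le> theta * (s / l)"
  proof (intro mult_left_mono)
    have "kap * l * card {u \<in> dn x. \<not> A \<subseteq> g ` dn u} = (\<Sum>u\<in>dn x. kap * l * of_bool (\<not> A \<subseteq> g ` dn u))"
      using finite_dn[OF xV] by (simp add: sum_distrib_left[symmetric] Collect_conj_eq)
    also have "\<dots> \<le> (\<Sum>u\<in>dn x. \<Sum>b\<in>A. lam b * of_bool (b \<notin> g ` dn u))"
    proof (rule sum_mono)
      fix u assume "u \<in> dn x"
      show "kap * l * of_bool (\<not> A \<subseteq> g ` dn u) \<le> (\<Sum>b\<in>A. lam b * of_bool (b \<notin> g ` dn u))"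
      proof (cases "A \<subseteq> g ` dn u")
        case True
        then show ?thesis using A lam_pos
          by (auto intro!: sum_nonneg mult_nonneg_nonneg simp: less_imp_le subset_iff)
      next
        case False
        then obtain b where b: "b \<in> A" "b \<notin> g ` dn u" by blast
        have "kap * l \<le> kap * sum lam K"
          unfolding l_def using kap sum_lam_mono[OF A(1)] by (intro mult_left_mono) auto
        also have "\<dots> \<le> lam b * of_bool (b \<notin> g ` dn u)" using kap_le b A by auto
        also have "\<dots> \<le> (\<Sum>b\<in>A. lam b * of_bool (b \<notin> g ` dn u))"
          using finA b A lam_pos by (intro member_le_sum) (auto simp: less_imp_le subset_iff)
        finally show ?thesis using False by simp
      qed
    qed
    also have "\<dots> = (\<Sum>b\<in>A. lam b * card {u \<in> dn x. b \<notin> g ` dn u})"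
      using finite_dn[OF xV] by (subst sum.swap) (simp add: sum_distrib_left[symmetric] Collect_conj_eq)
    also have "\<dots> = D * s"
      using D_pos by (simp add: s_def psi_def sum_distrib_left)
    finally show "kap * card {u \<in> dn x. \<not> A \<subseteq> g ` dn u} / D \<le> s / l"
      using D_pos l by (simp add: field_simps)
  qed (use theta in auto)
  ultimately show "ln (lam a) - ln (sum lam A) - 2 * theta * psi g x a +
          theta * kap * card {u \<in> dn x. \<not> A \<subseteq> g ` dn u} / D \<le> ln (normalize_wt mu a)"
    unfolding l_def by (simp add: mult.assoc)
qed

lemma restricted_wt:
  assumes A: "A \<subseteq> K" "a \<in> A"
  shows "0 < normalize_wt (\<lambda>b. if b \<in> A then lam b else 0) a"
    and "ln (normalize_wt (\<lambda>b. if b \<in> A then lam b else 0) a) = ln (lam a) - ln (sum lam A)"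
proof -
  have "0 < sum lam A" using A by (intro sum_lam_pos) auto
  moreover have "0 < lam a" using A lam_pos by auto
  moreover have "normalize_wt (\<lambda>b. if b \<in> A then lam b else 0) a = lam a / sum lam A"
    using A by (simp add: normalize_wt_def sum_restrict_K)
  ultimately show "0 < normalize_wt (\<lambda>b. if b \<in> A then lam b else 0) a"
    "ln (normalize_wt (\<lambda>b. if b \<in> A then lam b else 0) a) = ln (lam a) - ln (sum lam A)"
    by (simp_all add: ln_div)
qed

lemma prior_ge_base: "base \<le> prior x g c"
  using delta reach_nonneg by (auto simp: prior_def split: prod.splits)

lemma code_ge:
  assumes "x \<in> Ev \<union> Od" "c \<in> Pow K \<times> Pow K"
  shows "prior x g c * (\<Prod>y\<in>N x. ker x y c g (g y)) \<le> code g x"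
  unfolding code_def
proof (rule member_le_sum[where f = "\<lambda>c. prior x g c * (\<Prod>y\<in>N x. ker x y c g (g y))"])
  show "0 \<le> prior x g c * (\<Prod>y\<in>N x. ker x y c g (g y))" if "c \<in> Pow K \<times> Pow K - {c'}" for c c'
    using that assms base_pos prior_ge_base[of x g c]
    by (intro mult_nonneg_nonneg prod_nonneg ker_nonneg) auto
qed (use assms fin in auto)

lemma ln_code_ge:
  assumes "x \<in> Ev \<union> Od" "c \<in> Pow K \<times> Pow K"
    and pos: "\<And>y. y \<in> N x \<Longrightarrow> 0 < ker x y c g (g y)"
  shows "0 < code g x" "ln (prior x g c) + (\<Sum>y\<in>N x. ln (ker x y c g (g y))) \<le> ln (code g x)"
proof -
  have p: "0 < prior x g c" using prior_ge_base base_pos less_le_trans by blast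
  have k: "0 < (\<Prod>y\<in>N x. ker x y c g (g y))" using pos by (intro prod_pos) auto
  show c: "0 < code g x" using code_ge[OF assms(1,2), of g] mult_pos_pos[OF p k] by linarith
  have "ln (prior x g c) + (\<Sum>y\<in>N x. ln (ker x y c g (g y))) = ln (prior x g c * (\<Prod>y\<in>N x. ker x y c g (g y)))"
    using p k ln_prod[OF finite_N[OF assms(1)], of "\<lambda>y. ker x y c g (g y)"] pos
    by (force simp: ln_mult_pos)
  also have "\<dots> \<le> ln (code g x)"
    using code_ge[OF assms(1,2), of g] mult_pos_pos[OF p k] c by simp
  finally show "ln (prior x g c) + (\<Sum>y\<in>N x. ln (ker x y c g (g y))) \<le> ln (code g x)" .
qed

text \<open>The mixture is bounded below by its single term for the true pair of colour sets, so the
  prior of that pair is the whole price of not knowing it.\<close>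

lemma ln_code_Od:
  assumes f: "coloring f" and v: "v \<in> Od"
  defines "X \<equiv> f ` dn v" and "Y \<equiv> f ` up v"
  shows "0 < code f v"
    and "ln (prior v f (X, Y)) + (\<Sum>y\<in>N v. ln (lam (f y)))
        - card (dn v) * ln (sum lam X) - card (up v) * ln (sum lam Y)
        + (\<Sum>y\<in>dn v. theta * kap * card {u \<in> dn y. \<not> X \<subseteq> f ` dn u} / D - 2 * theta * psi f y (f y))
      \<le> ln (code f v)"
proof -
  have vV: "v \<in> Ev \<union> Od" using v by simp
  have K: "f y \<in> K" if "y \<in> N v" for y
    using that N_Od[OF v] f by (auto simp: coloring_def)
  have XY: "X \<subseteq> K" "Y \<subseteq> K" using K by (auto simp: X_def Y_def dn_def up_def)
  have kd: "ker v y (X, Y) f = normalize_wt (\<lambda>b. if b \<in> X then lam b * (1 - theta * psi f y b) else 0)"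
    if "y \<in> dn v" for y using that v by (simp add: ker_def dn_def)
  have ku: "ker v y (X, Y) f = normalize_wt (\<lambda>b. if b \<in> Y then lam b else 0)"
    if "y \<in> up v" for y using that v by (simp add: ker_def up_def)
  have E: "y \<in> Ev" if "y \<in> dn v" for y using that dn_Od[OF v] by auto
  have "0 < ker v y (X, Y) f (f y)" if "y \<in> N v" for y
  proof (cases "y \<in> dn v")
    case True
    then show ?thesis unfolding kd[OF True] using XY E by (intro tilted_wt) (auto simp: X_def)
  next
    case False
    then have "y \<in> up v" using that N_eq[OF vV] by auto
    then show ?thesis unfolding ku[OF \<open>y \<in> up v\<close>] using XY by (intro restricted_wt) (auto simp: Y_def)
  qed
  note * = ln_code_ge[OF vV _ this]
  have c: "(X, Y) \<in> Pow K \<times> Pow K" using XY by auto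
  show "0 < code f v" using *(1)[OF c] .
  have d: "(\<Sum>y\<in>dn v. ln (lam (f y)) - ln (sum lam X) - 2 * theta * psi f y (f y) +
          theta * kap * card {u \<in> dn y. \<not> X \<subseteq> f ` dn u} / D) \<le> (\<Sum>y\<in>dn v. ln (ker v y (X, Y) f (f y)))"
    using XY E by (intro sum_mono) (simp only: kd, intro tilted_wt, auto simp: X_def)
  have u: "(\<Sum>y\<in>up v. ln (lam (f y)) - ln (sum lam Y)) = (\<Sum>y\<in>up v. ln (ker v y (X, Y) f (f y)))"
  proof (rule sum.cong)
    fix y assume "y \<in> up v"
    then show "ln (lam (f y)) - ln (sum lam Y) = ln (ker v y (X, Y) f (f y))"
      using restricted_wt(2)[OF XY(2), of "f y"] by (simp add: ku) (simp add: Y_def)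
  qed simp
  have split: "(\<Sum>y\<in>N v. F y) = (\<Sum>y\<in>dn v. F y) + (\<Sum>y\<in>up v. F y)" for F :: "'a \<Rightarrow> real"
    unfolding N_eq[OF vV] by (rule sum.union_disjoint[OF finite_dn[OF vV] finite_up[OF vV] dn_up_disjoint])
  show "ln (prior v f (X, Y)) + (\<Sum>y\<in>N v. ln (lam (f y)))
        - card (dn v) * ln (sum lam X) - card (up v) * ln (sum lam Y)
        + (\<Sum>y\<in>dn v. theta * kap * card {u \<in> dn y. \<not> X \<subseteq> f ` dn u} / D - 2 * theta * psi f y (f y))
      \<le> ln (code f v)"
    using *(2)[OF c] d u unfolding split by (simp add: sum.distrib sum_subtractf)
qed

text \<open>For \<open>A = B\<close> the prior is the mean of \<open>base\<close> and
  \<open>base + (1 - delta)\<close> with weight \<open>r = reach g v A\<close> on the latter, so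
  concavity of \<open>ln\<close> gives a cost linear in \<open>1 - r\<close>. Linearity lets the
  costs be summed over \<open>v\<close> and compared with a count of paths.\<close>

lemma ln_prior_Od:
  assumes v: "v \<in> Od"
  shows "- (if A = B then 2 * delta - ln base * (1 - reach g v A) else - ln base) \<le> ln (prior v g (A, B))"
proof (cases "A = B")
  case True
  define r where "r = reach g v A"
  have r: "0 \<le> r" "r \<le> 1"
    using reach_nonneg sum_reach_le[of v "{A}" g] v by (auto simp: r_def)
  have p: "prior v g (A, B) = (1 - r) *\<^sub>R base + r *\<^sub>R (base + (1 - delta))"
    using v True by (simp add: prior_def r_def algebra_simps)
  have "(1 - r) * ln base + r * ln (base + (1 - delta)) \<le> ln (prior v g (A, B))"
    unfolding p using r base_pos delta by (intro concave_onD[OF ln_concave]) auto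
  moreover have "- (2 * delta) \<le> r * ln (base + (1 - delta))"
  proof -
    have "- 2 * delta \<le> ln (1 - delta)" using delta by (intro ln_one_minus_ge) auto
    also have "\<dots> \<le> ln (base + (1 - delta))" using base_pos delta by simp
    finally have "r * (- 2 * delta) \<le> r * ln (base + (1 - delta))"
      using r by (intro mult_left_mono) auto
    moreover have "r * (2 * delta) \<le> 1 * (2 * delta)" using r delta by (intro mult_right_mono) auto
    ultimately show ?thesis by simp
  qed
  ultimately show ?thesis using True by (simp add: r_def algebra_simps)
next
  case False
  have "ln base \<le> ln (prior v g (A, B))"
    using base_pos prior_ge_base[of v g "(A, B)"] by simp
  then show ?thesis using False by simp
qed

text \<open>\<open>CN\<close> of the colours on \<open>N v\<close> is the set of colours open to
  \<open>v\<close>. At a dull \<open>w\<close> every neighbour has an open colour unseen on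
  \<open>N w\<close>, so guessing the colours of \<open>N w\<close> correctly saves at each of the
  \<open>D\<close> neighbours.\<close>

definition dull :: "('a \<Rightarrow> 'h) \<Rightarrow> 'a \<Rightarrow> bool" where
  "dull f w \<longleftrightarrow> (\<forall>v\<in>N w. \<not> CN (f ` N v) \<subseteq> f ` N w)"

lemma coloring_in_CN:
  assumes "coloring f" "v \<in> Ev \<union> Od"
  shows "f v \<in> CN (f ` N v)"
proof -
  have "adj (f y) (f v)" if "y \<in> N v" for y
    using that assms N_sym[OF assms(2) that] N_Od N_Ev unfolding coloring_def by blast
  then show ?thesis using assms by (auto simp: common_nbrs_def coloring_def)
qed

text \<open>Two terms of the mixture are used: the unrestricted guess \<open>(K, K)\<close>, which
  is almost free, and at a dull \<open>w\<close> the true colour set of \<open>N w\<close>, which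
  costs \<open>- ln base\<close> and saves \<open>kap\<close> at each neighbour.\<close>

lemma ln_code_Ev:
  assumes f: "coloring f" and w: "w \<in> Ev"
  shows "0 < code f w"
    and "(\<Sum>v\<in>N w. ln (lam (f v)) - ln (sum lam (CN (f ` N v)))) - 2 * delta \<le> ln (code f w)"
    and "dull f w \<Longrightarrow>
      (\<Sum>v\<in>N w. ln (lam (f v)) - ln (sum lam (CN (f ` N v)))) + D * kap + ln base \<le> ln (code f w)"
proof -
  have wV: "w \<in> Ev \<union> Od" and wO: "w \<notin> Od" using w disj by auto
  have O: "v \<in> Od" if "v \<in> N w" for v using that N_Ev[OF w] by auto
  have CNK: "CN A \<subseteq> K" for A by (auto simp: common_nbrs_def)
  have inCN: "f v \<in> CN (f ` N v)" if "v \<in> N w" for v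
    using coloring_in_CN[OF f] O[OF that] by auto
  have ker: "ker w v (A, B) f = normalize_wt (\<lambda>a. if a \<in> CN (f ` N v) \<inter> A then lam a else 0)" for v A B
    using wO by (simp add: ker_def)
  have KC: "CN A \<inter> K = CN A" for A by (auto simp: common_nbrs_def)
  have pos: "0 < ker w v (K, K) f (f v)"
    and eq: "ln (ker w v (K, K) f (f v)) = ln (lam (f v)) - ln (sum lam (CN (f ` N v)))" if "v \<in> N w" for v
    unfolding ker KC using CNK inCN[OF that] by (auto intro!: restricted_wt)
  note * = ln_code_ge[OF wV _ pos]
  show "0 < code f w" using * by blast
  have "1 - delta \<le> prior w f (K, K)" using wO base_pos by (simp add: prior_def)
  moreover have "0 < 1 - delta" using delta by simp
  ultimately have "ln (1 - delta) \<le> ln (prior w f (K, K))" by simp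
  moreover have "- 2 * delta \<le> ln (1 - delta)" using delta by (intro ln_one_minus_ge) auto
  ultimately have "- 2 * delta \<le> ln (prior w f (K, K))" by linarith
  then show "(\<Sum>v\<in>N w. ln (lam (f v)) - ln (sum lam (CN (f ` N v)))) - 2 * delta \<le> ln (code f w)"
    using *(2) by (simp add: eq)
  assume dull: "dull f w"
  define A where "A = f ` N w"
  have A: "A \<subseteq> K" using f O by (auto simp: A_def coloring_def)
  have pos: "0 < ker w v (A, A) f (f v)" if "v \<in> N w" for v
    unfolding ker using CNK inCN[OF that] that by (intro restricted_wt) (auto simp: A_def)
  have ge: "ln (lam (f v)) - ln (sum lam (CN (f ` N v))) + kap \<le> ln (ker w v (A, A) f (f v))" if "v \<in> N w" for v
  proof -
    have "ln (ker w v (A, A) f (f v)) = ln (lam (f v)) - ln (sum lam (CN (f ` N v) \<inter> A))"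
      unfolding ker using CNK inCN[OF that] that by (intro restricted_wt) (auto simp: A_def)
    moreover have "ln (sum lam (CN (f ` N v) \<inter> A)) \<le> ln (sum lam (CN (f ` N v))) - kap"
      using dull that inCN[OF that] CNK
      by (intro ln_sum_lam_strict_mono) (auto simp: A_def dull_def psubset_eq inf.absorb_iff1)
    ultimately show ?thesis by simp
  qed
  have "ln base \<le> ln (prior w f (A, A))"
    using base_pos prior_ge_base[of w f "(A, A)"] by simp
  moreover have "(\<Sum>v\<in>N w. ln (lam (f v)) - ln (sum lam (CN (f ` N v))) + kap) \<le> (\<Sum>v\<in>N w. ln (ker w v (A, A) f (f v)))"
    by (intro sum_mono ge)
  moreover have "ln (prior w f (A, A)) + (\<Sum>v\<in>N w. ln (ker w v (A, A) f (f v))) \<le> ln (code f w)"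
    using A by (intro ln_code_ge[OF wV] pos) auto
  ultimately show "(\<Sum>v\<in>N w. ln (lam (f v)) - ln (sum lam (CN (f ` N v)))) + D * kap + ln base \<le> ln (code f w)"
    using card_N[OF wV] by (simp add: sum.distrib)
qed

end

section \<open>The gain of a code\<close>

text \<open>\<open>g\<close> is the gap below the optimum on the logarithmic scale and
  \<open>gam\<close> the proportion of neighbours that counts as substantial. With
  \<open>g \<le> gam * kap\<close>, a colour missing at \<open>gam * D\<close> neighbours gains at
  least as much as a suboptimal set.\<close>

locale gain = coding Ev Od N rho D K lam adj delta theta kap
  for Ev Od :: "'a set" and N rho D and K :: "'h set" and lam adj delta theta kap +
  fixes eta g gam :: real
  assumes eta_pos: "0 < eta" and gam_pos: "0 < gam" and g: "0 \<le> g" "g \<le> gam * kap"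
    and eta_max: "A \<subseteq> K \<Longrightarrow> sum lam A * sum lam (CN A) \<le> eta"
    and eta_gap: "A \<subseteq> K \<Longrightarrow> A \<noteq> {} \<Longrightarrow> CN A \<noteq> {} \<Longrightarrow> sum lam A * sum lam (CN A) \<noteq> eta \<Longrightarrow>
          ln (sum lam A) + ln (sum lam (CN A)) \<le> ln eta - g"
begin

definition bad :: "('a \<Rightarrow> 'h) \<Rightarrow> 'a \<Rightarrow> bool" where
  "bad f v \<longleftrightarrow> \<not> (f ` dn v = f ` up v \<and> sum lam (f ` dn v) * sum lam (CN (f ` dn v)) = eta)"

text \<open>The bound on descending paths also provides \<open>gam * D\<close> lower neighbours
  (\<open>typical_card_dn\<close>), so a missing colour gains an amount of order \<open>D\<close> on
  whichever side it is missing.\<close>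

definition typical :: "'a \<Rightarrow> bool" where
  "typical v \<longleftrightarrow> gam * (real D)\<^sup>2 \<le> card (paths v) \<and> gam * D \<le> card (up v)"

lemma card_paths: "v \<in> Od \<Longrightarrow> card (paths v) = (\<Sum>y\<in>dn v. card (dn y))"
  unfolding paths_def using finite_dn dn_Od by (subst card_SigmaI) (auto simp: subset_iff)

lemma typical_card_dn:
  assumes v: "v \<in> Od" and t: "typical v"
  shows "gam * D \<le> card (dn v)"
proof -
  have "card (paths v) \<le> (\<Sum>y\<in>dn v. D)"
    unfolding card_paths[OF v] using card_dn_le dn_Od[OF v] by (intro sum_mono) auto
  then have "real (card (paths v)) \<le> card (dn v) * real D"
    by (metis of_nat_mono of_nat_mult sum_constant of_nat_id)
  then have "(gam * D) * D \<le> card (dn v) * real D"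
    using t by (simp add: typical_def power2_eq_square mult.assoc)
  then show ?thesis using D_pos by simp
qed

text \<open>The left side is what the code of \<open>v\<close> pays for normalisation, with the
  share that the codes of its neighbours pay at \<open>v\<close>. Both sets lie in \<open>M\<close>,
  and the weights of \<open>M\<close> and \<open>CN M\<close> multiply to at most
  \<open>eta\<close>. At a typical bad vertex either \<open>M\<close> is not optimal, or one of the
  two sets misses a colour of \<open>M\<close>, which counts for at least \<open>gam * D\<close>
  neighbours.\<close>

lemma local_energy:
  assumes f: "coloring f" and v: "v \<in> Od"
  shows "card (dn v) * ln (sum lam (f ` dn v)) + card (up v) * ln (sum lam (f ` up v))
      + D * ln (sum lam (CN (f ` N v))) \<le> D * ln eta - g * D * of_bool (bad f v \<and> typical v)"
proof -
  define X Y M where "X = f ` dn v" and "Y = f ` up v" and "M = f ` N v"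
  have vV: "v \<in> Ev \<union> Od" using v by simp
  have M: "M = X \<union> Y" using N_eq[OF vV] by (auto simp: X_def Y_def M_def)
  have "N v \<noteq> {}" using card_N[OF vV] D_pos by auto
  then have M0: "M \<noteq> {}" by (simp add: M_def)
  have MK: "M \<subseteq> K" using f N_Od[OF v] by (auto simp: M_def coloring_def)
  have CK: "CN M \<subseteq> K" by (auto simp: common_nbrs_def)
  have C0: "CN M \<noteq> {}" using coloring_in_CN[OF f vV] by (auto simp: M_def)
  have pos: "0 < sum lam M" "0 < sum lam (CN M)" using MK M0 CK C0 sum_lam_pos by auto
  define l where "l = ln (sum lam M)"
  have le: "l + ln (sum lam (CN M)) \<le> ln eta"
  proof -
    have "l + ln (sum lam (CN M)) = ln (sum lam M * sum lam (CN M))"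
      using pos by (simp add: l_def ln_mult_pos)
    also have "\<dots> \<le> ln eta" using pos eta_max[OF MK] eta_pos by (subst ln_le_cancel_iff) auto
    finally show ?thesis .
  qed
  have D: "real D = card (dn v) + card (up v)" using card_dn_up[OF vV] by simp
  have X: "card (dn v) * ln (sum lam X) \<le> card (dn v) * l"
  proof (cases "dn v = {}")
    case False
    then show ?thesis unfolding l_def
      using MK M by (intro mult_left_mono ln_sum_lam_mono) (auto simp: X_def)
  qed simp
  have Y: "card (up v) * ln (sum lam Y) \<le> card (up v) * l"
  proof (cases "up v = {}")
    case False
    then show ?thesis unfolding l_def
      using MK M by (intro mult_left_mono ln_sum_lam_mono) (auto simp: Y_def)
  qed simp
  have Dle: "D * (l + ln (sum lam (CN M))) \<le> D * ln eta" using le by (intro mult_left_mono) auto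
  have "card (dn v) * ln (sum lam X) + card (up v) * ln (sum lam Y) + D * ln (sum lam (CN M))
    \<le> D * ln eta - g * D * of_bool (bad f v \<and> typical v)"
  proof (cases "bad f v \<and> typical v")
    case False
    have "D * l = card (dn v) * l + card (up v) * l" unfolding D by (simp add: distrib_right)
    moreover have "g * D * of_bool (bad f v \<and> typical v) = 0" using False by auto
    ultimately show ?thesis using X Y Dle unfolding distrib_left by linarith
  next
    case True
    have Dl: "D * l = card (dn v) * l + card (up v) * l" unfolding D by (simp add: distrib_right)
    show ?thesis
    proof (cases "sum lam M * sum lam (CN M) = eta")
      case False
      have "l + ln (sum lam (CN M)) \<le> ln eta - g"
        unfolding l_def using MK M0 C0 False by (rule eta_gap)
      then have "D * (l + ln (sum lam (CN M))) \<le> D * (ln eta - g)" by (intro mult_left_mono) auto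
      then show ?thesis using X Y True Dl by (simp add: algebra_simps)
    next
      case eq: True
      have gD: "g * D \<le> gam * D * kap" using g D_pos by (simp add: mult.assoc mult.commute)
      have "X \<noteq> M \<or> Y \<noteq> M"
        using True eq unfolding bad_def X_def[symmetric] Y_def[symmetric] by auto
      then show ?thesis
      proof
        assume "X \<noteq> M"
        have dnD: "gam * D \<le> card (dn v)" using typical_card_dn[OF v] True by auto
        then have "dn v \<noteq> {}" using gam_pos D_pos by (auto simp: mult_le_0_iff)
        then have "ln (sum lam X) \<le> l - kap"
          unfolding l_def using \<open>X \<noteq> M\<close> M MK by (intro ln_sum_lam_strict_mono) (auto simp: X_def)
        then have "card (dn v) * ln (sum lam X) \<le> card (dn v) * (l - kap)"
          by (intro mult_left_mono) auto
        moreover have "gam * D * kap \<le> card (dn v) * kap" using dnD kap by (intro mult_right_mono) auto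
        ultimately show ?thesis using Y Dle gD True Dl by (simp add: algebra_simps)
      next
        assume "Y \<noteq> M"
        have dnD: "gam * D \<le> card (up v)" using True by (auto simp: typical_def)
        then have "up v \<noteq> {}" using gam_pos D_pos by (auto simp: mult_le_0_iff)
        then have "ln (sum lam Y) \<le> l - kap"
          unfolding l_def using \<open>Y \<noteq> M\<close> M MK by (intro ln_sum_lam_strict_mono) (auto simp: Y_def)
        then have "card (up v) * ln (sum lam Y) \<le> card (up v) * (l - kap)"
          by (intro mult_left_mono) auto
        moreover have "gam * D * kap \<le> card (up v) * kap" using dnD kap by (intro mult_right_mono) auto
        ultimately show ?thesis using X Dle gD True Dl by (simp add: algebra_simps)
      qed
    qed
  qed
  then show ?thesis by (simp add: X_def Y_def M_def)
qed

lemma base_le_1: "base \<le> 1"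
proof -
  have "delta \<le> 1" using delta by simp
  also have "(1::real) \<le> 4 ^ card K" by simp
  finally show ?thesis by (simp add: base_def)
qed

text \<open>A typical vertex has at least \<open>gam * D^2\<close> descending paths, which turns the
  missed proportion into a path count; an atypical one is charged the trivial bound 1.\<close>

lemma sum_reach_defect:
  "(\<Sum>v\<in>Od. 1 - reach f v (f ` dn v))
    \<le> card {v \<in> Od. \<not> typical v} + psum (\<lambda>v u. f ` dn v \<noteq> f ` dn u) / (gam * (real D)\<^sup>2)"
proof -
  have "1 - reach f v (f ` dn v)
    \<le> of_bool (\<not> typical v) + (\<Sum>y\<in>dn v. \<Sum>u\<in>dn y. of_bool (f ` dn v \<noteq> f ` dn u)) / (gam * (real D)\<^sup>2)"
    if v: "v \<in> Od" for v
  proof (cases "typical v")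
    case False
    have "0 \<le> (\<Sum>y\<in>dn v. \<Sum>u\<in>dn y. of_bool (f ` dn v \<noteq> f ` dn u)) / (gam * (real D)\<^sup>2)"
      using gam_pos by (intro divide_nonneg_nonneg sum_nonneg) auto
    then show ?thesis using False reach_nonneg[of f v "f ` dn v"] by simp
  next
    case True
    have vV: "v \<in> Ev \<union> Od" using v by simp
    define P where "P = {p \<in> paths v. f ` dn v = f ` dn (snd p)}"
    define Q where "Q = {p \<in> paths v. f ` dn v \<noteq> f ` dn (snd p)}"
    have c: "0 < gam * (real D)\<^sup>2" "gam * (real D)\<^sup>2 \<le> card (paths v)"
      using gam_pos D_pos True by (auto simp: typical_def)
    have "paths v = P \<union> Q" "P \<inter> Q = {}" by (auto simp: P_def Q_def)
    then have "card (paths v) = card P + card Q"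
      using finite_paths[OF vV] by (metis card_Un_disjoint finite_Un)
    then have "1 - card P / card (paths v) = card Q / card (paths v)"
      using c by (simp add: field_simps)
    also have "\<dots> \<le> card Q / (gam * (real D)\<^sup>2)"
      using c by (intro divide_left_mono) auto
    also have "real (card Q) = (\<Sum>p\<in>paths v. of_bool (f ` dn v \<noteq> f ` dn (snd p)))"
      using finite_paths[OF vV] by (simp add: Q_def Collect_conj_eq)
    also have "\<dots> = (\<Sum>y\<in>dn v. \<Sum>u\<in>dn y. of_bool (f ` dn v \<noteq> f ` dn u))"
    proof -
      have "\<forall>y\<in>dn v. finite (dn y)" using dn_Od[OF v] finite_dn by auto
      then show ?thesis unfolding paths_def using finite_dn[OF vV]
        by (subst sum.Sigma) (auto simp: split_def)
    qed
    finally show ?thesis using True by (simp add: reach_def P_def eq_commute)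
  qed
  then have "(\<Sum>v\<in>Od. 1 - reach f v (f ` dn v)) \<le> (\<Sum>v\<in>Od. of_bool (\<not> typical v) +
      (\<Sum>y\<in>dn v. \<Sum>u\<in>dn y. of_bool (f ` dn v \<noteq> f ` dn u)) / (gam * (real D)\<^sup>2))"
    by (rule sum_mono)
  also have "\<dots> = card {v \<in> Od. \<not> typical v} + psum (\<lambda>v u. f ` dn v \<noteq> f ` dn u) / (gam * (real D)\<^sup>2)"
    using fin by (simp add: sum.distrib psum_def sum_divide_distrib Collect_conj_eq)
  finally show ?thesis .
qed

text \<open>The tilt hurts the true colouring only near bad vertices: if the colour of
  \<open>y\<close> is unseen below a lower neighbour \<open>u\<close>, then \<open>y\<close>, lying
  above \<open>u\<close>, shows that the upper and lower sets of \<open>u\<close> differ.\<close>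

lemma sum_psi_le:
  assumes f: "coloring f"
  shows "(\<Sum>v\<in>Od. \<Sum>y\<in>dn v. psi f y (f y)) \<le> D * card {v \<in> Od. bad f v}"
proof -
  have "psi f y (f y) \<le> (\<Sum>u\<in>dn y. of_bool (bad f u)) / D" if "v \<in> Od" "y \<in> dn v" for v y
  proof -
    have y: "y \<in> Ev" "y \<in> Ev \<union> Od" using that dn_Od by auto
    have "bad f u" if u: "u \<in> dn y" "f y \<notin> f ` dn u" for u
    proof -
      have "y \<in> N u" using N_sym[OF y(2)] u by (auto simp: dn_def)
      then have "y \<in> up u" using u by (simp add: dn_def up_def)
      then show ?thesis using u by (auto simp: bad_def)
    qed
    then have "card {u \<in> dn y. f y \<notin> f ` dn u} \<le> card {u \<in> dn y. bad f u}"
      using finite_dn[OF y(2)] by (intro card_mono) auto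
    then have "real (card {u \<in> dn y. f y \<notin> f ` dn u}) \<le> (\<Sum>u\<in>dn y. of_bool (bad f u))"
      using finite_dn[OF y(2)] by (simp add: Collect_conj_eq)
    then show ?thesis by (simp add: psi_def divide_right_mono)
  qed
  then have "(\<Sum>v\<in>Od. \<Sum>y\<in>dn v. psi f y (f y)) \<le> (\<Sum>v\<in>Od. \<Sum>y\<in>dn v. (\<Sum>u\<in>dn y. of_bool (bad f u)) / D)"
    by (intro sum_mono)
  also have "\<dots> = psum (\<lambda>v u. bad f u) / D"
    by (simp add: psum_def sum_divide_distrib)
  also have "\<dots> \<le> (real D)\<^sup>2 * card {v \<in> Od. bad f v} / D"
    by (intro divide_right_mono psum_snd_le) auto
  finally show ?thesis using D_pos by (simp add: power2_eq_square)
qed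

text \<open>The balance of one code. By regularity each \<open>ln (lam (f x))\<close> occurs
  \<open>D\<close> times in the codes of the neighbours of \<open>x\<close> and cancels. The
  normalisations are compared with \<open>ln eta\<close> by \<open>local_energy\<close>; what
  remains is the tilt, the priors of both classes (\<open>2 * delta\<close> at each vertex, and the
  wrong guesses) and the dull vertices.\<close>

lemma gain_lower_bound:
  fixes f :: "'a \<Rightarrow> 'h"
  assumes f: "coloring f"
  defines "B \<equiv> real (card {v \<in> Od. bad f v})" and "T \<equiv> real (card {v \<in> Od. \<not> typical v})"
    and "U \<equiv> real (card {w \<in> Ev. dull f w})" and "L \<equiv> - ln base" and "n \<equiv> card Od"
  shows "g * D * (B - T) - 2 * theta * D * B + theta * kap / D * psum (\<lambda>v u. \<not> f ` dn v \<subseteq> f ` dn u)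
       - 4 * delta * n - L * (B + T + psum (\<lambda>v u. f ` dn v \<noteq> f ` dn u) / (gam * (real D)\<^sup>2))
       + U * (D * kap - L)
     \<le> (\<Sum>x\<in>Ev \<union> Od. ln (code f x)) - D * (\<Sum>x\<in>Ev \<union> Od. ln (lam (f x))) + D * n * ln eta"
proof -
  have L: "0 \<le> L" using base_pos base_le_1 by (simp add: L_def)
  define e where "e v = card (dn v) * ln (sum lam (f ` dn v)) + card (up v) * ln (sum lam (f ` up v))
      + D * ln (sum lam (CN (f ` N v)))" for v
  have e: "g * D * (B - T) \<le> (\<Sum>v\<in>Od. D * ln eta - e v)"
  proof -
    have "B \<le> real (card ({v \<in> Od. bad f v \<and> typical v} \<union> {v \<in> Od. \<not> typical v}))"
      unfolding B_def using fin by (intro of_nat_mono card_mono) auto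
    also have "\<dots> \<le> real (card {v \<in> Od. bad f v \<and> typical v} + card {v \<in> Od. \<not> typical v})"
      by (intro of_nat_mono card_Un_le)
    finally have "B - T \<le> real (card {v \<in> Od. bad f v \<and> typical v})" by (simp add: T_def)
    then have "g * D * (B - T) \<le> g * D * real (card {v \<in> Od. bad f v \<and> typical v})"
      using g by (intro mult_left_mono) auto
    also have "\<dots> = (\<Sum>v\<in>Od. g * D * of_bool (bad f v \<and> typical v))"
      unfolding sum_distrib_left[symmetric] using fin by (simp add: Collect_conj_eq)
    also have "\<dots> \<le> (\<Sum>v\<in>Od. D * ln eta - e v)"
    proof (rule sum_mono)
      fix v assume "v \<in> Od"
      from local_energy[OF f this] show "g * D * of_bool (bad f v \<and> typical v) \<le> D * ln eta - e v"
        unfolding e_def by linarith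
    qed
    finally show ?thesis .
  qed
  have prior: "- (2 * delta * n + L * (B + (\<Sum>v\<in>Od. 1 - reach f v (f ` dn v)))) \<le>
      (\<Sum>v\<in>Od. ln (prior v f (f ` dn v, f ` up v)))"
  proof -
    have "- (2 * delta + L * (of_bool (bad f v) + (1 - reach f v (f ` dn v))))
        \<le> ln (prior v f (f ` dn v, f ` up v))" if v: "v \<in> Od" for v
    proof -
      have r: "reach f v (f ` dn v) \<le> 1"
        using sum_reach_le[of v "{f ` dn v}" f] v by auto
      show ?thesis
      proof (cases "f ` dn v = f ` up v")
        case True
        have "0 \<le> L * of_bool (bad f v)" using L by simp
        then show ?thesis using ln_prior_Od[OF v, of "f ` dn v" "f ` up v" f] True
          by (simp add: L_def algebra_simps)
      next
        case False
        have "0 \<le> L * (1 - reach f v (f ` dn v))" using L r by simp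
        then show ?thesis using ln_prior_Od[OF v, of "f ` dn v" "f ` up v" f] False delta
          by (simp add: L_def bad_def algebra_simps)
      qed
    qed
    then have "(\<Sum>v\<in>Od. - (2 * delta + L * (of_bool (bad f v) + (1 - reach f v (f ` dn v)))))
        \<le> (\<Sum>v\<in>Od. ln (prior v f (f ` dn v, f ` up v)))" by (rule sum_mono)
    also have "(\<Sum>v\<in>Od. - (2 * delta + L * (of_bool (bad f v) + (1 - reach f v (f ` dn v)))))
       = - (2 * delta * n + L * (B + (\<Sum>v\<in>Od. 1 - reach f v (f ` dn v))))"
      unfolding sum_negf sum.distrib sum_distrib_left[symmetric] B_def n_def
      using fin by (simp add: Collect_conj_eq)
    finally show ?thesis .
  qed
  have "L * (\<Sum>v\<in>Od. 1 - reach f v (f ` dn v))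
     \<le> L * (T + psum (\<lambda>v u. f ` dn v \<noteq> f ` dn u) / (gam * (real D)\<^sup>2))"
    unfolding T_def using sum_reach_defect L by (intro mult_left_mono) auto
  note prior' = prior this
  have tilt: "theta * kap / D * psum (\<lambda>v u. \<not> f ` dn v \<subseteq> f ` dn u) - 2 * theta * D * B
     \<le> (\<Sum>v\<in>Od. \<Sum>y\<in>dn v. theta * kap * card {u \<in> dn y. \<not> f ` dn v \<subseteq> f ` dn u} / D - 2 * theta * psi f y (f y))"
  proof -
    have card: "real (card {u \<in> dn y. \<not> f ` dn v \<subseteq> f ` dn u}) = (\<Sum>u\<in>dn y. of_bool (\<not> f ` dn v \<subseteq> f ` dn u))"
      if "v \<in> Od" "y \<in> dn v" for v y
    proof -
      have "finite (dn y)" using that dn_Od finite_dn by auto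
      then show ?thesis by (simp add: Collect_conj_eq)
    qed
    have "(\<Sum>v\<in>Od. \<Sum>y\<in>dn v. theta * kap * card {u \<in> dn y. \<not> f ` dn v \<subseteq> f ` dn u} / D)
      = (\<Sum>v\<in>Od. \<Sum>y\<in>dn v. theta * kap / D * (\<Sum>u\<in>dn y. of_bool (\<not> f ` dn v \<subseteq> f ` dn u)))"
      by (intro sum.cong) (auto simp: card)
    also have "\<dots> = theta * kap / D * psum (\<lambda>v u. \<not> f ` dn v \<subseteq> f ` dn u)"
      by (simp only: psum_def sum_distrib_left[symmetric])
    finally have 1: "(\<Sum>v\<in>Od. \<Sum>y\<in>dn v. theta * kap * card {u \<in> dn y. \<not> f ` dn v \<subseteq> f ` dn u} / D)
      = theta * kap / D * psum (\<lambda>v u. \<not> f ` dn v \<subseteq> f ` dn u)" .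
    have "(\<Sum>v\<in>Od. \<Sum>y\<in>dn v. 2 * theta * psi f y (f y)) = 2 * theta * (\<Sum>v\<in>Od. \<Sum>y\<in>dn v. psi f y (f y))"
      by (simp only: sum_distrib_left)
    also have "\<dots> \<le> 2 * theta * (D * B)"
      unfolding B_def using sum_psi_le[OF f] theta by (intro mult_left_mono) auto
    finally show ?thesis using 1 by (simp add: sum_subtractf mult.assoc)
  qed
  have od: "(\<Sum>v\<in>Od. ln (prior v f (f ` dn v, f ` up v))) + D * (\<Sum>y\<in>Ev. ln (lam (f y)))
      - (\<Sum>v\<in>Od. e v) + D * (\<Sum>v\<in>Od. ln (sum lam (CN (f ` N v))))
      + (\<Sum>v\<in>Od. \<Sum>y\<in>dn v. theta * kap * card {u \<in> dn y. \<not> f ` dn v \<subseteq> f ` dn u} / D - 2 * theta * psi f y (f y))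
      \<le> (\<Sum>v\<in>Od. ln (code f v))"
  proof -
    have "(\<Sum>v\<in>Od. ln (prior v f (f ` dn v, f ` up v)) + (\<Sum>y\<in>N v. ln (lam (f y)))
      - e v + D * ln (sum lam (CN (f ` N v)))
      + (\<Sum>y\<in>dn v. theta * kap * card {u \<in> dn y. \<not> f ` dn v \<subseteq> f ` dn u} / D - 2 * theta * psi f y (f y)))
      \<le> (\<Sum>v\<in>Od. ln (code f v))"
    proof (rule sum_mono)
      fix v assume "v \<in> Od"
      from ln_code_Od(2)[OF f this] show "ln (prior v f (f ` dn v, f ` up v)) + (\<Sum>y\<in>N v. ln (lam (f y)))
        - e v + D * ln (sum lam (CN (f ` N v)))
        + (\<Sum>y\<in>dn v. theta * kap * card {u \<in> dn y. \<not> f ` dn v \<subseteq> f ` dn u} / D - 2 * theta * psi f y (f y))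
        \<le> ln (code f v)" unfolding e_def by linarith
    qed
    then show ?thesis
      by (simp only: sum.distrib sum_subtractf sum_N_Od sum_distrib_left[symmetric])
  qed
  have ev: "D * (\<Sum>v\<in>Od. ln (lam (f v))) - D * (\<Sum>v\<in>Od. ln (sum lam (CN (f ` N v))))
      + U * (D * kap - L) - 2 * delta * n \<le> (\<Sum>w\<in>Ev. ln (code f w))"
  proof -
    have "(\<Sum>w\<in>Ev. (\<Sum>v\<in>N w. ln (lam (f v)) - ln (sum lam (CN (f ` N v)))) +
        (of_bool (dull f w) * (D * kap - L) - 2 * delta)) \<le> (\<Sum>w\<in>Ev. ln (code f w))"
    proof (rule sum_mono)
      fix w assume w: "w \<in> Ev"
      show "(\<Sum>v\<in>N w. ln (lam (f v)) - ln (sum lam (CN (f ` N v)))) +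
        (of_bool (dull f w) * (D * kap - L) - 2 * delta) \<le> ln (code f w)"
        using ln_code_Ev(2,3)[OF f w] delta by (cases "dull f w") (auto simp: L_def)
    qed
    moreover have "(\<Sum>w\<in>Ev. of_bool (dull f w) * (D * kap - L) - 2 * delta) = U * (D * kap - L) - 2 * delta * n"
      unfolding sum_subtractf sum_distrib_right[symmetric] U_def n_def card_Ev_Od[symmetric]
      using fin by (simp add: Collect_conj_eq)
    ultimately show ?thesis
      by (simp only: sum.distrib sum_N_Ev) (simp add: sum_subtractf algebra_simps)
  qed
  have V: "(\<Sum>x\<in>Ev \<union> Od. F x) = (\<Sum>x\<in>Ev. F x) + (\<Sum>x\<in>Od. F x)" for F :: "'a \<Rightarrow> real"
    using fin disj by (simp add: sum.union_disjoint)
  have "(\<Sum>v\<in>Od. D * ln eta - e v) = D * n * ln eta - (\<Sum>v\<in>Od. e v)"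
    by (simp add: sum_subtractf n_def)
  with e prior' tilt od ev show ?thesis
    unfolding V by (simp add: distrib_left)
qed

lemma weight_large_gain:
  fixes t :: real
  assumes S: "S \<subseteq> Ev \<union> Od \<rightarrow>\<^sub>E K"
    and large: "\<And>f. f \<in> S \<Longrightarrow> exp t * (\<Prod>x\<in>Ev \<union> Od. lam (f x))
        \<le> eta ^ card Od * (\<Prod>x\<in>Ev \<union> Od. code f x powr (1 / D))"
  shows "(\<Sum>f\<in>S. \<Prod>x\<in>Ev \<union> Od. lam (f x)) \<le> exp (- t) * eta ^ card Od"
proof -
  have finP: "finite (Ev \<union> Od \<rightarrow>\<^sub>E K)" using fin by (intro finite_PiE) auto
  have "exp t * (\<Sum>f\<in>S. \<Prod>x\<in>Ev \<union> Od. lam (f x)) \<le> (\<Sum>f\<in>S. eta ^ card Od * (\<Prod>x\<in>Ev \<union> Od. code f x powr (1 / D)))"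
    unfolding sum_distrib_left by (intro sum_mono large)
  also have "\<dots> \<le> eta ^ card Od * (\<Sum>f\<in>Ev \<union> Od \<rightarrow>\<^sub>E K. \<Prod>x\<in>Ev \<union> Od. code f x powr (1 / D))"
    unfolding sum_distrib_left[symmetric]
    using eta_pos finP S by (intro mult_left_mono sum_mono2) (auto intro!: prod_nonneg)
  also have "\<dots> \<le> eta ^ card Od * 1"
    using eta_pos sum_code_le_1 by (intro mult_left_mono) auto
  finally show ?thesis by (simp add: exp_minus field_simps)
qed

lemma gain_less:
  fixes t :: real
  assumes f: "coloring f"
    and "\<not> exp t * (\<Prod>x\<in>Ev \<union> Od. lam (f x)) \<le> eta ^ card Od * (\<Prod>x\<in>Ev \<union> Od. code f x powr (1 / D))"
  shows "(\<Sum>x\<in>Ev \<union> Od. ln (code f x)) - D * (\<Sum>x\<in>Ev \<union> Od. ln (lam (f x))) + D * card Od * ln eta < D * t"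
proof -
  have c: "0 < code f x" if "x \<in> Ev \<union> Od" for x
    using that ln_code_Od(1)[OF f] ln_code_Ev(1)[OF f] by auto
  have l: "0 < lam (f x)" if "x \<in> Ev \<union> Od" for x
    using that f lam_pos by (auto simp: coloring_def)
  have finV: "finite (Ev \<union> Od)" using fin by simp
  have pc: "0 < (\<Prod>x\<in>Ev \<union> Od. code f x powr (1 / D))" using c by (intro prod_pos) fastforce
  have pl: "0 < (\<Prod>x\<in>Ev \<union> Od. lam (f x))" using l by (intro prod_pos) auto
  have "ln (eta ^ card Od * (\<Prod>x\<in>Ev \<union> Od. code f x powr (1 / D))) < ln (exp t * (\<Prod>x\<in>Ev \<union> Od. lam (f x)))"
    using assms(2) pc pl eta_pos by simp
  moreover have "ln (eta ^ card Od * (\<Prod>x\<in>Ev \<union> Od. code f x powr (1 / D)))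
     = card Od * ln eta + ln (\<Prod>x\<in>Ev \<union> Od. code f x powr (1 / D))"
    using eta_pos pc by (simp add: ln_mult_pos ln_realpow)
  moreover have "ln (\<Prod>x\<in>Ev \<union> Od. code f x powr (1 / D)) = (\<Sum>x\<in>Ev \<union> Od. ln (code f x powr (1 / D)))"
    using c by (intro ln_prod finV) fastforce
  moreover have "\<dots> = (\<Sum>x\<in>Ev \<union> Od. ln (code f x)) / D"
    using c by (simp add: sum_divide_distrib ln_powr)
  moreover have "ln (exp t * (\<Prod>x\<in>Ev \<union> Od. lam (f x))) = t + ln (\<Prod>x\<in>Ev \<union> Od. lam (f x))"
    using pl by (simp add: ln_mult_pos)
  moreover have "ln (\<Prod>x\<in>Ev \<union> Od. lam (f x)) = (\<Sum>x\<in>Ev \<union> Od. ln (lam (f x)))"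
    using l by (intro ln_prod finV) fastforce
  ultimately have "card Od * ln eta + (\<Sum>x\<in>Ev \<union> Od. ln (code f x)) / D < t + (\<Sum>x\<in>Ev \<union> Od. ln (lam (f x)))"
    by linarith
  then show ?thesis using D_pos by (simp add: field_simps)
qed

end

section \<open>Combining the two orders\<close>

context ranked_bipartite begin

lemma sum_dn_swap: "(\<Sum>v\<in>Od. \<Sum>y\<in>dn v. F v y) = (\<Sum>y\<in>Ev. \<Sum>v\<in>up y. F v y)"
  for F :: "'a \<Rightarrow> 'a \<Rightarrow> real"
proof -
  have "(\<Sum>v\<in>Od. \<Sum>y\<in>dn v. F v y) = (\<Sum>(v, y)\<in>Sigma Od dn. F v y)"
    using fin finite_dn by (subst sum.Sigma) auto
  also have "\<dots> = (\<Sum>(y, v)\<in>Sigma Ev up. F v y)"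
    by (intro sum.reindex_bij_witness[of _ "\<lambda>(y, v). (v, y)" "\<lambda>(y, v). (v, y)"])
       (auto simp: dn_def up_def intro: N_sym dest: N_Od[THEN subsetD] N_Ev[THEN subsetD])
  also have "\<dots> = (\<Sum>y\<in>Ev. \<Sum>v\<in>up y. F v y)"
    using fin finite_up by (subst sum.Sigma) auto
  finally show ?thesis .
qed

lemma psum_eq: "psum P = (\<Sum>y\<in>Ev. \<Sum>v\<in>up y. \<Sum>u\<in>dn y. of_bool (P v u))"
  unfolding psum_def by (rule sum_dn_swap)

text \<open>Each such \<open>y\<close> is the middle of a counted path, and different
  \<open>y\<close> belong to different paths.\<close>

lemma card_mismatch_le: "real (card {y \<in> Ev. \<exists>v\<in>up y. \<exists>u\<in>dn y. P v u}) \<le> psum P"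
proof -
  have "real (card {y \<in> Ev. \<exists>v\<in>up y. \<exists>u\<in>dn y. P v u}) = (\<Sum>y\<in>Ev. of_bool (\<exists>v\<in>up y. \<exists>u\<in>dn y. P v u))"
    using fin by (simp add: Collect_conj_eq)
  also have "\<dots> \<le> psum P"
    unfolding psum_eq
  proof (rule sum_mono)
    fix y assume y: "y \<in> Ev"
    show "of_bool (\<exists>v\<in>up y. \<exists>u\<in>dn y. P v u) \<le> (\<Sum>v\<in>up y. \<Sum>u\<in>dn y. of_bool (P v u) :: real)"
    proof (cases "\<exists>v\<in>up y. \<exists>u\<in>dn y. P v u")
      case True
      then obtain v u where vu: "v \<in> up y" "u \<in> dn y" "P v u" by blast
      have "(1::real) = of_bool (P v u)" using vu by simp
      also have "\<dots> \<le> (\<Sum>u\<in>dn y. of_bool (P v u))"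
        using vu y finite_dn by (intro member_le_sum[where f = "\<lambda>u. of_bool (P v u)"]) auto
      also have "\<dots> \<le> (\<Sum>v\<in>up y. \<Sum>u\<in>dn y. of_bool (P v u))"
        using vu y finite_up
        by (intro member_le_sum[where f = "\<lambda>v. \<Sum>u\<in>dn y. of_bool (P v u)"]) (auto intro!: sum_nonneg)
      finally show ?thesis using True by simp
    next
      case False
      then show ?thesis by (auto intro!: sum_nonneg)
    qed
  qed
  finally show ?thesis .
qed

lemma card_nbr_le: "card {y \<in> Ev. \<exists>v\<in>N y. P v} \<le> D * card {v \<in> Od. P v}"
proof -
  have "{y \<in> Ev. \<exists>v\<in>N y. P v} \<subseteq> (\<Union>v\<in>{v \<in> Od. P v}. N v)"
    using N_Ev N_sym by blast
  then have "card {y \<in> Ev. \<exists>v\<in>N y. P v} \<le> card (\<Union>v\<in>{v \<in> Od. P v}. N v)"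
    using fin finite_N by (intro card_mono) auto
  also have "\<dots> \<le> (\<Sum>v\<in>{v \<in> Od. P v}. card (N v))" using fin by (intro card_UN_le) auto
  also have "\<dots> = D * card {v \<in> Od. P v}" by (simp add: card_N)
  finally show ?thesis .
qed

end

text \<open>The bound \<open>rho_le\<close> makes the truncated subtraction \<open>R - rho x\<close>
  reverse the order strictly, so that the two instances exchange \<open>dn\<close> and
  \<open>up\<close>.\<close>

locale two_sided = asc: gain Ev Od N rho D K lam adj delta theta kap eta g gam +
  desc: gain Ev Od N "\<lambda>x. R - rho x" D K lam adj delta theta kap eta g gam
  for Ev Od :: "'a set" and N and rho :: "'a \<Rightarrow> nat" and D and K :: "'h set"
    and lam adj delta theta kap eta g gam and R :: nat +
  assumes rho_le: "x \<in> Ev \<union> Od \<Longrightarrow> rho x \<le> R"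
begin

lemma desc_dn: "x \<in> Ev \<union> Od \<Longrightarrow> desc.dn x = asc.up x"
  and desc_up: "x \<in> Ev \<union> Od \<Longrightarrow> desc.up x = asc.dn x"
proof -
  assume x: "x \<in> Ev \<union> Od"
  have "(R - rho y < R - rho x \<longleftrightarrow> rho x < rho y) \<and> (R - rho x < R - rho y \<longleftrightarrow> rho y < rho x)"
    if "y \<in> N x" for y
  proof -
    have "y \<in> Ev \<union> Od" using x that asc.N_Od asc.N_Ev by blast
    then show ?thesis using rho_le[of y] rho_le[OF x] by auto
  qed
  then show "desc.dn x = asc.up x" "desc.up x = asc.dn x"
    by (auto simp: desc.dn_def desc.up_def asc.dn_def asc.up_def)
qed

text \<open>Badness treats the two sides alike, so both codes gain at the same vertices.\<close>

lemma desc_bad: "v \<in> Od \<Longrightarrow> desc.bad f v \<longleftrightarrow> asc.bad f v"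
  by (auto simp: desc.bad_def asc.bad_def desc_dn desc_up)

lemma desc_psum: "desc.psum P = asc.psum (\<lambda>v u. P u v)"
  unfolding desc.psum_eq asc.psum_eq
proof (rule sum.cong)
  fix y assume "y \<in> Ev"
  then show "(\<Sum>v\<in>desc.up y. \<Sum>u\<in>desc.dn y. of_bool (P v u) :: real) = (\<Sum>v\<in>asc.up y. \<Sum>u\<in>asc.dn y. of_bool (P u v))"
    by (subst sum.swap) (simp add: desc_dn desc_up)
qed simp

abbreviation Bad :: "('a \<Rightarrow> 'h) \<Rightarrow> 'a set" where "Bad f \<equiv> {v \<in> Od. asc.bad f v}"

definition atypical :: "'a set" where
  "atypical = {v \<in> Od. \<not> asc.typical v} \<union> {v \<in> Od. \<not> desc.typical v}
     \<union> {w \<in> Ev. asc.dn w = {} \<or> asc.up w = {}}"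

text \<open>
  The ascending code only pays for \<open>f ` dn v\<close> not being contained in \<open>f ` dn u\<close> with \<open>u\<close> below
  \<open>v\<close>, the descending code for the opposite non-containment of the upper sets; at vertices that
  are not bad the lower and upper sets agree, so together they control every mismatch.
\<close>

lemma mismatch_le:
  shows "asc.psum (\<lambda>v u. f ` asc.dn v \<noteq> f ` asc.dn u)
      \<le> asc.psum (\<lambda>v u. \<not> f ` asc.dn v \<subseteq> f ` asc.dn u) + asc.psum (\<lambda>v u. \<not> f ` asc.up u \<subseteq> f ` asc.up v)
        + 2 * (real D)\<^sup>2 * card (Bad f)" (is ?dn)
    and "asc.psum (\<lambda>v u. f ` asc.up v \<noteq> f ` asc.up u)
      \<le> asc.psum (\<lambda>v u. \<not> f ` asc.dn v \<subseteq> f ` asc.dn u) + asc.psum (\<lambda>v u. \<not> f ` asc.up u \<subseteq> f ` asc.up v)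
        + 2 * (real D)\<^sup>2 * card (Bad f)" (is ?up)
proof -
  define P where "P = (\<lambda>v u. \<not> f ` asc.dn v \<subseteq> f ` asc.dn u)"
  define Q where "Q = (\<lambda>v u. \<not> f ` asc.up u \<subseteq> f ` asc.up v)"
  have le: "asc.psum (\<lambda>v u. (P v u \<or> Q v u) \<or> (asc.bad f v \<or> asc.bad f u))
     \<le> asc.psum P + asc.psum Q + 2 * (real D)\<^sup>2 * card (Bad f)"
    using asc.psum_disj[of "\<lambda>v u. P v u \<or> Q v u" "\<lambda>v u. asc.bad f v \<or> asc.bad f u"]
      asc.psum_disj[of P Q] asc.psum_disj[of "\<lambda>v u. asc.bad f v" "\<lambda>v u. asc.bad f u"]
      asc.psum_fst_le[of "asc.bad f"] asc.psum_snd_le[of "asc.bad f"] by linarith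
  have *: "f ` asc.dn v = f ` asc.up v" if "\<not> asc.bad f v" for v
    using that by (simp add: asc.bad_def)
  have "asc.psum (\<lambda>v u. f ` asc.dn v \<noteq> f ` asc.dn u)
    \<le> asc.psum (\<lambda>v u. (P v u \<or> Q v u) \<or> (asc.bad f v \<or> asc.bad f u))"
    by (intro asc.psum_mono) (use * in \<open>unfold P_def Q_def, metis subset_antisym\<close>)
  with le show ?dn unfolding P_def Q_def by linarith
  have "asc.psum (\<lambda>v u. f ` asc.up v \<noteq> f ` asc.up u)
    \<le> asc.psum (\<lambda>v u. (P v u \<or> Q v u) \<or> (asc.bad f v \<or> asc.bad f u))"
    by (intro asc.psum_mono) (use * in \<open>unfold P_def Q_def, metis subset_antisym\<close>)
  with le show ?up unfolding P_def Q_def by linarith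
qed

definition large_gain :: "real \<Rightarrow> ('a \<Rightarrow> 'h) \<Rightarrow> bool" where
  "large_gain t f \<longleftrightarrow>
     exp t * (\<Prod>x\<in>Ev \<union> Od. lam (f x)) \<le> eta ^ card Od * (\<Prod>x\<in>Ev \<union> Od. asc.code f x powr (1 / D)) \<or>
     exp t * (\<Prod>x\<in>Ev \<union> Od. lam (f x)) \<le> eta ^ card Od * (\<Prod>x\<in>Ev \<union> Od. desc.code f x powr (1 / D))"

lemma weight_large_gain:
  "(\<Sum>f\<in>{f \<in> Ev \<union> Od \<rightarrow>\<^sub>E K. large_gain t f}. \<Prod>x\<in>Ev \<union> Od. lam (f x)) \<le> 2 * exp (- t) * eta ^ card Od"
proof -
  define S1 where "S1 = {f \<in> Ev \<union> Od \<rightarrow>\<^sub>E K. exp t * (\<Prod>x\<in>Ev \<union> Od. lam (f x))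
      \<le> eta ^ card Od * (\<Prod>x\<in>Ev \<union> Od. asc.code f x powr (1 / D))}"
  define S2 where "S2 = {f \<in> Ev \<union> Od \<rightarrow>\<^sub>E K. exp t * (\<Prod>x\<in>Ev \<union> Od. lam (f x))
      \<le> eta ^ card Od * (\<Prod>x\<in>Ev \<union> Od. desc.code f x powr (1 / D))}"
  have finP: "finite (Ev \<union> Od \<rightarrow>\<^sub>E K)" using asc.fin by (intro finite_PiE) auto
  have nonneg: "0 \<le> (\<Prod>x\<in>Ev \<union> Od. lam (f x))" if "f \<in> S1 \<union> S2" for f
    using that asc.lam_pos by (intro prod_nonneg) (auto simp: S1_def S2_def PiE_iff less_imp_le)
  have "{f \<in> Ev \<union> Od \<rightarrow>\<^sub>E K. large_gain t f} = S1 \<union> S2"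
    by (auto simp: S1_def S2_def large_gain_def)
  then have "(\<Sum>f\<in>{f \<in> Ev \<union> Od \<rightarrow>\<^sub>E K. large_gain t f}. \<Prod>x\<in>Ev \<union> Od. lam (f x))
    \<le> (\<Sum>f\<in>S1. \<Prod>x\<in>Ev \<union> Od. lam (f x)) + (\<Sum>f\<in>S2. \<Prod>x\<in>Ev \<union> Od. lam (f x))"
    using sum.union_inter[of S1 S2 "\<lambda>f. \<Prod>x\<in>Ev \<union> Od. lam (f x)"] finP
      sum_nonneg[of "S1 \<inter> S2" "\<lambda>f. \<Prod>x\<in>Ev \<union> Od. lam (f x)"] nonneg
    by (simp add: S1_def S2_def)
  moreover have "(\<Sum>f\<in>S1. \<Prod>x\<in>Ev \<union> Od. lam (f x)) \<le> exp (- t) * eta ^ card Od"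
    by (intro asc.weight_large_gain) (auto simp: S1_def)
  moreover have "(\<Sum>f\<in>S2. \<Prod>x\<in>Ev \<union> Od. lam (f x)) \<le> exp (- t) * eta ^ card Od"
    by (intro desc.weight_large_gain) (auto simp: S2_def)
  ultimately show ?thesis by linarith
qed

text \<open>Adding the bounds of the two codes gives \<open>2 * g * D * B\<close> for the bad
  vertices. The choice \<open>theta = g / 8\<close> spends a quarter of this on the tilt, the
  condition \<open>eps * (2 + 4 / gam) \<le> g / 2\<close> another quarter on wrong guesses, and
  half remains. The other two conditions on \<open>eps\<close> likewise preserve half of the
  mismatch term and half of the dull term.\<close>

lemma defects_le:
  fixes f :: "'a \<Rightarrow> 'h" and eps t :: real
  assumes f: "asc.coloring f" and small: "\<not> large_gain t f"
    and theta_eq: "theta = g / 8" and eps: "- ln asc.base \<le> eps * D" "0 \<le> eps"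
      "eps * (2 + 4 / gam) \<le> g / 2" "4 * eps \<le> theta * kap * gam" "eps \<le> kap / 2"
  defines "a \<equiv> asc.psum (\<lambda>v u. \<not> f ` asc.dn v \<subseteq> f ` asc.dn u)"
    and "b \<equiv> asc.psum (\<lambda>v u. \<not> f ` asc.up u \<subseteq> f ` asc.up v)"
  shows "g * card (Bad f) + theta * kap / 2 * ((a + b) / (real D)\<^sup>2) + kap * card {w \<in> Ev. asc.dull f w}
     \<le> 2 * t + 8 * delta * card Od + 2 * (g + eps) * card atypical"
proof -
  define B where "B = real (card (Bad f))"
  define U where "U = real (card {w \<in> Ev. asc.dull f w})"
  define L where "L = - ln asc.base"
  define n where "n = real (card Od)"
  define T where "T = real (card atypical)"
  define T1 where "T1 = real (card {v \<in> Od. \<not> asc.typical v})"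
  define T2 where "T2 = real (card {v \<in> Od. \<not> desc.typical v})"
  define q where "q = gam * (real D)\<^sup>2"
  have D: "0 < real D" using asc.D_pos by simp
  have q: "0 < q" using asc.gam_pos D by (simp add: q_def)
  have L: "0 \<le> L" "L \<le> eps * D" using asc.base_pos asc.base_le_1 eps by (auto simp: L_def)
  have finT: "finite atypical" using asc.fin by (auto simp: atypical_def)
  have T: "T1 \<le> T" "T2 \<le> T"
    unfolding T1_def T2_def T_def using finT by (auto intro!: card_mono simp: atypical_def)
  have nn: "0 \<le> B" "0 \<le> U" "0 \<le> T1" "0 \<le> T2" "0 \<le> n" "0 \<le> a" "0 \<le> b"
    using asc.psum_nonneg by (auto simp: B_def U_def T1_def T2_def n_def a_def b_def)
  have badeq: "{v \<in> Od. desc.bad f v} = Bad f" using desc_bad by auto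
  define s where "s = (a + b + 2 * (real D)\<^sup>2 * B) / q"
  have m1: "asc.psum (\<lambda>v u. f ` asc.dn v \<noteq> f ` asc.dn u) / q \<le> s"
    unfolding s_def a_def b_def B_def using mismatch_le(1) q by (intro divide_right_mono) auto
  have "desc.psum (\<lambda>v u. f ` desc.dn v \<noteq> f ` desc.dn u) = desc.psum (\<lambda>v u. f ` asc.up v \<noteq> f ` asc.up u)"
    by (intro antisym desc.psum_mono) (auto simp: desc_dn)
  also have "\<dots> = asc.psum (\<lambda>v u. f ` asc.up v \<noteq> f ` asc.up u)"
    unfolding desc_psum by (simp add: eq_commute)
  finally have m2: "desc.psum (\<lambda>v u. f ` desc.dn v \<noteq> f ` desc.dn u) / q \<le> s"
    unfolding s_def a_def b_def B_def using mismatch_le(2) q by (auto intro!: divide_right_mono)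
  have "desc.psum (\<lambda>v u. \<not> f ` desc.dn v \<subseteq> f ` desc.dn u) = desc.psum (\<lambda>v u. \<not> f ` asc.up v \<subseteq> f ` asc.up u)"
    by (intro antisym desc.psum_mono) (auto simp: desc_dn)
  then have b_eq: "desc.psum (\<lambda>v u. \<not> f ` desc.dn v \<subseteq> f ` desc.dn u) = b"
    unfolding b_def desc_psum by simp
  have "g * D * (B - T1) - 2 * theta * D * B + theta * kap / D * a
       - 4 * delta * n - L * (B + T1 + asc.psum (\<lambda>v u. f ` asc.dn v \<noteq> f ` asc.dn u) / q)
       + U * (D * kap - L) < D * t"
    using asc.gain_lower_bound[OF f] asc.gain_less[OF f, of t] small
    unfolding large_gain_def B_def T1_def a_def L_def U_def n_def q_def by linarith
  moreover have "L * (asc.psum (\<lambda>v u. f ` asc.dn v \<noteq> f ` asc.dn u) / q) \<le> L * s"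
    using m1 L by (intro mult_left_mono) auto
  ultimately have A: "g * D * (B - T1) - 2 * theta * D * B + theta * kap / D * a
       - 4 * delta * n - L * (B + T1) - L * s + U * (D * kap - L) < D * t"
    by (simp add: distrib_left)
  have "g * D * (B - T2) - 2 * theta * D * B + theta * kap / D * b
       - 4 * delta * n - L * (B + T2 + desc.psum (\<lambda>v u. f ` desc.dn v \<noteq> f ` desc.dn u) / q)
       + U * (D * kap - L) < D * t"
    using desc.gain_lower_bound[OF f] desc.gain_less[OF f, of t] small
    unfolding large_gain_def B_def T2_def b_eq badeq L_def U_def n_def q_def by linarith
  moreover have "L * (desc.psum (\<lambda>v u. f ` desc.dn v \<noteq> f ` desc.dn u) / q) \<le> L * s"
    using m2 L by (intro mult_left_mono) auto
  ultimately have A': "g * D * (B - T2) - 2 * theta * D * B + theta * kap / D * b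
       - 4 * delta * n - L * (B + T2) - L * s + U * (D * kap - L) < D * t"
    by (simp add: distrib_left)
  have s_eq: "s = (a + b) / q + 2 * B / gam"
    using D asc.gam_pos by (simp add: s_def q_def add_divide_distrib)
  have Ls: "L * s \<le> eps * D * ((a + b) / q) + eps * D * (2 * B / gam)"
    unfolding s_eq distrib_left[symmetric]
    using L q nn asc.gam_pos by (intro mult_right_mono) auto
  have e1: "2 * (eps * D * ((a + b) / q)) \<le> theta * kap / 2 * ((a + b) / D)"
  proof -
    have "2 * (eps * D * ((a + b) / q)) = (4 * eps) * ((a + b) / (2 * gam * D))"
      using D asc.gam_pos by (simp add: q_def power2_eq_square field_simps)
    also have "\<dots> \<le> (theta * kap * gam) * ((a + b) / (2 * gam * D))"
      using eps nn D asc.gam_pos by (intro mult_right_mono) auto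
    also have "\<dots> = theta * kap / 2 * ((a + b) / D)"
      using D asc.gam_pos by (simp add: field_simps)
    finally show ?thesis .
  qed
  have e2: "2 * (eps * D * B) + 2 * (eps * D * (2 * B / gam)) \<le> g / 2 * (D * B)"
  proof -
    have "2 * (eps * D * B) + 2 * (eps * D * (2 * B / gam)) = (eps * (2 + 4 / gam)) * (D * B)"
      by (simp add: algebra_simps)
    also have "\<dots> \<le> g / 2 * (D * B)" using eps nn D by (intro mult_right_mono) auto
    finally show ?thesis .
  qed
  have LB: "L * B \<le> eps * D * B" using L nn by (intro mult_right_mono) auto
  have LT: "L * (T1 + T2) \<le> eps * D * (2 * T)" using L T nn eps D by (intro mult_mono) auto
  have gT: "g * D * (T1 + T2) \<le> g * D * (2 * T)" using T asc.g D by (intro mult_left_mono) auto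
  have UL: "U * (D * kap / 2) \<le> U * (D * kap - L)"
  proof (intro mult_left_mono)
    have "eps * D \<le> kap / 2 * D" using eps D by (intro mult_right_mono) auto
    then show "D * kap / 2 \<le> D * kap - L" using L by (simp add: field_simps)
  qed (use nn in auto)
  have eq: "theta * kap / D * a + theta * kap / D * b = theta * kap * ((a + b) / D)"
    by (simp add: add_divide_distrib distrib_left)
  have th: "4 * theta * D * B = g / 2 * (D * B)" by (simp add: theta_eq)
  have e1': "2 * (eps * D * ((a + b) / q)) \<le> theta * kap * ((a + b) / D) / 2"
    and e2': "2 * (eps * D * B) + 2 * (eps * D * (2 * B / gam)) \<le> g * (D * B) / 2"
    and UL': "U * (D * kap) / 2 \<le> U * (D * kap - L)"
    and th': "4 * (theta * (D * B)) = g * (D * B) / 2"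
    and LT': "L * (T1 + T2) \<le> 2 * (eps * D * T)" and gT': "g * D * (T1 + T2) \<le> 2 * (g * D * T)"
    using e1 e2 UL th LT gT by simp_all
  define ab where "ab = (a + b) / D"
  define abq where "abq = (a + b) / q"
  define Bg where "Bg = 2 * B / gam"
  have "g * (D * B) + theta * kap * ab / 2 + U * (D * kap) \<le> 2 * (D * t) + 8 * delta * n + 2 * (g * D * T) + 2 * (eps * D * T)"
    using A A' Ls e1' e2' LB LT' gT' UL' eq th'
    unfolding ab_def[symmetric] abq_def[symmetric] Bg_def[symmetric]
      right_diff_distrib distrib_left mult.assoc by linarith
  \<comment> \<open>A generous step, made so that the factor \<open>D\<close> can be cancelled from
    the whole inequality.\<close>
  also have "8 * delta * n \<le> D * (8 * delta * n)"
  proof -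
    have "1 * (8 * delta * n) \<le> D * (8 * delta * n)"
      using asc.D_pos asc.delta nn by (intro mult_right_mono) auto
    then show ?thesis by simp
  qed
  finally have *: "g * (D * B) + theta * kap * ab / 2 + U * (D * kap)
      \<le> 2 * (D * t) + D * (8 * delta * n) + 2 * (g * D * T) + 2 * (eps * D * T)" by linarith
  have "ab = D * ((a + b) / (real D)\<^sup>2)" using D by (simp add: ab_def power2_eq_square)
  with * have "D * (g * B + theta * kap / 2 * ((a + b) / (real D)\<^sup>2) + kap * U)
      \<le> D * (2 * t + 8 * delta * n + 2 * (g + eps) * T)"
    by (simp add: distrib_left distrib_right mult_ac)
  then have "g * B + theta * kap / 2 * ((a + b) / (real D)\<^sup>2) + kap * U
      \<le> 2 * t + 8 * delta * n + 2 * (g + eps) * T"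
    using D by (rule mult_left_le_imp_le)
  then show ?thesis by (simp add: B_def U_def n_def T_def)
qed

definition mixed :: "('a \<Rightarrow> 'h) \<Rightarrow> 'a set" where
  "mixed f = {w \<in> Ev. asc.dn w = {} \<or> asc.up w = {} \<or> (\<exists>v\<in>N w. asc.bad f v) \<or>
     (\<exists>v\<in>asc.up w. \<exists>u\<in>asc.dn w. f ` asc.dn v \<noteq> f ` asc.dn u)}"

lemma card_mixed_le:
  "real (card (mixed f)) \<le> card atypical + D * card (Bad f) + asc.psum (\<lambda>v u. f ` asc.dn v \<noteq> f ` asc.dn u)"
proof -
  define W1 where "W1 = {w \<in> Ev. asc.dn w = {} \<or> asc.up w = {}}"
  define W2 where "W2 = {w \<in> Ev. \<exists>v\<in>N w. asc.bad f v}"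
  define W3 where "W3 = {w \<in> Ev. \<exists>v\<in>asc.up w. \<exists>u\<in>asc.dn w. f ` asc.dn v \<noteq> f ` asc.dn u}"
  have "mixed f = W1 \<union> W2 \<union> W3" unfolding mixed_def W1_def W2_def W3_def by blast
  then have "card (mixed f) \<le> card W1 + card W2 + card W3"
    using card_Un_le[of "W1 \<union> W2" W3] card_Un_le[of W1 W2] by simp
  moreover have "card W1 \<le> card atypical"
    unfolding W1_def atypical_def using asc.fin by (intro card_mono) auto
  moreover have "card W2 \<le> D * card (Bad f)"
    unfolding W2_def by (rule asc.card_nbr_le)
  moreover have "real (card W3) \<le> asc.psum (\<lambda>v u. f ` asc.dn v \<noteq> f ` asc.dn u)"
    unfolding W3_def by (rule asc.card_mismatch_le)
  ultimately show ?thesis by (smt (verit) of_nat_add of_nat_mono of_nat_mult)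
qed

text \<open>An even vertex borrows the set of an arbitrary neighbour; outside \<open>mixed\<close>
  all neighbours give the same one.\<close>

definition phase :: "('a \<Rightarrow> 'h) \<Rightarrow> 'a \<Rightarrow> 'h set" where
  "phase f x = f ` asc.dn (if x \<in> Od then x else SOME v. v \<in> N x)"

text \<open>\<open>mixed\<close> compares only an upper with a lower neighbour. Two neighbours on
  the same side are compared through one on the other side, which is why a vertex with an empty side
  counts as mixed.\<close>

lemma phase_nbr:
  assumes w: "w \<in> Ev" "w \<notin> mixed f" and v: "v \<in> N w"
  shows "phase f v = phase f w" "\<not> asc.bad f v"
proof -
  have wV: "w \<in> Ev \<union> Od" using w by simp
  show "\<not> asc.bad f v" using w v by (auto simp: mixed_def)
  have vO: "v \<in> Od" using asc.N_Ev w v by auto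
  have wO: "w \<notin> Od" using w asc.disj by auto
  define v' where "v' = (SOME v. v \<in> N w)"
  have v': "v' \<in> N w" unfolding v'_def using v by (rule someI)
  obtain u1 u2 where u: "u1 \<in> asc.up w" "u2 \<in> asc.dn w" using w by (auto simp: mixed_def)
  have same: "f ` asc.dn x = f ` asc.dn y" if "x \<in> asc.up w" "y \<in> asc.dn w" for x y
    using that w by (auto simp: mixed_def)
  have "f ` asc.dn x = f ` asc.dn u2" if "x \<in> N w" for x
  proof (cases "x \<in> asc.dn w")
    case True
    then show ?thesis using same[OF u(1) True] same[OF u] by simp
  next
    case False
    then have "x \<in> asc.up w" using that asc.N_eq[OF wV] by auto
    then show ?thesis using same u by simp
  qed
  then have "f ` asc.dn v = f ` asc.dn v'" using v v' by simp
  then show "phase f v = phase f w" using vO wO by (simp add: phase_def v'_def)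
qed

lemma phase_image:
  assumes v: "v \<in> Od" "\<not> asc.bad f v"
  shows "f ` N v = phase f v" "sum lam (phase f v) * sum lam (asc.CN (phase f v)) = eta"
  using v asc.N_eq[of v] by (auto simp: phase_def asc.bad_def image_Un)

text \<open>Outside the exceptional sets, an odd vertex and all neighbours of an even vertex see
  exactly the colours \<open>A\<close>. An even vertex that is not dull has a neighbour whose open
  colours, namely \<open>CN A\<close>, all occur around it. If \<open>Bad f\<close> and
  \<open>Z\<close> do not fill \<open>Od\<close>, a single ordinary odd vertex makes
  \<open>A\<close> optimal.\<close>

lemma phase_conclusion:
  fixes f :: "'a \<Rightarrow> 'h" and A :: "'h set"
  assumes f: "asc.coloring f"
  defines "Z \<equiv> {x \<in> Ev \<union> Od. phase f x \<noteq> A}"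
  shows "{w \<in> Ev. f w \<notin> A} \<subseteq> mixed f \<union> Z"
    and "{v \<in> Od. f v \<notin> asc.CN A} \<subseteq> Bad f \<union> Z"
    and "{v \<in> Od. \<not> A \<subseteq> f ` N v} \<subseteq> Bad f \<union> Z"
    and "{w \<in> Ev. \<not> asc.CN A \<subseteq> f ` N w} \<subseteq> mixed f \<union> Z \<union> {w \<in> Ev. asc.dull f w}"
    and "card (Bad f) + card Z < card Od \<Longrightarrow> sum lam A * sum lam (asc.CN A) = eta \<and> A \<subseteq> K"
proof -
  have N: "f ` N v = A" if "v \<in> Od" "v \<notin> Bad f \<union> Z" for v
    using that phase_image(1)[of v f] by (auto simp: Z_def)
  have Ev: "f ` N v = A" if "w \<in> Ev" "w \<notin> mixed f \<union> Z" "v \<in> N w" for v w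
    using that phase_nbr[of w f v] asc.N_Ev[of w] phase_image(1)[of v f] by (auto simp: Z_def)
  show "{v \<in> Od. \<not> A \<subseteq> f ` N v} \<subseteq> Bad f \<union> Z" using N by blast
  show "{v \<in> Od. f v \<notin> asc.CN A} \<subseteq> Bad f \<union> Z"
    using N asc.coloring_in_CN[OF f] by blast
  show "{w \<in> Ev. f w \<notin> A} \<subseteq> mixed f \<union> Z"
  proof safe
    fix w assume w: "w \<in> Ev" "f w \<notin> A" "w \<notin> Z"
    show "w \<in> mixed f"
    proof (rule ccontr)
      assume m: "w \<notin> mixed f"
      obtain v where v: "v \<in> N w" using asc.card_N[of w] asc.D_pos w by fastforce
      have "w \<in> N v" using asc.N_sym v w by blast
      then show False using Ev[OF w(1) _ v] m w by blast
    qed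
  qed
  show "{w \<in> Ev. \<not> asc.CN A \<subseteq> f ` N w} \<subseteq> mixed f \<union> Z \<union> {w \<in> Ev. asc.dull f w}"
    using Ev by (auto simp: asc.dull_def)
  assume card: "card (Bad f) + card Z < card Od"
  have "\<not> Od \<subseteq> Bad f \<union> Z"
  proof
    assume "Od \<subseteq> Bad f \<union> Z"
    then have "card Od \<le> card (Bad f \<union> Z)" using asc.fin by (intro card_mono) (auto simp: Z_def)
    then show False using card card_Un_le[of "Bad f" Z] by linarith
  qed
  then obtain v where v: "v \<in> Od" "v \<notin> Bad f" "v \<notin> Z" by blast
  then have "phase f v = A" by (simp add: Z_def)
  moreover have "phase f v \<subseteq> K"
    using f v asc.dn_Od[of v] by (auto simp: phase_def asc.coloring_def)
  ultimately show "sum lam A * sum lam (asc.CN A) = eta \<and> A \<subseteq> K"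
    using phase_image(2)[of v f] v by auto
qed

end

section \<open>Geometry of the torus\<close>

definition cyc :: "nat \<Rightarrow> nat \<Rightarrow> nat set" where
  "cyc m t = {s. s < m \<and> ([t + 1 = s] (mod m) \<or> [s + 1 = t] (mod m))}"

lemma cyc_iff:
  assumes "t < m" "2 \<le> m"
  shows "s \<in> cyc m t \<longleftrightarrow> s < m \<and> (s = t + 1 \<or> t = s + 1 \<or> t = 0 \<and> s + 1 = m \<or> s = 0 \<and> t + 1 = m)"
proof (cases "s < m")
  case True
  have *: "[p + 1 = q] (mod m) \<longleftrightarrow> (q = p + 1 \<or> p + 1 = m \<and> q = 0)" if "p < m" "q < m" for p q
    using that by (cases "p + 1 = m") (auto simp: cong_def)
  show ?thesis using True assms *[of t s] *[of s t] by (auto simp: cyc_def)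
next
  case False
  then show ?thesis by (simp add: cyc_def)
qed

text \<open>For \<open>m = 2\<close> both directions lead to the same neighbour, whence the degree
  \<open>d\<close> in place of \<open>2 * d\<close>.\<close>

lemma card_cyc:
  assumes "t < m" "2 \<le> m"
  shows "card (cyc m t) = (if m = 2 then 1 else 2)"
proof -
  have "cyc m t = {if t + 1 = m then 0 else t + 1, if t = 0 then m - 1 else t - 1}"
    using assms by (auto simp: cyc_iff split: if_splits)
  then show ?thesis using assms by (auto simp: card_insert_if)
qed

lemma cyc_parity:
  assumes "t < m" "2 \<le> m" "even m" "s \<in> cyc m t"
  shows "even s \<longleftrightarrow> odd t"
  using assms by (auto simp: cyc_iff)

definition cdist :: "nat \<Rightarrow> nat \<Rightarrow> nat" where "cdist m t = min t (m - t)"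

text \<open>An odd cycle has an edge with both ends equally far from 0; \<open>m\<close> even
  excludes this and makes \<open>m div 2\<close> the only farthest point.\<close>

lemma cdist_cyc:
  assumes "t < m" "2 \<le> m" "even m" "s \<in> cyc m t"
  shows "cdist m s = Suc (cdist m t) \<or> cdist m t = Suc (cdist m s)"
proof -
  obtain k where "m = 2 * k" using assms by auto
  then show ?thesis using assms by (auto simp: cyc_iff cdist_def min_def; presburger)
qed

lemma cdist_down:
  assumes "t < m" "2 \<le> m" "even m" "t \<noteq> 0"
  shows "\<exists>s\<in>cyc m t. cdist m s < cdist m t"
proof (cases "t \<le> m div 2")
  case True
  then show ?thesis using assms by (intro bexI[of _ "t - 1"]) (auto simp: cyc_iff cdist_def min_def)
next
  case False
  then show ?thesis using assms
    by (intro bexI[of _ "if t + 1 = m then 0 else t + 1"]) (auto simp: cyc_iff cdist_def min_def)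
qed

lemma cdist_up:
  assumes "t < m" "2 \<le> m" "even m" "t \<noteq> m div 2"
  shows "\<exists>s\<in>cyc m t. cdist m t < cdist m s"
proof (cases "t < m div 2")
  case True
  then show ?thesis using assms by (intro bexI[of _ "t + 1"]) (auto simp: cyc_iff cdist_def min_def)
next
  case False
  then show ?thesis using assms by (intro bexI[of _ "t - 1"]) (auto simp: cyc_iff cdist_def min_def)
qed

lemma torus_verts_upd: "x \<in> torus_verts m d \<Longrightarrow> i < d \<Longrightarrow> s < m \<Longrightarrow> x(i := s) \<in> torus_verts m d"
  by (auto simp: torus_verts_def PiE_iff extensional_def)

lemma torus_verts_less: "x \<in> torus_verts m d \<Longrightarrow> i < d \<Longrightarrow> x i < m"
  by (auto simp: torus_verts_def PiE_iff)

lemma finite_torus_verts: "finite (torus_verts m d)"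
  by (auto simp: torus_verts_def intro!: finite_PiE)

lemma card_torus_verts: "card (torus_verts m d) = m ^ d"
  by (simp add: torus_verts_def card_PiE)

lemma torus_verts_eqI: "x \<in> torus_verts m d \<Longrightarrow> y \<in> torus_verts m d \<Longrightarrow> (\<And>i. i < d \<Longrightarrow> x i = y i) \<Longrightarrow> x = y"
  unfolding torus_verts_def by (rule PiE_ext) auto

lemma torus_adj_sym: "torus_adj m d x y \<Longrightarrow> torus_adj m d y x"
  unfolding torus_adj_def by metis

lemma nbhd_torus:
  assumes x: "x \<in> torus_verts m d"
  shows "nbhd (torus m d) x = (\<Union>i<d. (\<lambda>s. x(i := s)) ` cyc m (x i))"
proof -
  have "nbhd (torus m d) x = {y \<in> torus_verts m d. torus_adj m d x y}"
    using x torus_adj_sym by (auto simp: nbhd_def torus_def doubleton_eq_iff)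
  also have "\<dots> = (\<Union>i<d. (\<lambda>s. x(i := s)) ` cyc m (x i))"
  proof (intro equalityI subsetI)
    fix y assume y: "y \<in> {y \<in> torus_verts m d. torus_adj m d x y}"
    then obtain i where i: "i < d" "[x i + 1 = y i] (mod m) \<or> [y i + 1 = x i] (mod m)"
      "\<And>j. j < d \<Longrightarrow> j \<noteq> i \<Longrightarrow> x j = y j" by (auto simp: torus_adj_def)
    have "y i < m" using y i torus_verts_less by auto
    then have "y i \<in> cyc m (x i)" using i by (auto simp: cyc_def)
    moreover have "y = x(i := y i)"
      using y i x \<open>y i < m\<close> by (intro torus_verts_eqI[of _ m d] torus_verts_upd) auto
    ultimately show "y \<in> (\<Union>i<d. (\<lambda>s. x(i := s)) ` cyc m (x i))" using i by blast
  next
    fix y assume "y \<in> (\<Union>i<d. (\<lambda>s. x(i := s)) ` cyc m (x i))"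
    then obtain i s where ii: "i < d" "s \<in> cyc m (x i)" "y = x(i := s)" by blast
    then show "y \<in> {y \<in> torus_verts m d. torus_adj m d x y}"
      using x torus_verts_upd[OF x, of i s] by (auto simp: torus_adj_def cyc_def intro!: exI[of _ i])
  qed
  finally show ?thesis .
qed

definition torus_rank :: "nat \<Rightarrow> nat \<Rightarrow> (nat \<Rightarrow> nat) \<Rightarrow> nat" where
  "torus_rank m d x = (\<Sum>i<d. cdist m (x i))"

lemma sum_upd:
  fixes F x :: "nat \<Rightarrow> nat" and i d :: nat
  assumes "i < d"
  shows "(\<Sum>j<d. F ((x(i := s)) j)) + F (x i) = (\<Sum>j<d. F (x j)) + F s"
proof -
  have "(\<Sum>j<d. F ((x(i := s)) j)) = F s + (\<Sum>j\<in>{..<d} - {i}. F ((x(i := s)) j))"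
    using assms by (subst sum.remove[of _ i]) auto
  also have "(\<Sum>j\<in>{..<d} - {i}. F ((x(i := s)) j)) = (\<Sum>j\<in>{..<d} - {i}. F (x j))"
    by (intro sum.cong) auto
  finally show ?thesis using sum.remove[of "{..<d}" i "\<lambda>j. F (x j)"] assms by simp
qed

section \<open>Degrees, ranks and expansion of the torus\<close>

context
  fixes m d :: nat
  assumes m: "2 \<le> m" "even m"
begin

lemma torus_nbhd_in:
  assumes "x \<in> torus_verts m d" "y \<in> nbhd (torus m d) x"
  shows "y \<in> torus_verts m d" "x \<in> nbhd (torus m d) y"
proof -
  obtain i s where ii: "i < d" "s \<in> cyc m (x i)" "y = x(i := s)"
    using assms by (auto simp: nbhd_torus)
  then show y: "y \<in> torus_verts m d" using assms torus_verts_upd by (auto simp: cyc_def)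
  show "x \<in> nbhd (torus m d) y"
    using assms by (auto simp: nbhd_def insert_commute)
qed

lemma torus_rank_nbhd:
  assumes x: "x \<in> torus_verts m d" and y: "y \<in> nbhd (torus m d) x"
  shows "torus_rank m d y = Suc (torus_rank m d x) \<or> torus_rank m d x = Suc (torus_rank m d y)"
proof -
  obtain i s where ii: "i < d" "s \<in> cyc m (x i)" "y = x(i := s)"
    using assms by (auto simp: nbhd_torus)
  have "cdist m s = Suc (cdist m (x i)) \<or> cdist m (x i) = Suc (cdist m s)"
    by (rule cdist_cyc[OF torus_verts_less[OF x ii(1)] m ii(2)])
  moreover have "torus_rank m d y + cdist m (x i) = torus_rank m d x + cdist m s"
    using sum_upd[OF ii(1), of "cdist m" x s] unfolding torus_rank_def ii(3) .
  ultimately show ?thesis by auto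
qed

lemma torus_parity_nbhd:
  assumes x: "x \<in> torus_verts m d" and y: "y \<in> nbhd (torus m d) x"
  shows "even (\<Sum>i<d. y i) \<longleftrightarrow> odd (\<Sum>i<d. x i)"
proof -
  obtain i s where ii: "i < d" "s \<in> cyc m (x i)" "y = x(i := s)"
    using assms by (auto simp: nbhd_torus)
  have "even s \<longleftrightarrow> odd (x i)"
    by (rule cyc_parity[OF torus_verts_less[OF x ii(1)] m ii(2)])
  moreover have "(\<Sum>i<d. y i) + x i = (\<Sum>i<d. x i) + s"
    using sum_upd[OF ii(1), of "\<lambda>t. t" x s] unfolding ii(3) .
  ultimately show ?thesis by (metis even_add)
qed

lemma card_torus_nbhd:
  assumes x: "x \<in> torus_verts m d"
  shows "card (nbhd (torus m d) x) = (if m = 2 then d else 2 * d)"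
proof -
  have less: "x i < m" if "i < d" for i using torus_verts_less[OF x that] .
  have self: "x i \<notin> cyc m (x i)" if "i < d" for i
    using less[OF that] m(1) by (auto simp: cyc_iff)
  have fin: "finite (cyc m t)" for t by (auto simp: cyc_def)
  have "card (nbhd (torus m d) x) = (\<Sum>i<d. card ((\<lambda>s. x(i := s)) ` cyc m (x i)))"
    unfolding nbhd_torus[OF x]
  proof (rule card_UN_disjoint)
    show "\<forall>i\<in>{..<d}. \<forall>j\<in>{..<d}. i \<noteq> j \<longrightarrow> (\<lambda>s. x(i := s)) ` cyc m (x i) \<inter> (\<lambda>s. x(j := s)) ` cyc m (x j) = {}"
    proof (intro ballI impI)
      fix i j assume ij: "i \<in> {..<d}" "j \<in> {..<d}" "i \<noteq> j"
      have "x(i := s) \<noteq> x(j := t)" if "s \<in> cyc m (x i)" for s t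
      proof
        assume "x(i := s) = x(j := t)"
        then have "(x(i := s)) i = (x(j := t)) i" by simp
        then show False using ij that self[of i] by auto
      qed
      then show "(\<lambda>s. x(i := s)) ` cyc m (x i) \<inter> (\<lambda>s. x(j := s)) ` cyc m (x j) = {}" by blast
    qed
  qed (use fin in auto)
  also have "\<dots> = (\<Sum>i<d. if m = 2 then 1 else 2)"
  proof (rule sum.cong)
    fix i assume "i \<in> {..<d}"
    have "inj_on (\<lambda>s. x(i := s)) (cyc m (x i))" by (rule inj_onI) (metis fun_upd_same)
    then show "card ((\<lambda>s. x(i := s)) ` cyc m (x i)) = (if m = 2 then 1 else 2)"
      using card_cyc[of "x i" m] less[of i] m \<open>i \<in> {..<d}\<close> by (simp add: card_image)
  qed simp
  finally show ?thesis by simp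
qed

text \<open>Each coordinate of \<open>I\<close> supplies a neighbour, and neighbours obtained by
  changing different coordinates differ.\<close>

lemma card_nbhd_ge:
  assumes x: "x \<in> torus_verts m d" and I: "I \<subseteq> {..<d}"
    and ex: "\<And>i. i \<in> I \<Longrightarrow> \<exists>s\<in>cyc m (x i). P (x(i := s))"
  shows "card I \<le> card {y \<in> nbhd (torus m d) x. P y}"
proof -
  obtain s where s: "\<And>i. i \<in> I \<Longrightarrow> s i \<in> cyc m (x i) \<and> P (x(i := s i))" using ex by metis
  have self: "s i \<noteq> x i" if "i \<in> I" for i
  proof
    assume "s i = x i"
    moreover have "x i < m" using torus_verts_less[OF x, of i] I that by auto
    ultimately show False using s[OF that] m(1) by (auto simp: cyc_iff)
  qed
  have inj: "inj_on (\<lambda>i. x(i := s i)) I"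
  proof (rule inj_onI)
    fix i j assume ij: "i \<in> I" "j \<in> I" "x(i := s i) = x(j := s j)"
    then have "(x(i := s i)) i = (x(j := s j)) i" by simp
    then show "i = j" using self[OF ij(1)] by (auto split: if_splits)
  qed
  have sub: "(\<lambda>i. x(i := s i)) ` I \<subseteq> {y \<in> nbhd (torus m d) x. P y}"
    using s I by (auto simp: nbhd_torus[OF x])
  have "finite (nbhd (torus m d) x)"
    using finite_torus_verts[of m d] torus_nbhd_in[OF x] by (meson finite_subset subsetI)
  then have "card ((\<lambda>i. x(i := s i)) ` I) \<le> card {y \<in> nbhd (torus m d) x. P y}"
    using sub by (intro card_mono) auto
  then show ?thesis using card_image[OF inj] by simp
qed

lemma card_nbhd_down:
  assumes x: "x \<in> torus_verts m d"
  shows "card {i. i < d \<and> x i \<noteq> 0} \<le> card {y \<in> nbhd (torus m d) x. torus_rank m d y < torus_rank m d x}"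
proof (rule card_nbhd_ge[OF x])
  fix i assume i: "i \<in> {i. i < d \<and> x i \<noteq> 0}"
  then obtain s where s: "s \<in> cyc m (x i)" "cdist m s < cdist m (x i)"
    using cdist_down[of "x i" m] torus_verts_less[OF x, of i] m by auto
  moreover have "torus_rank m d (x(i := s)) + cdist m (x i) = torus_rank m d x + cdist m s"
    using sum_upd[of i d "cdist m" x s] i unfolding torus_rank_def by blast
  ultimately have "torus_rank m d (x(i := s)) < torus_rank m d x" by linarith
  then show "\<exists>s\<in>cyc m (x i). torus_rank m d (x(i := s)) < torus_rank m d x" using s(1) by blast
qed auto

lemma card_nbhd_up:
  assumes x: "x \<in> torus_verts m d"
  shows "card {i. i < d \<and> x i \<noteq> m div 2} \<le> card {y \<in> nbhd (torus m d) x. torus_rank m d x < torus_rank m d y}"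
proof (rule card_nbhd_ge[OF x])
  fix i assume i: "i \<in> {i. i < d \<and> x i \<noteq> m div 2}"
  then obtain s where s: "s \<in> cyc m (x i)" "cdist m (x i) < cdist m s"
    using cdist_up[of "x i" m] torus_verts_less[OF x, of i] m by auto
  moreover have "torus_rank m d (x(i := s)) + cdist m (x i) = torus_rank m d x + cdist m s"
    using sum_upd[of i d "cdist m" x s] i unfolding torus_rank_def by blast
  ultimately have "torus_rank m d x < torus_rank m d (x(i := s))" by linarith
  then show "\<exists>s\<in>cyc m (x i). torus_rank m d x < torus_rank m d (x(i := s))" using s(1) by blast
qed auto

lemma card_coord_nbhd:
  assumes x: "x \<in> torus_verts m d" and y: "y \<in> nbhd (torus m d) x"
  shows "card {i. i < d \<and> x i \<noteq> c} \<le> Suc (card {i. i < d \<and> y i \<noteq> c})"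
proof -
  obtain i s where ii: "i < d" "s \<in> cyc m (x i)" "y = x(i := s)"
    using assms by (auto simp: nbhd_torus)
  have "{i. i < d \<and> x i \<noteq> c} \<subseteq> insert i {i. i < d \<and> y i \<noteq> c}" using ii by auto
  then have "card {i. i < d \<and> x i \<noteq> c} \<le> card (insert i {i. i < d \<and> y i \<noteq> c})"
    by (intro card_mono) auto
  also have "\<dots> \<le> Suc (card {i. i < d \<and> y i \<noteq> c})" by (rule card_insert_le_m1) auto
  finally show ?thesis .
qed

text \<open>Chernoff bound with the tilt \<open>1/4\<close> per coordinate different from \<open>c\<close>.\<close>

lemma card_few_coords:
  assumes c: "c < m"
  shows "real (card {x \<in> torus_verts m d. real (card {i. i < d \<and> x i \<noteq> c}) < d / 4}) \<le> (9 / 10 * real m) ^ d"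
proof -
  define S where "S = {x \<in> torus_verts m d. real (card {i. i < d \<and> x i \<noteq> c}) < d / 4}"
  have "(\<Sum>x\<in>torus_verts m d. \<Prod>i<d. if x i = c then 1 else 1/4) = (\<Prod>i<d. \<Sum>s<m. if s = c then 1 else 1/4 :: real)"
    unfolding torus_verts_def by (subst prod_sum_PiE) auto
  also have "(\<Sum>s<m. if s = c then 1 else 1/4 :: real) = (m + 3) / 4"
  proof -
    have "(\<Sum>s<m. if s = c then 1 else 1/4 :: real) = 1 + (\<Sum>s\<in>{..<m} - {c}. 1/4)"
      using c by (subst sum.remove[of _ c]) (auto intro!: sum.cong)
    also have "\<dots> = (m + 3) / 4" using c m by (simp add: field_simps of_nat_diff)
    finally show ?thesis .
  qed
  finally have tot: "(\<Sum>x\<in>torus_verts m d. \<Prod>i<d. if x i = c then 1 else 1/4) = ((m + 3) / 4 :: real) ^ d"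
    by simp
  have r: "(1/4 :: real) powr (d / 4) = (1 / sqrt 2) ^ d"
  proof -
    have "(1/4 :: real) powr (d / 4) = ((1/4) powr (1/4)) powr d" by (simp add: powr_powr)
    also have "(1/4 :: real) powr (1/4) = 1 / sqrt 2"
    proof -
      have e: "(1 / sqrt 2) powr 4 = 1/4"
        by (simp add: powr_numeral power_divide) (simp add: power4_eq_xxxx)
      have "(1/4 :: real) powr (1/4) = ((1 / sqrt 2) powr 4) powr (1/4)" unfolding e ..
      also have "\<dots> = 1 / sqrt 2" by (subst powr_powr) simp
      finally show ?thesis .
    qed
    also have "(1 / sqrt 2) powr d = (1 / sqrt 2) ^ d" by (simp add: powr_realpow)
    finally show ?thesis .
  qed
  have "(1 / sqrt 2) ^ d * card S = (\<Sum>x\<in>S. (1/4 :: real) powr (d / 4))" by (simp add: r)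
  also have "\<dots> \<le> (\<Sum>x\<in>S. \<Prod>i<d. if x i = c then 1 else 1/4)"
  proof (rule sum_mono)
    fix x assume x: "x \<in> S"
    have "(\<Prod>i<d. if x i = c then 1 else 1/4 :: real) = (\<Prod>i\<in>{i. i < d \<and> x i \<noteq> c}. 1/4)"
      by (intro prod.mono_neutral_cong_right) auto
    also have "\<dots> = (1/4) ^ card {i. i < d \<and> x i \<noteq> c}" by (rule prod_constant)
    also have "\<dots> = (1/4) powr card {i. i < d \<and> x i \<noteq> c}" by (simp add: powr_realpow)
    finally show "(1/4 :: real) powr (d / 4) \<le> (\<Prod>i<d. if x i = c then 1 else 1/4)"
      using x by (simp add: S_def powr_mono')
  qed
  also have "\<dots> \<le> (\<Sum>x\<in>torus_verts m d. \<Prod>i<d. if x i = c then 1 else 1/4)"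
    using finite_torus_verts by (intro sum_mono2) (auto simp: S_def intro!: prod_nonneg)
  also note tot
  finally have "(1 / sqrt 2) ^ d * card S \<le> ((m + 3) / 4 :: real) ^ d" .
  then have "sqrt 2 ^ d * ((1 / sqrt 2) ^ d * card S) \<le> sqrt 2 ^ d * ((m + 3) / 4 :: real) ^ d"
    by (rule mult_left_mono) simp
  also have "sqrt 2 ^ d * ((1 / sqrt 2) ^ d * card S) = card S"
    by (simp add: power_one_over)
  finally have "real (card S) \<le> (sqrt 2 * ((m + 3) / 4)) ^ d"
    by (simp only: power_mult_distrib)
  also have "\<dots> \<le> (9 / 10 * real m) ^ d"
  proof (rule power_mono)
    \<comment> \<open>The constant \<open>9 / 10\<close> is dictated by \<open>m = 2\<close>, where
      \<open>sqrt 2 * 5 / 4\<close> is about 1.768, just below 1.8.\<close>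
    have "sqrt 2 \<le> 1415 / 1000" by (rule real_le_lsqrt) (simp_all add: power2_eq_square)
    then have "sqrt 2 * ((m + 3) / 4) \<le> 1415 / 1000 * ((m + 3) / 4 :: real)"
      by (intro mult_right_mono) auto
    also have "\<dots> \<le> 9 / 10 * real m" using m by (simp add: field_simps)
    finally show "sqrt 2 * ((m + 3) / 4) \<le> 9 / 10 * real m" .
  qed simp
  finally show ?thesis by (simp add: S_def)
qed

lemma line_constant:
  assumes x: "x \<in> torus_verts m d" and i: "i < d"
    and step: "\<And>t. t < m \<Longrightarrow> Suc t < m \<Longrightarrow> G (x(i := t)) = G (x(i := Suc t))"
  shows "t < m \<Longrightarrow> G (x(i := t)) = G (x(i := 0))"
proof (induction t)
  case (Suc t)
  then show ?case using step[of t] by (metis Suc_lessD)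
qed simp

text \<open>
  Join \<open>x\<close> to \<open>y\<close> by changing one coordinate at a time. The swap
  \<open>(x, y) \<mapsto> (h i x y, h i y x)\<close> is an involution, so at most \<open>m ^ d\<close> pairs use a given vertex
  at step \<open>i\<close>.
\<close>

lemma torus_isoperimetry:
  fixes G :: "(nat \<Rightarrow> nat) \<Rightarrow> 'b"
  assumes C: "\<And>x y. x \<in> torus_verts m d \<Longrightarrow> y \<in> nbhd (torus m d) x \<Longrightarrow> G x \<noteq> G y \<Longrightarrow> x \<in> C"
    and CV: "C \<subseteq> torus_verts m d"
  shows "\<exists>A. card {x \<in> torus_verts m d. G x \<noteq> A} \<le> d * m * card C"
proof -
  define V where "V = torus_verts m d"
  have finV: "finite V" by (simp add: V_def finite_torus_verts)
  have finC: "finite C" using CV finV finite_subset by (auto simp: V_def)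
  have cardV: "card V = m ^ d" by (simp add: V_def card_torus_verts)
  define h where "h i x y = (\<lambda>j. if j < i then y j else x j)" for i and x y :: "nat \<Rightarrow> nat"
  have hV: "h i x y \<in> V" if "x \<in> V" "y \<in> V" for i x y
    using that by (auto simp: V_def torus_verts_def h_def PiE_iff extensional_def)
  define S where "S i = {z \<in> V. \<exists>s<m. G z \<noteq> G (z(i := s))}" for i
  have cardS: "card (S i) \<le> m * card C" if i: "i < d" for i
  proof -
    \<comment> \<open>On a line in direction \<open>i\<close> where \<open>G\<close> is not
      constant, two consecutive points differ in \<open>G\<close>, and the first of them lies in
      \<open>C\<close>. The vertex \<open>z\<close> is recovered from that point and the coordinate
      \<open>z i\<close>.\<close>
    have "S i \<subseteq> (\<lambda>(z, s). z(i := s)) ` (C \<times> {..<m})"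
    proof
      fix z assume "z \<in> S i"
      then obtain s where z: "z \<in> V" "s < m" "G z \<noteq> G (z(i := s))" by (auto simp: S_def)
      have zi: "z i < m" using z i torus_verts_less by (auto simp: V_def)
      have "\<exists>t. t < m \<and> Suc t < m \<and> G (z(i := t)) \<noteq> G (z(i := Suc t))"
      proof (rule ccontr)
        assume "\<not> ?thesis"
        then have "G (z(i := t)) = G (z(i := 0))" if "t < m" for t
          using line_constant[of z i G t] z i that by (auto simp: V_def)
        from this[of s] this[of "z i"] show False using z zi by simp
      qed
      then obtain t where t: "t < m" "Suc t < m" "G (z(i := t)) \<noteq> G (z(i := Suc t))" by blast
      have tV: "z(i := t) \<in> torus_verts m d" using z t i torus_verts_upd by (auto simp: V_def)
      have "Suc t \<in> cyc m t" using t by (simp add: cyc_def)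
      then have "(z(i := t))(i := Suc t) \<in> nbhd (torus m d) (z(i := t))"
        unfolding nbhd_torus[OF tV] using i by (intro UN_I[of i] imageI) auto
      then have "z(i := t) \<in> C" using C[OF tV] t by simp
      then have "(z(i := t), z i) \<in> C \<times> {..<m}" using zi by simp
      then show "z \<in> (\<lambda>(z, s). z(i := s)) ` (C \<times> {..<m})"
        by (rule rev_image_eqI) simp
    qed
    then have "card (S i) \<le> card ((\<lambda>(z, s). z(i := s)) ` (C \<times> {..<m}))"
      using finC by (intro card_mono) auto
    also have "\<dots> \<le> card (C \<times> {..<m})" using finC by (intro card_image_le) auto
    also have "\<dots> = m * card C" by (simp add: card_cartesian_product)
    finally show ?thesis .
  qed
  define P where "P i = {p \<in> V \<times> V. G (h i (fst p) (snd p)) \<noteq> G (h (Suc i) (fst p) (snd p))}" for i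
  have cardP: "card (P i) \<le> m ^ d * (m * card C)" if i: "i < d" for i
  proof -
    define sw where "sw p = (h i (fst p) (snd p), h i (snd p) (fst p))" for p
    have inv: "sw (sw p) = p" for p by (simp add: sw_def h_def prod_eq_iff fun_eq_iff)
    have "inj_on sw (P i)" using inv by (metis inj_onI)
    moreover have "sw ` P i \<subseteq> S i \<times> V"
    proof
      fix q assume "q \<in> sw ` P i"
      then obtain x y where xy: "x \<in> V" "y \<in> V" "q = sw (x, y)" "G (h i x y) \<noteq> G (h (Suc i) x y)"
        by (auto simp: P_def)
      have "h (Suc i) x y = (h i x y)(i := y i)" by (auto simp: h_def fun_eq_iff)
      moreover have "y i < m" using xy i torus_verts_less by (auto simp: V_def)
      ultimately have "h i x y \<in> S i" using xy hV[of x y i] by (auto simp: S_def)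
      then show "q \<in> S i \<times> V" using xy hV by (auto simp: sw_def)
    qed
    moreover have "finite (S i \<times> V)" using finV by (auto simp: S_def)
    ultimately have "card (P i) \<le> card (S i \<times> V)" using card_inj_on_le by blast
    also have "\<dots> = m ^ d * card (S i)" by (simp add: card_cartesian_product cardV)
    also have "\<dots> \<le> m ^ d * (m * card C)" using cardS[OF i] by simp
    finally show ?thesis .
  qed
  have "Sigma V (\<lambda>x. {y \<in> V. G y \<noteq> G x}) \<subseteq> (\<Union>i<d. P i)"
  proof
    fix p assume "p \<in> Sigma V (\<lambda>x. {y \<in> V. G y \<noteq> G x})"
    then obtain x y where xy: "p = (x, y)" "x \<in> V" "y \<in> V" "G y \<noteq> G x" by auto
    have h0: "h 0 x y = x" by (simp add: h_def)
    have hd: "h d x y = y"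
      using xy hV by (intro torus_verts_eqI[of _ m d]) (auto simp: V_def h_def)
    have "\<exists>i<d. G (h i x y) \<noteq> G (h (Suc i) x y)"
    proof (rule ccontr)
      assume "\<not> ?thesis"
      then have *: "G (h i x y) = G (h (Suc i) x y)" if "i < d" for i using that by blast
      have "G (h i x y) = G (h 0 x y)" if "i \<le> d" for i
        using that by (induction i) (use * in auto)
      from this[of d] show False using h0 hd xy by simp
    qed
    then show "p \<in> (\<Union>i<d. P i)" using xy by (auto simp: P_def)
  qed
  moreover have "finite (P i)" for i using finV by (auto simp: P_def)
  ultimately have "card (Sigma V (\<lambda>x. {y \<in> V. G y \<noteq> G x})) \<le> card (\<Union>i<d. P i)"
    by (intro card_mono) auto
  also have "\<dots> \<le> (\<Sum>i<d. card (P i))" by (rule card_UN_le) simp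
  also have "\<dots> \<le> (\<Sum>i<d. m ^ d * (m * card C))" using cardP by (intro sum_mono) auto
  finally have le: "(\<Sum>x\<in>V. card {y \<in> V. G y \<noteq> G x}) \<le> card V * (d * m * card C)"
    using finV by (subst (asm) card_SigmaI) (auto simp: cardV mult_ac)
  \<comment> \<open>Averaging: some \<open>x\<close> disagrees with no more vertices than the mean,
    and its value serves as \<open>A\<close>.\<close>
  have "\<exists>x\<in>V. card {y \<in> V. G y \<noteq> G x} \<le> d * m * card C"
  proof (rule ccontr)
    assume "\<not> ?thesis"
    then have "\<And>x. x \<in> V \<Longrightarrow> d * m * card C < card {y \<in> V. G y \<noteq> G x}" by force
    moreover have "V \<noteq> {}" using cardV m by auto
    ultimately have "(\<Sum>x\<in>V. d * m * card C) < (\<Sum>x\<in>V. card {y \<in> V. G y \<noteq> G x})"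
      using finV by (intro sum_strict_mono) auto
    then show False using le by simp
  qed
  then show ?thesis by (auto simp: V_def)
qed

end

section \<open>Optimal pairs and the partition function\<close>

abbreviation edge_rel :: "'h ugraph \<Rightarrow> 'h \<Rightarrow> 'h \<Rightarrow> bool" where
  "edge_rel H \<equiv> (\<lambda>a b. {a, b} \<in> edges H)"

abbreviation CNbrs :: "'h ugraph \<Rightarrow> 'h set \<Rightarrow> 'h set" where
  "CNbrs H \<equiv> common_nbrs (verts H) (edge_rel H)"

context
  fixes H :: "'h ugraph" and lam :: "'h \<Rightarrow> real"
  assumes H: "finite_loop_graph H" and lam: "\<And>i. i \<in> verts H \<Longrightarrow> 0 < lam i"
begin

lemma finite_verts: "finite (verts H)"
  using H by (simp add: finite_loop_graph_def)

lemma finite_eta_set: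
  "finite {sum lam A * sum lam B | A B. A \<subseteq> verts H \<and> B \<subseteq> verts H \<and> fully_adjacent H A B}"
proof (rule finite_subset)
  show "{sum lam A * sum lam B | A B. A \<subseteq> verts H \<and> B \<subseteq> verts H \<and> fully_adjacent H A B}
    \<subseteq> (\<lambda>(A, B). sum lam A * sum lam B) ` (Pow (verts H) \<times> Pow (verts H))" by auto
qed (use finite_verts in auto)

lemma eta_ge:
  "A \<subseteq> verts H \<Longrightarrow> B \<subseteq> verts H \<Longrightarrow> fully_adjacent H A B \<Longrightarrow> sum lam A * sum lam B \<le> eta lam H"
  unfolding eta_def by (rule Max_ge[OF finite_eta_set]) auto

lemma eta_attained:
  obtains A B where "A \<subseteq> verts H" "B \<subseteq> verts H" "fully_adjacent H A B" "sum lam A * sum lam B = eta lam H"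
proof -
  have "sum lam {} * sum lam {} \<in> {sum lam A * sum lam B | A B. A \<subseteq> verts H \<and> B \<subseteq> verts H \<and> fully_adjacent H A B}"
    by (auto simp: fully_adjacent_def intro!: exI[of _ "{}"])
  then have "eta lam H \<in> {sum lam A * sum lam B | A B. A \<subseteq> verts H \<and> B \<subseteq> verts H \<and> fully_adjacent H A B}"
    unfolding eta_def by (intro Max_in[OF finite_eta_set]) blast
  then show ?thesis using that by auto
qed

lemma fully_adjacent_CNbrs: "fully_adjacent H A (CNbrs H A)"
  by (auto simp: fully_adjacent_def common_nbrs_def)

lemma CNbrs_subset: "CNbrs H A \<subseteq> verts H"
  by (auto simp: common_nbrs_def)

lemma CNbrs_le_eta: "A \<subseteq> verts H \<Longrightarrow> sum lam A * sum lam (CNbrs H A) \<le> eta lam H"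
  using eta_ge CNbrs_subset fully_adjacent_CNbrs by blast

lemma edge_verts: "{a, b} \<in> edges H \<Longrightarrow> a \<in> verts H \<and> b \<in> verts H"
  using H by (fastforce simp: finite_loop_graph_def doubleton_eq_iff)

lemma weight_pos: "A \<subseteq> verts H \<Longrightarrow> A \<noteq> {} \<Longrightarrow> 0 < sum lam A"
  using finite_verts finite_subset lam by (intro sum_pos) blast+

lemma eta_pos:
  assumes "edges H \<noteq> {}"
  shows "0 < eta lam H"
proof -
  obtain e where "e \<in> edges H" using assms by blast
  then obtain a b where ab: "{a, b} \<in> edges H"
    using H by (auto simp: finite_loop_graph_def)
  have v: "a \<in> verts H" "b \<in> verts H" using edge_verts[OF ab] by auto
  have "0 < sum lam {a} * sum lam {b}" using v lam by simp
  also have "\<dots> \<le> eta lam H"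
    using v ab by (intro eta_ge) (auto simp: fully_adjacent_def)
  finally show ?thesis .
qed

lemma min_weight_ratio_exists:
  assumes "verts H \<noteq> {}"
  shows "\<exists>kap. 0 < kap \<and> kap \<le> 1 \<and> (\<forall>a\<in>verts H. kap * sum lam (verts H) \<le> lam a)"
proof -
  define s where "s = sum lam (verts H)"
  define mn where "mn = Min (lam ` verts H)"
  have s: "0 < s" unfolding s_def using assms by (intro weight_pos) auto
  have mn: "mn \<in> lam ` verts H" "\<And>a. a \<in> verts H \<Longrightarrow> mn \<le> lam a"
    unfolding mn_def using finite_verts assms by auto
  then have "0 < mn" using lam by auto
  obtain a where a: "a \<in> verts H" using assms by auto
  have "lam a \<le> s"
    unfolding s_def using finite_verts a lam by (intro member_le_sum) (auto simp: less_imp_le)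
  then have "mn \<le> s" using mn(2)[OF a] by simp
  have "0 < mn / s \<and> mn / s \<le> 1 \<and> (\<forall>a\<in>verts H. mn / s * s \<le> lam a)"
    using s \<open>0 < mn\<close> \<open>mn \<le> s\<close> mn(2) by simp
  then show ?thesis unfolding s_def by blast
qed

text \<open>There are finitely many sets of colours, so the logarithmic gaps of the suboptimal ones
  have a positive minimum. Inserting \<open>c\<close> caps it and keeps the minimum defined when
  there are none.\<close>

lemma eta_gap_exists:
  assumes c: "0 < c" and ne: "edges H \<noteq> {}"
  shows "\<exists>g. 0 < g \<and> g \<le> c \<and> (\<forall>A\<subseteq>verts H. A \<noteq> {} \<longrightarrow> CNbrs H A \<noteq> {} \<longrightarrow>
     sum lam A * sum lam (CNbrs H A) \<noteq> eta lam H \<longrightarrow>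
     ln (sum lam A) + ln (sum lam (CNbrs H A)) \<le> ln (eta lam H) - g)"
proof -
  define F where "F A = ln (eta lam H) - (ln (sum lam A) + ln (sum lam (CNbrs H A)))" for A
  define \<A> where "\<A> = {A. A \<subseteq> verts H \<and> A \<noteq> {} \<and> CNbrs H A \<noteq> {} \<and> sum lam A * sum lam (CNbrs H A) \<noteq> eta lam H}"
  have fin: "finite \<A>" using finite_verts by (auto simp: \<A>_def intro: finite_subset[of _ "Pow (verts H)"])
  have F: "0 < F A" if "A \<in> \<A>" for A
  proof -
    have A: "A \<subseteq> verts H" "A \<noteq> {}" "CNbrs H A \<noteq> {}" "sum lam A * sum lam (CNbrs H A) \<noteq> eta lam H"
      using that by (auto simp: \<A>_def)
    have pos: "0 < sum lam A" "0 < sum lam (CNbrs H A)"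
      using A CNbrs_subset by (auto intro!: weight_pos)
    have "sum lam A * sum lam (CNbrs H A) < eta lam H"
      using CNbrs_le_eta[OF A(1)] A(4) by simp
    then have "ln (sum lam A * sum lam (CNbrs H A)) < ln (eta lam H)"
      using pos eta_pos[OF ne] by (subst ln_less_cancel_iff) auto
    then show ?thesis using pos by (simp add: F_def ln_mult_pos)
  qed
  define g where "g = Min (insert c (F ` \<A>))"
  have "g \<in> insert c (F ` \<A>)" unfolding g_def using fin by (intro Min_in) auto
  then have "0 < g" using c F by auto
  moreover have "g \<le> c" unfolding g_def using fin by simp
  moreover have "ln (sum lam A) + ln (sum lam (CNbrs H A)) \<le> ln (eta lam H) - g"
    if "A \<subseteq> verts H" "A \<noteq> {}" "CNbrs H A \<noteq> {}" "sum lam A * sum lam (CNbrs H A) \<noteq> eta lam H" for A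
  proof -
    have "A \<in> \<A>" using that by (simp add: \<A>_def)
    then have "g \<le> F A" unfolding g_def using fin by simp
    then show ?thesis by (simp add: F_def)
  qed
  ultimately show ?thesis by blast
qed

end

section \<open>The torus as a ranked bipartite graph, and a lower bound for its partition
  function\<close>

context
  fixes m d :: nat
  assumes m: "2 \<le> m" "even m"
begin

lemma classes: "even_class m d \<union> odd_class m d = torus_verts m d" "even_class m d \<inter> odd_class m d = {}"
  by (auto simp: even_class_def odd_class_def)

lemma ranked_bipartite_torus:
  fixes K :: "'h set"
  assumes "0 < d" "finite K" "\<And>a. a \<in> K \<Longrightarrow> 0 < lam a"
    and rho: "\<And>x y. x \<in> torus_verts m d \<Longrightarrow> y \<in> nbhd (torus m d) x \<Longrightarrow>
       rho y = Suc (rho x) \<or> rho x = Suc (rho y)"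
  shows "ranked_bipartite (even_class m d) (odd_class m d) (nbhd (torus m d)) rho (if m = 2 then d else 2 * d) K lam"
proof
  show "finite (even_class m d)" "finite (odd_class m d)"
    by (auto simp: even_class_def odd_class_def finite_torus_verts)
  show "nbhd (torus m d) v \<subseteq> even_class m d" if "v \<in> odd_class m d" for v
    using that torus_nbhd_in[OF m, of v d] torus_parity_nbhd[OF m, of v d]
    by (auto simp: even_class_def odd_class_def)
  show "nbhd (torus m d) v \<subseteq> odd_class m d" if "v \<in> even_class m d" for v
    using that torus_nbhd_in[OF m, of v d] torus_parity_nbhd[OF m, of v d]
    by (auto simp: even_class_def odd_class_def)
qed (use assms classes torus_nbhd_in(2)[OF m] card_torus_nbhd[OF m] in \<open>auto\<close>)

lemma torus_rank_le: "x \<in> torus_verts m d \<Longrightarrow> torus_rank m d x \<le> m * d"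
proof -
  assume "x \<in> torus_verts m d"
  then have "torus_rank m d x \<le> (\<Sum>i<d. m)"
    unfolding torus_rank_def
    by (intro sum_mono) (use torus_verts_less[of x m d] in \<open>force simp: cdist_def min_def\<close>)
  then show ?thesis by (simp add: mult.commute)
qed

lemma Hom_torusD:
  assumes "f \<in> Hom (torus m d) H"
  shows "f \<in> torus_verts m d \<rightarrow>\<^sub>E verts H" "x \<in> torus_verts m d \<Longrightarrow> y \<in> nbhd (torus m d) x \<Longrightarrow> {f x, f y} \<in> edges H"
  using assms by (auto simp: Hom_def nbhd_def torus_def)

lemma card_odd_class: "0 < d \<Longrightarrow> real (card (odd_class m d)) = real m ^ d / 2"
proof -
  assume d: "0 < d"
  \<comment> \<open>The colour data are placeholders: only the double count
    \<open>card_Ev_Od\<close> of a regular graph is wanted.\<close>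
  interpret ranked_bipartite "even_class m d" "odd_class m d" "nbhd (torus m d)" "torus_rank m d"
    "if m = 2 then d else 2 * d" "{} :: nat set" "\<lambda>_. 1" "\<lambda>_ _. True"
    using d torus_rank_nbhd[OF m] by (intro ranked_bipartite_torus) auto
  have "card (torus_verts m d) = card (even_class m d) + card (odd_class m d)"
    unfolding classes(1)[symmetric] using fin disj by (intro card_Un_disjoint) auto
  then have "2 * card (odd_class m d) = m ^ d" using card_Ev_Od by (simp add: card_torus_verts)
  then have "2 * real (card (odd_class m d)) = real m ^ d" by (metis of_nat_mult of_nat_numeral of_nat_power)
  then show ?thesis by simp
qed

text \<open>For an optimal pair, all maps with values in \<open>A\<close> on the even and in
  \<open>B\<close> on the odd class are colourings, and their weights sum to a product over the
  vertices.\<close>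

lemma partition_function_ge:
  fixes H :: "'h ugraph"
  assumes H: "finite_loop_graph H" and lam: "\<And>i. i \<in> verts H \<Longrightarrow> 0 < lam i" and d: "0 < d"
  shows "eta lam H ^ card (odd_class m d) \<le> partition_function lam (torus m d) H"
proof -
  interpret ranked_bipartite "even_class m d" "odd_class m d" "nbhd (torus m d)" "torus_rank m d"
    "if m = 2 then d else 2 * d" "verts H" lam "edge_rel H"
    using d torus_rank_nbhd[OF m] lam H by (intro ranked_bipartite_torus) (auto simp: finite_loop_graph_def)
  obtain A B where AB: "A \<subseteq> verts H" "B \<subseteq> verts H" "fully_adjacent H A B" "sum lam A * sum lam B = eta lam H"
    by (rule eta_attained[OF H lam])
  define S where "S x = (if x \<in> even_class m d then A else B)" for x
  have finS: "finite (S x)" for x using AB fin(3) finite_subset by (auto simp: S_def)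
  have sub: "PiE (torus_verts m d) S \<subseteq> Hom (torus m d) H"
  proof
    fix f assume f: "f \<in> PiE (torus_verts m d) S"
    have "{f u, f v} \<in> edges H" if e: "{u, v} \<in> edges (torus m d)" for u v
    proof -
      have uv: "u \<in> torus_verts m d" "v \<in> torus_verts m d"
        using e by (auto simp: torus_def doubleton_eq_iff)
      have n: "v \<in> nbhd (torus m d) u" using e by (simp add: nbhd_def)
      have adj: "{a, b} \<in> edges H" "{b, a} \<in> edges H" if "a \<in> A" "b \<in> B" for a b
        using AB that by (auto simp: fully_adjacent_def insert_commute)
      have "f u \<in> S u" "f v \<in> S v" using f uv by auto
      moreover have "u \<in> even_class m d \<longleftrightarrow> v \<notin> even_class m d"
        using n N_Ev[of u] N_Od[of u] uv classes by auto
      ultimately show ?thesis using adj by (auto simp: S_def split: if_splits)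
    qed
    moreover have "f \<in> torus_verts m d \<rightarrow>\<^sub>E verts H"
      using f AB by (auto simp: PiE_iff S_def subset_iff split: if_splits)
    ultimately show "f \<in> Hom (torus m d) H" by (auto simp: Hom_def torus_def)
  qed
  have finHom: "finite (Hom (torus m d) H)"
    by (rule finite_subset[of _ "torus_verts m d \<rightarrow>\<^sub>E verts H"])
       (auto simp: Hom_def torus_def intro!: finite_PiE finite_torus_verts fin(3))
  have "eta lam H ^ card (odd_class m d) = (\<Prod>x\<in>even_class m d. sum lam A) * (\<Prod>x\<in>odd_class m d. sum lam B)"
    unfolding AB(4)[symmetric] using card_Ev_Od by (simp add: power_mult_distrib)
  also have "\<dots> = (\<Prod>x\<in>even_class m d. sum lam (S x)) * (\<Prod>x\<in>odd_class m d. sum lam (S x))"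
    using disj by (intro arg_cong2[where f = "(*)"] prod.cong) (auto simp: S_def)
  also have "\<dots> = (\<Prod>x\<in>torus_verts m d. sum lam (S x))"
    unfolding classes(1)[symmetric] using fin disj by (intro prod.union_disjoint[symmetric]) auto
  also have "\<dots> = (\<Sum>f\<in>PiE (torus_verts m d) S. \<Prod>x\<in>torus_verts m d. lam (f x))"
    using finS by (intro prod_sum_PiE finite_torus_verts) auto
  also have "\<dots> \<le> (\<Sum>f\<in>Hom (torus m d) H. \<Prod>x\<in>torus_verts m d. lam (f x))"
    using sub finHom lam Hom_torusD(1)[of _ H]
    by (intro sum_mono2 prod_nonneg) (auto simp: less_imp_le PiE_iff)
  also have "\<dots> = partition_function lam (torus m d) H"
    by (simp add: partition_function_def set_weight_def col_weight_def torus_def)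
  finally show ?thesis .
qed

end

section \<open>Structure of colourings of small gain\<close>

text \<open>The sequence is the fifth power of \<open>n * root 5 q ^ n\<close>; the exponent 5 is
  the one produced by \<open>structure_bound\<close>.\<close>

lemma power_times_geometric_tendsto_0:
  fixes q :: real
  assumes "0 < q" "q < 1"
  shows "(\<lambda>n. real n ^ 5 * q ^ n) \<longlonglongrightarrow> 0"
proof -
  define s where "s = root 5 q"
  have s: "norm s < 1" "s ^ 5 = q" using assms by (auto simp: s_def)
  have "(\<lambda>n. real n * s ^ n) \<longlonglongrightarrow> 0" by (rule powser_times_n_limit_0[OF s(1)])
  then have "(\<lambda>n. (real n * s ^ n) ^ 5) \<longlonglongrightarrow> 0 ^ 5" by (rule tendsto_power)
  moreover have "(real n * s ^ n) ^ 5 = real n ^ 5 * q ^ n" for n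
    unfolding s(2)[symmetric] by (simp add: power_mult_distrib power_mult[symmetric] mult.commute)
  ultimately show ?thesis by simp
qed

text \<open>The midpoint of \<open>r * M\<close> and \<open>M\<close> absorbs the polynomial factor
  and stays below \<open>M\<close>. With \<open>M = m\<close>, the bound \<open>M ^ d / 2\<close> is
  the size of the odd class, and being below it guarantees an odd vertex without defect.\<close>

lemma poly_times_geometric_le:
  fixes r C M :: real
  assumes r: "0 < r" "r < 1" and M: "0 < M"
  shows "\<forall>\<^sub>F d in sequentially. C * (real d ^ 5 * (r * M) ^ d) \<le> ((r * M + M) / 2) ^ d \<and>
     C * (real d ^ 5 * (r * M) ^ d) < M ^ d / 2"
proof -
  have *: "\<forall>\<^sub>F d in sequentially. C * (real d ^ 5 * q ^ d) < 1 / 2" if "0 < q" "q < 1" for q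
  proof -
    have "(\<lambda>d. C * (real d ^ 5 * q ^ d)) \<longlonglongrightarrow> C * 0"
      by (intro tendsto_mult tendsto_const power_times_geometric_tendsto_0 that)
    then show ?thesis by (rule order_tendstoD) simp
  qed
  \<comment> \<open>The ratio of \<open>r * M\<close> to the midpoint
    \<open>(r * M + M) / 2\<close>.\<close>
  define q where "q = 2 * r / (r + 1)"
  have q: "0 < q" "q < 1" using r by (auto simp: q_def field_simps)
  have qM: "q * ((r * M + M) / 2) = r * M"
    using r by (simp add: q_def field_simps)
  show ?thesis
    using *[OF q] *[OF r]
  proof eventually_elim
    case (elim d)
    have pos: "0 < ((r * M + M) / 2) ^ d" using r M by (intro zero_less_power) (simp add: add_pos_pos)
    have "(r * M) ^ d = q ^ d * ((r * M + M) / 2) ^ d"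
      by (subst qM[symmetric]) (rule power_mult_distrib)
    then have "C * (real d ^ 5 * (r * M) ^ d) = (C * (real d ^ 5 * q ^ d)) * ((r * M + M) / 2) ^ d"
      by (simp only: mult.assoc)
    also have "\<dots> \<le> 1 * ((r * M + M) / 2) ^ d"
      using elim pos by (intro mult_right_mono) auto
    finally have 1: "C * (real d ^ 5 * (r * M) ^ d) \<le> ((r * M + M) / 2) ^ d" by simp
    have "C * (real d ^ 5 * (r * M) ^ d) = (C * (real d ^ 5 * r ^ d)) * M ^ d"
      by (simp only: power_mult_distrib mult_ac)
    also have "\<dots> < 1 / 2 * M ^ d"
      using elim M by (intro mult_strict_right_mono) auto
    finally show ?case using 1 by simp
  qed
qed

lemma two_sided_torus:
  fixes H :: "'h ugraph"
  assumes m: "2 \<le> m" "even m" and H: "finite_loop_graph H" and lam: "\<And>i. i \<in> verts H \<Longrightarrow> 0 < lam i"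
    and ne: "edges H \<noteq> {}" and d: "0 < d"
    and delta: "0 < delta" "delta \<le> 1/2" and theta: "0 \<le> theta" "theta \<le> 1/2"
    and kap: "0 < kap" "kap \<le> 1" "\<And>a. a \<in> verts H \<Longrightarrow> kap * sum lam (verts H) \<le> lam a"
    and gam: "0 < gam" and g: "0 < g" "g \<le> gam * kap"
    and gap: "\<And>A. A \<subseteq> verts H \<Longrightarrow> A \<noteq> {} \<Longrightarrow> CNbrs H A \<noteq> {} \<Longrightarrow>
     sum lam A * sum lam (CNbrs H A) \<noteq> eta lam H \<Longrightarrow>
     ln (sum lam A) + ln (sum lam (CNbrs H A)) \<le> ln (eta lam H) - g"
  shows "two_sided (even_class m d) (odd_class m d) (nbhd (torus m d)) (torus_rank m d)
     (if m = 2 then d else 2 * d) (verts H) lam (edge_rel H) delta theta kap (eta lam H) g gam (m * d)"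
proof -
  have gain: "gain (even_class m d) (odd_class m d) (nbhd (torus m d)) rho
     (if m = 2 then d else 2 * d) (verts H) lam (edge_rel H) delta theta kap (eta lam H) g gam"
    if "\<And>x y. x \<in> torus_verts m d \<Longrightarrow> y \<in> nbhd (torus m d) x \<Longrightarrow>
       rho y = Suc (rho x) \<or> rho x = Suc (rho y)" for rho
  proof (intro gain.intro coding.intro gain_axioms.intro coding_axioms.intro)
    show "ranked_bipartite (even_class m d) (odd_class m d) (nbhd (torus m d)) rho
      (if m = 2 then d else 2 * d) (verts H) lam"
      using that d H lam by (intro ranked_bipartite_torus m) (auto simp: finite_loop_graph_def)
    show "sum lam A * sum lam (CNbrs H A) \<le> eta lam H" if "A \<subseteq> verts H" for A
      using CNbrs_le_eta[OF H lam that] .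
    show "0 < eta lam H" using eta_pos[OF H lam ne] .
  qed (use assms in auto)
  show ?thesis
  proof (intro two_sided.intro two_sided_axioms.intro gain)
    show "torus_rank m d x \<le> m * d" if "x \<in> even_class m d \<union> odd_class m d" for x
      using that by (intro torus_rank_le m) (auto simp: even_class_def odd_class_def)
    show "torus_rank m d y = Suc (torus_rank m d x) \<or> torus_rank m d x = Suc (torus_rank m d y)"
      if "x \<in> torus_verts m d" "y \<in> nbhd (torus m d) x" for x y
      using torus_rank_nbhd[OF m that] .
    show "m * d - torus_rank m d y = Suc (m * d - torus_rank m d x) \<or>
        m * d - torus_rank m d x = Suc (m * d - torus_rank m d y)"
      if "x \<in> torus_verts m d" "y \<in> nbhd (torus m d) x" for x y
      using torus_rank_nbhd[OF m that] torus_rank_le[OF m that(1)]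
        torus_rank_le[OF m torus_nbhd_in(1)[OF m that]] by auto
  qed
qed

locale torus_coding = two_sided "even_class m d" "odd_class m d" "nbhd (torus m d)" "torus_rank m d"
     "if m = 2 then d else 2 * d" "verts H" lam "edge_rel H" delta theta kap "eta lam H" g "1 / 128" "m * d"
  for m d :: nat and H :: "'h ugraph" and lam delta theta kap g +
  assumes m: "2 \<le> m" "even m" and d8: "8 \<le> d"
begin

abbreviation D :: nat where "D \<equiv> if m = 2 then d else 2 * d"

lemma V_eq: "even_class m d \<union> odd_class m d = torus_verts m d"
  by (rule classes(1)[OF m])

lemma card_dn_ge: "x \<in> torus_verts m d \<Longrightarrow> card {i. i < d \<and> x i \<noteq> 0} \<le> card (asc.dn x)"
  unfolding asc.dn_def using card_nbhd_down[OF m] by simp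

lemma card_up_ge: "x \<in> torus_verts m d \<Longrightarrow> card {i. i < d \<and> x i \<noteq> m div 2} \<le> card (asc.up x)"
  unfolding asc.up_def using card_nbhd_up[OF m] by simp

definition few :: "nat \<Rightarrow> (nat \<Rightarrow> nat) set" where
  "few c = {x \<in> torus_verts m d. real (card {i. i < d \<and> x i \<noteq> c}) < d / 4}"

text \<open>The origin of \<open>1 / 128\<close>: at least \<open>d / 4\<close> neighbours with at
  least \<open>d / 4 - 1\<close> further steps each make at least
  \<open>(d / 4) * (d / 8) = d^2 / 32\<close> paths once \<open>d \<ge> 8\<close>, and
  \<open>D \<le> 2 * d\<close>.\<close>

lemma path_count:
  fixes s :: real
  assumes "d / 4 \<le> s" "\<And>y. y \<in> A \<Longrightarrow> s \<le> F y + 1" "s \<le> card A" "finite A"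
  shows "1 / 128 * (real D)\<^sup>2 \<le> (\<Sum>y\<in>A. F y :: real)"
proof -
  have d: "8 \<le> real d" using d8 by simp
  have "1 / 128 * (real D)\<^sup>2 \<le> (real d)\<^sup>2 / 32" by (auto simp: power2_eq_square)
  also have "\<dots> = (d / 4) * (d / 8)" by (simp add: power2_eq_square)
  also have "\<dots> \<le> card A * (s - 1)" using assms d by (intro mult_mono) auto
  also have "\<dots> = (\<Sum>y\<in>A. s - 1)" by simp
  also have "\<dots> \<le> (\<Sum>y\<in>A. F y)" using assms by (intro sum_mono) (simp add: algebra_simps)
  finally show ?thesis .
qed

text \<open>A coordinate other than 0 can move towards the origin, one other than
  \<open>m div 2\<close> away from it. So a vertex with \<open>d / 4\<close> of each kind has many
  steps down and up, and a neighbour loses at most one of either kind.\<close>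

lemma atypical_subset: "atypical \<subseteq> few 0 \<union> few (m div 2)"
proof
  fix x assume x: "x \<in> atypical"
  show "x \<in> few 0 \<union> few (m div 2)"
  proof (rule ccontr)
    assume n: "x \<notin> few 0 \<union> few (m div 2)"
    have xV: "x \<in> torus_verts m d" using x V_eq by (auto simp: atypical_def)
    then have xV': "x \<in> even_class m d \<union> odd_class m d" using V_eq by simp
    have nz: "d / 4 \<le> real (card {i. i < d \<and> x i \<noteq> 0})"
      and nh: "d / 4 \<le> real (card {i. i < d \<and> x i \<noteq> m div 2})"
      using n xV by (auto simp: few_def)
    have dn: "real (card {i. i < d \<and> x i \<noteq> 0}) \<le> card (asc.dn x)"
      and up: "real (card {i. i < d \<and> x i \<noteq> m div 2}) \<le> card (asc.up x)"
      using card_dn_ge[OF xV] card_up_ge[OF xV] by auto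
    have d: "8 \<le> real d" using d8 by simp
    have D: "1 / 128 * real D \<le> d / 4" by auto
    have nbr: "y \<in> torus_verts m d" if "y \<in> nbhd (torus m d) x" for y
      using torus_nbhd_in[OF m xV that] by simp
    have F: "real (card {i. i < d \<and> x i \<noteq> 0}) \<le> real (card (asc.dn y)) + 1" if "y \<in> nbhd (torus m d) x" for y
      using card_coord_nbhd[OF m xV that, of 0] card_dn_ge[OF nbr[OF that]] by linarith
    have G: "real (card {i. i < d \<and> x i \<noteq> m div 2}) \<le> real (card (asc.up y)) + 1" if "y \<in> nbhd (torus m d) x" for y
      using card_coord_nbhd[OF m xV that, of "m div 2"] card_up_ge[OF nbr[OF that]] by linarith
    have "0 < real (card (asc.dn x))" "0 < real (card (asc.up x))" using nz nh dn up d by linarith+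
    then have ne: "asc.dn x \<noteq> {}" "asc.up x \<noteq> {}" by auto
    have xO: "x \<in> odd_class m d" and nt: "\<not> asc.typical x \<or> \<not> desc.typical x"
      using x ne by (auto simp: atypical_def)
    have fin: "finite (asc.dn x)" "finite (asc.up x)" using asc.finite_dn asc.finite_up xV' by auto
    have "1 / 128 * (real D)\<^sup>2 \<le> (\<Sum>y\<in>asc.dn x. real (card (asc.dn y)))"
      using nz dn F fin asc.dn_subset by (intro path_count) auto
    then have "asc.typical x"
      using asc.card_paths[OF xO] D nh up unfolding asc.typical_def by simp
    moreover have "1 / 128 * (real D)\<^sup>2 \<le> (\<Sum>y\<in>asc.up x. real (card (asc.up y)))"
      using nh up G fin asc.up_subset by (intro path_count) auto
    moreover have "(\<Sum>y\<in>asc.up x. real (card (asc.up y))) = card (desc.paths x)"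
      using desc.card_paths[OF xO] desc_dn[OF xV'] asc.up_Od[OF xO]
      by (auto simp: desc_dn intro!: sum.cong)
    ultimately have "desc.typical x"
      using D nz dn desc_up[OF xV'] unfolding desc.typical_def by simp
    then show False using nt \<open>asc.typical x\<close> by simp
  qed
qed

lemma card_atypical: "real (card atypical) \<le> 2 * (9 / 10 * real m) ^ d"
proof -
  have fin: "finite (few c)" for c using finite_torus_verts[of m d] by (auto simp: few_def)
  have "card atypical \<le> card (few 0 \<union> few (m div 2))"
    using atypical_subset fin by (intro card_mono) auto
  also have "\<dots> \<le> card (few 0) + card (few (m div 2))" by (rule card_Un_le)
  finally have "real (card atypical) \<le> real (card (few 0)) + real (card (few (m div 2)))"
    by (metis of_nat_add of_nat_mono)
  moreover have "real (card (few 0)) \<le> (9 / 10 * real m) ^ d" "real (card (few (m div 2))) \<le> (9 / 10 * real m) ^ d"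
    unfolding few_def by (rule card_few_coords[OF m], use m in simp)+
  ultimately show ?thesis by simp
qed

text \<open>With logarithmic gain below \<open>D\<close>, and with \<open>delta\<close> and the
  proportion of atypical vertices of order \<open>r ^ d\<close> at most, the defects number
  \<open>E = (r * m) ^ d\<close> up to constants and powers of \<open>d\<close>: \<open>d\<close>
  for bad and dull vertices, \<open>d^3\<close> for mixed ones, and \<open>d^5\<close> after the
  isoperimetric step with its factor \<open>d * m * (1 + D)\<close>.\<close>

lemma structure_bound:
  fixes eps r s c1 Q :: real
  assumes f: "f \<in> Hom (torus m d) H" and small: "\<not> large_gain D f"
    and theta_eq: "theta = g / 8" and g_pos: "0 < g"
    and eps: "- ln asc.base \<le> eps * D" "0 \<le> eps"
      "eps * (2 + 4 / (1 / 128)) \<le> g / 2" "4 * eps \<le> theta * kap * (1 / 128)" "eps \<le> kap / 2"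
    and delta_le: "delta \<le> r ^ d" and r: "9 / 10 \<le> r"
  defines "s \<equiv> 12 + 4 * (g + eps)"
  defines "c1 \<equiv> 2 + 2 * s / g + 8 * s / (theta * kap) + 8 * s / g"
  defines "Q \<equiv> (c1 + 3 * m * c1 + s / g + s / kap) * (real d ^ 5 * (r * m) ^ d)"
  shows "\<exists>A. (Q < card (odd_class m d) \<longrightarrow> (A, CNbrs H A) \<in> max_pairs lam H) \<and>
     real (card {v \<in> even_class m d. f v \<notin> A}) \<le> Q \<and>
     real (card {v \<in> odd_class m d. f v \<notin> CNbrs H A}) \<le> Q \<and>
     real (card {w \<in> odd_class m d. \<not> A \<subseteq> f ` nbhd (torus m d) w}) \<le> Q \<and>
     real (card {w \<in> even_class m d. \<not> CNbrs H A \<subseteq> f ` nbhd (torus m d) w}) \<le> Q"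
proof -
  define E where "E = (r * m) ^ d"
  have d1: "1 \<le> real d" using d8 by simp
  have "1 \<le> r * m" using r m mult_mono[of "9/10" r 2 "real m"] by simp
  then have E1: "1 \<le> E" unfolding E_def by (rule one_le_power)
  have D2: "real D \<le> 2 * d" by simp
  have f': "asc.coloring f"
    unfolding asc.coloring_def V_eq using Hom_torusD[OF m f] by (auto simp: PiE_iff)
  define B where "B = real (card (Bad f))"
  define U where "U = real (card {w \<in> even_class m d. asc.dull f w})"
  define ab where "ab = asc.psum (\<lambda>v u. \<not> f ` asc.dn v \<subseteq> f ` asc.dn u) + asc.psum (\<lambda>v u. \<not> f ` asc.up u \<subseteq> f ` asc.up v)"
  define S where "S = 2 * real D + 8 * delta * card (odd_class m d) + 2 * (g + eps) * card atypical"
  have th: "0 < theta" using theta_eq g_pos by simp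
  have kp: "0 < kap" using asc.kap by simp
  have D0: "0 < real D" using asc.D_pos by simp
  have s0: "0 < s" using g_pos eps by (simp add: s_def)
  have nn: "0 \<le> B" "0 \<le> U" "0 \<le> ab" using asc.psum_nonneg by (auto simp: B_def U_def ab_def)
  have main: "g * B + theta * kap / 2 * (ab / (real D)\<^sup>2) + kap * U \<le> S"
    using defects_le[OF f' small theta_eq eps] by (simp add: B_def U_def ab_def S_def)
  have at: "real (card atypical) \<le> 2 * E"
  proof -
    have "(9 / 10 * real m) ^ d \<le> E" unfolding E_def using r by (intro power_mono mult_right_mono) auto
    then show ?thesis using card_atypical by simp
  qed
  have dE: "E \<le> d * E" using d1 E1 by simp
  have S: "S \<le> s * (d * E)"
  proof -
    have "card (odd_class m d) \<le> card (torus_verts m d)"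
      using finite_torus_verts by (intro card_mono) (auto simp: odd_class_def)
    then have "real (card (odd_class m d)) \<le> real m ^ d"
      by (metis card_torus_verts of_nat_mono of_nat_power)
    then have "delta * card (odd_class m d) \<le> r ^ d * real m ^ d"
      using delta_le asc.delta by (intro mult_mono) auto
    also have "\<dots> = E" by (simp add: E_def power_mult_distrib)
    finally have "8 * delta * card (odd_class m d) \<le> 8 * E" by simp
    moreover have "2 * (g + eps) * card atypical \<le> 2 * (g + eps) * (2 * E)"
      using at g_pos eps by (intro mult_left_mono) auto
    moreover have "2 * real D \<le> 4 * (d * E)"
      using D2 mult_left_mono[OF E1, of "real d"] by linarith
    ultimately have "S \<le> 4 * (d * E) + 8 * E + 4 * (g + eps) * E" unfolding S_def by linarith
    also have "\<dots> \<le> 4 * (d * E) + 8 * (d * E) + 4 * (g + eps) * (d * E)"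
      using dE g_pos eps by (intro add_mono mult_left_mono) auto
    also have "\<dots> = s * (d * E)" by (simp add: s_def algebra_simps)
    finally show ?thesis .
  qed
  have p1: "0 \<le> g * B" "0 \<le> theta * kap / 2 * (ab / (real D)\<^sup>2)" "0 \<le> kap * U"
    using nn g_pos th kp by auto
  have dE5: "real d ^ k * E \<le> real d ^ 5 * E" if "k \<le> 5" for k
    using that d1 E1 by (intro mult_right_mono power_increasing) auto
  have B: "B \<le> s / g * (d * E)"
  proof -
    have "g * B \<le> s * (d * E)" using main S p1 by linarith
    then show ?thesis using g_pos by (simp add: field_simps)
  qed
  have U: "U \<le> s / kap * (d * E)"
  proof -
    have "kap * U \<le> s * (d * E)" using main S p1 by linarith
    then show ?thesis using kp by (simp add: field_simps)
  qed
  have D4: "(real D)\<^sup>2 \<le> 4 * (real d)\<^sup>2"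
    using power_mono[OF D2, of 2] by (simp add: power_mult_distrib)
  have ab: "ab \<le> 8 * s / (theta * kap) * (real d ^ 3 * E)"
  proof -
    have "theta * kap / 2 * (ab / (real D)\<^sup>2) \<le> s * (d * E)" using main S p1 by linarith
    then have "ab \<le> 2 * s / (theta * kap) * (d * E) * (real D)\<^sup>2"
      using th kp D0 by (simp add: field_simps)
    also have "\<dots> \<le> 2 * s / (theta * kap) * (d * E) * (4 * (real d)\<^sup>2)"
      using D4 s0 th kp E1 by (intro mult_left_mono) auto
    also have "\<dots> = 8 * s / (theta * kap) * (real d ^ 3 * E)"
      by (simp add: power2_eq_square power3_eq_cube)
    finally show ?thesis .
  qed
  have DB: "2 * (real D)\<^sup>2 * B \<le> 8 * s / g * (real d ^ 3 * E)"
  proof -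
    have "2 * (real D)\<^sup>2 * B \<le> 2 * (4 * (real d)\<^sup>2) * (s / g * (d * E))"
      using D4 B nn by (intro mult_mono) auto
    also have "\<dots> = 8 * s / g * (real d ^ 3 * E)"
      by (simp add: power2_eq_square power3_eq_cube)
    finally show ?thesis .
  qed
  have mixed: "real (card (mixed f)) \<le> c1 * (real d ^ 3 * E)"
  proof -
    have "real (card (mixed f)) \<le> card atypical + D * B + (ab + 2 * (real D)\<^sup>2 * B)"
      using card_mixed_le[of f] mismatch_le(1)[of f] unfolding ab_def B_def of_nat_mult of_nat_add by argo
    moreover have "D * B \<le> 2 * s / g * (real d ^ 3 * E)"
    proof -
      have "D * B \<le> (2 * d) * (s / g * (d * E))" using D2 B nn by (intro mult_mono) auto
      also have "\<dots> = 2 * s / g * (real d ^ 2 * E)" by (simp add: power2_eq_square)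
      also have "\<dots> \<le> 2 * s / g * (real d ^ 3 * E)"
        using s0 g_pos d1 E1 by (intro mult_left_mono mult_right_mono power_increasing) auto
      finally show ?thesis .
    qed
    moreover have "real (card atypical) \<le> 2 * (real d ^ 3 * E)"
    proof -
      have "1 * E \<le> real d ^ 3 * E" using d1 E1 by (intro mult_right_mono one_le_power) auto
      then show ?thesis using at by simp
    qed
    ultimately show ?thesis using ab DB unfolding c1_def distrib_right by linarith
  qed
  \<comment> \<open>A phase change along an edge is charged to the even end, which is mixed. The
    isoperimetric inequality wants both ends in \<open>C\<close>, so the neighbours are
    added.\<close>
  define C where "C = mixed f \<union> (\<Union>w\<in>mixed f. nbhd (torus m d) w)"
  have mE: "mixed f \<subseteq> even_class m d" by (auto simp: mixed_def)
  have finm: "finite (mixed f)" using mE asc.fin finite_subset by blast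
  have CV: "C \<subseteq> torus_verts m d"
    using mE asc.N_Ev V_eq unfolding C_def by blast
  have cardC: "card C \<le> (1 + D) * card (mixed f)"
  proof -
    have "card C \<le> card (mixed f) + card (\<Union>w\<in>mixed f. nbhd (torus m d) w)"
      unfolding C_def by (rule card_Un_le)
    also have "card (\<Union>w\<in>mixed f. nbhd (torus m d) w) \<le> (\<Sum>w\<in>mixed f. card (nbhd (torus m d) w))"
      using finm by (rule card_UN_le)
    also have "\<dots> = (\<Sum>w\<in>mixed f. D)" using mE asc.card_N by (intro sum.cong) auto
    finally show ?thesis by (simp only: sum_constant of_nat_id add_mult_distrib nat_mult_1 mult.commute)
  qed
  have "\<exists>A. card {x \<in> torus_verts m d. phase f x \<noteq> A} \<le> d * m * card C"
  proof (rule torus_isoperimetry[OF m _ CV])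
    fix x y assume xy: "x \<in> torus_verts m d" "y \<in> nbhd (torus m d) x" "phase f x \<noteq> phase f y"
    show "x \<in> C"
    proof (cases "x \<in> even_class m d")
      case True
      then have "x \<in> mixed f" using phase_nbr(1)[of x f y] xy by auto
      then show ?thesis by (simp add: C_def)
    next
      case False
      then have "x \<in> odd_class m d" using xy V_eq by blast
      then have "y \<in> even_class m d" using asc.N_Od xy by blast
      moreover have "x \<in> nbhd (torus m d) y" using torus_nbhd_in[OF m] xy by blast
      ultimately have "y \<in> mixed f" using phase_nbr(1)[of y f x] xy by auto
      then show ?thesis using \<open>x \<in> nbhd (torus m d) y\<close> by (auto simp: C_def)
    qed
  qed
  then obtain A where A: "card {x \<in> torus_verts m d. phase f x \<noteq> A} \<le> d * m * card C" by blast
  define Z where "Z = {x \<in> even_class m d \<union> odd_class m d. phase f x \<noteq> A}"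
  have finZ: "finite Z" using asc.fin by (simp add: Z_def)
  have Z: "real (card Z) \<le> 3 * m * c1 * (real d ^ 5 * E)"
  proof -
    have "card Z \<le> d * m * ((1 + D) * card (mixed f))"
      using A cardC unfolding Z_def V_eq by (meson le_trans mult_le_mono2)
    then have "real (card Z) \<le> real (d * m * ((1 + D) * card (mixed f)))" by (rule of_nat_mono)
    also have "\<dots> = d * m * ((1 + real D) * real (card (mixed f)))"
      by (simp only: of_nat_mult of_nat_add of_nat_1)
    also have "\<dots> \<le> d * m * ((3 * real d) * (c1 * (real d ^ 3 * E)))"
    proof (intro mult_left_mono mult_mono mixed)
      show "1 + real D \<le> 3 * real d" using D2 d1 by linarith
    qed auto
    also have "\<dots> = 3 * m * c1 * (real d ^ 5 * E)"
      by (simp add: power_numeral_reduce)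
    finally show ?thesis .
  qed
  have c1: "0 \<le> c1" using s0 g_pos th kp by (simp add: c1_def)
  define X where "X = real d ^ 5 * E"
  have X: "real (card (mixed f)) \<le> c1 * X" "real (card Z) \<le> 3 * m * c1 * X" "B \<le> s / g * X" "U \<le> s / kap * X"
  proof -
    show "real (card (mixed f)) \<le> c1 * X"
      using mixed mult_left_mono[OF dE5[of 3] c1] unfolding X_def by simp
    show "B \<le> s / g * X"
      using B mult_left_mono[OF dE5[of 1], of "s / g"] s0 g_pos unfolding X_def by simp
    show "U \<le> s / kap * X"
      using U mult_left_mono[OF dE5[of 1], of "s / kap"] s0 kp unfolding X_def by simp
    show "real (card Z) \<le> 3 * m * c1 * X" using Z by (simp add: X_def)
  qed
  have "Q = c1 * X + 3 * m * c1 * X + s / g * X + s / kap * X"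
    by (simp add: Q_def X_def E_def algebra_simps)
  then have Q: "real (card (mixed f)) + real (card Z) + B + U \<le> Q" using X by linarith
  note concl = phase_conclusion[OF f', of A, folded Z_def]
  have finB: "finite (Bad f)" using asc.fin by simp
  have c: "card {v \<in> even_class m d. f v \<notin> A} \<le> card (mixed f) + card Z"
    "card {v \<in> odd_class m d. f v \<notin> CNbrs H A} \<le> card (Bad f) + card Z"
    "card {w \<in> odd_class m d. \<not> A \<subseteq> f ` nbhd (torus m d) w} \<le> card (Bad f) + card Z"
    "card {w \<in> even_class m d. \<not> CNbrs H A \<subseteq> f ` nbhd (torus m d) w}
       \<le> card (mixed f) + card Z + card {w \<in> even_class m d. asc.dull f w}"
  proof -
    have cm: "card X \<le> card Y1 + card Y2" if "X \<subseteq> Y1 \<union> Y2" "finite Y1" "finite Y2"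
      for X Y1 Y2 :: "(nat \<Rightarrow> nat) set"
      using card_mono[OF _ that(1)] card_Un_le[of Y1 Y2] that(2,3) by (meson finite_UnI le_trans)
    show "card {v \<in> even_class m d. f v \<notin> A} \<le> card (mixed f) + card Z"
      by (rule cm[OF concl(1) finm finZ])
    show "card {v \<in> odd_class m d. f v \<notin> CNbrs H A} \<le> card (Bad f) + card Z"
      by (rule cm[OF concl(2) finB finZ])
    show "card {w \<in> odd_class m d. \<not> A \<subseteq> f ` nbhd (torus m d) w} \<le> card (Bad f) + card Z"
      by (rule cm[OF concl(3) finB finZ])
    have "finite {w \<in> even_class m d. asc.dull f w}" using asc.fin by simp
    from cm[OF concl(4) finite_UnI[OF finm finZ] this] card_Un_le[of "mixed f" Z]
    show "card {w \<in> even_class m d. \<not> CNbrs H A \<subseteq> f ` nbhd (torus m d) w}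
       \<le> card (mixed f) + card Z + card {w \<in> even_class m d. asc.dull f w}" by linarith
  qed
  have "(A, CNbrs H A) \<in> max_pairs lam H" if "Q < card (odd_class m d)"
  proof -
    have "real (card (Bad f) + card Z) < card (odd_class m d)"
      using that Q nn by (simp add: B_def)
    then have "card (Bad f) + card Z < card (odd_class m d)" by (simp only: of_nat_less_iff)
    from concl(5)[OF this] have "sum lam A * sum lam (CNbrs H A) = eta lam H" "A \<subseteq> verts H" by auto
    then show ?thesis
      by (auto simp: max_pairs_def fully_adjacent_def common_nbrs_def)
  qed
  moreover have "real (card {v \<in> even_class m d. f v \<notin> A}) \<le> Q"
    "real (card {v \<in> odd_class m d. f v \<notin> CNbrs H A}) \<le> Q"
    "real (card {w \<in> odd_class m d. \<not> A \<subseteq> f ` nbhd (torus m d) w}) \<le> Q"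
    "real (card {w \<in> even_class m d. \<not> CNbrs H A \<subseteq> f ` nbhd (torus m d) w}) \<le> Q"
    using c[THEN of_nat_mono[where 'a = real]] Q nn unfolding of_nat_add B_def U_def by linarith+
  ultimately show ?thesis by blast
qed

end

section \<open>Choice of constants and assembly of the partition\<close>

definition near_pair :: "nat \<Rightarrow> nat \<Rightarrow> real \<Rightarrow> ((nat \<Rightarrow> nat) \<Rightarrow> 'h) \<Rightarrow> 'h set \<Rightarrow> 'h set \<Rightarrow> bool" where
  "near_pair m d q f A B \<longleftrightarrow>
     real (card {v \<in> even_class m d. f v \<notin> A}) \<le> q \<and>
     real (card {v \<in> odd_class m d. f v \<notin> B}) \<le> q \<and>
     real (card {w \<in> odd_class m d. \<not> A \<subseteq> f ` nbhd (torus m d) w}) \<le> q \<and>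
     real (card {w \<in> even_class m d. \<not> B \<subseteq> f ` nbhd (torus m d) w}) \<le> q"

text \<open>Without edges in \<open>H\<close> the value \<open>eta\<close> is 0 and the logarithmic
  argument breaks down; this case is settled by the existence of an edge in the torus.\<close>

lemma Hom_torus_empty:
  assumes m: "2 \<le> m" "even m" and d: "1 \<le> d" and ne: "edges H = {}"
  shows "Hom (torus m d) H = {}"
proof (rule ccontr)
  assume "Hom (torus m d) H \<noteq> {}"
  then obtain f where f: "f \<in> Hom (torus m d) H" by blast
  define x :: "nat \<Rightarrow> nat" where "x = (\<lambda>i\<in>{..<d}. 0)"
  have x: "x \<in> torus_verts m d" using m by (auto simp: x_def torus_verts_def)
  have "card (nbhd (torus m d) x) > 0" using card_torus_nbhd[OF m x] d by simp
  then obtain y where "y \<in> nbhd (torus m d) x" by (metis all_not_in_conv card.empty less_irrefl)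
  then show False using Hom_torusD(2)[OF m f x] ne by blast
qed

lemma torus_dichotomy:
  fixes H :: "'h ugraph" and lam :: "'h \<Rightarrow> real" and m :: nat
  assumes H: "finite_loop_graph H" and lam: "\<And>i. i \<in> verts H \<Longrightarrow> 0 < lam i"
    and m: "2 \<le> m" "even m" and ne: "edges H \<noteq> {}"
  obtains c :: real and d0 :: nat where "0 < c" "c < m"
    and "\<And>d. d \<ge> d0 \<Longrightarrow> \<exists>S \<subseteq> Hom (torus m d) H.
       set_weight lam (torus m d) S \<le> 2 powr (- (c * real d)) * partition_function lam (torus m d) H \<and>
       (\<forall>f \<in> Hom (torus m d) H - S. \<exists>(A, B) \<in> max_pairs lam H. near_pair m d ((real m - c) ^ d) f A B)"
proof -
  have finK: "finite (verts H)" using H by (simp add: finite_loop_graph_def)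
  have "verts H \<noteq> {}" using ne H by (auto simp: finite_loop_graph_def)
  from min_weight_ratio_exists[where lam = lam, OF H lam this] obtain kap where
    kap: "0 < kap" "kap \<le> 1" "\<And>a. a \<in> verts H \<Longrightarrow> kap * sum lam (verts H) \<le> lam a" by blast
  have "0 < 1 / 128 * kap" using kap by simp
  from eta_gap_exists[where lam = lam, OF H lam this ne] obtain g where g: "0 < g" "g \<le> 1 / 128 * kap"
    and gap: "\<And>A. A \<subseteq> verts H \<Longrightarrow> A \<noteq> {} \<Longrightarrow> CNbrs H A \<noteq> {} \<Longrightarrow>
     sum lam A * sum lam (CNbrs H A) \<noteq> eta lam H \<Longrightarrow>
     ln (sum lam A) + ln (sum lam (CNbrs H A)) \<le> ln (eta lam H) - g" by blast
  define theta where "theta = g / 8"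
  have theta: "0 < theta" "0 \<le> theta" "theta \<le> 1 / 2" using g kap by (auto simp: theta_def)
  \<comment> \<open>The minimum of the three upper bounds that \<open>defects_le\<close> puts on
    \<open>eps\<close>.\<close>
  define eps where "eps = min (min (g / 2 / (2 + 4 / (1 / 128))) (theta * kap * (1 / 128) / 4)) (kap / 2)"
  have "eps \<le> g / 2 / (2 + 4 / (1 / 128))" "eps \<le> theta * kap * (1 / 128) / 4" "eps \<le> kap / 2"
    unfolding eps_def by linarith+
  moreover have "0 < eps" using g theta kap by (simp add: eps_def)
  ultimately have eps: "0 < eps" "eps * (2 + 4 / (1 / 128)) \<le> g / 2"
    "4 * eps \<le> theta * kap * (1 / 128)" "eps \<le> kap / 2" by auto
  \<comment> \<open>\<open>9 / 10\<close> is the decay rate of the proportion of atypical vertices,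
    \<open>exp (- (eps / 2))\<close> bounds that of \<open>delta\<close>.\<close>
  define r where "r = max (9 / 10) (exp (- (eps / 2)))"
  have r: "9 / 10 \<le> r" "exp (- (eps / 2)) \<le> r" "0 < r" "r < 1" using eps by (auto simp: r_def)
  define s where "s = 12 + 4 * (g + eps)"
  define c1 where "c1 = 2 + 2 * s / g + 8 * s / (theta * kap) + 8 * s / g"
  define C where "C = c1 + 3 * m * c1 + s / g + s / kap"
  have "0 < real m" using m by simp
  from poly_times_geometric_le[OF r(3,4) this, of C] obtain d1 where d1: "\<And>d. d \<ge> d1 \<Longrightarrow>
     C * (real d ^ 5 * (r * m) ^ d) \<le> ((r * m + m) / 2) ^ d \<and> C * (real d ^ 5 * (r * m) ^ d) < real m ^ d / 2"
    by (auto simp: eventually_sequentially)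
  \<comment> \<open>From \<open>d2\<close> on, the factor \<open>4 ^ card K\<close> in
    \<open>base\<close> costs at most \<open>eps / 2 * d\<close>; the summand \<open>ln 2\<close>
    secures \<open>delta \<le> 1 / 2\<close>.\<close>
  define d2 where "d2 = nat \<lceil>2 / eps * (card (verts H) * ln 4 + ln 2)\<rceil>"
  \<comment> \<open>The first term puts the midpoint \<open>(r * m + m) / 2\<close> below
    \<open>m - c\<close>; the second lets \<open>exp (- D)\<close> absorb the factor 2 and still
    stay below \<open>2 powr (- (c * d))\<close>.\<close>
  define c where "c = min (m * (1 - r) / 2) (1 / 4)"
  have c: "0 < c" "c \<le> 1 / 4" "c \<le> m * (1 - r) / 2" using r m by (auto simp: c_def)
  show ?thesis
  proof (rule that[of c "max (max d1 d2) 8"])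
    show "0 < c" "c < m" using c m by auto
    fix d assume "max (max d1 d2) 8 \<le> d"
    then have dd: "d1 \<le> d" "d2 \<le> d" "8 \<le> d" "0 < d" by auto
    define DD where "DD = (if m = 2 then d else 2 * d)"
    have DD: "real d \<le> real DD" by (simp add: DD_def)
    have "2 / eps * (card (verts H) * ln 4 + ln 2) \<le> d"
      using dd(2) by (simp add: d2_def nat_le_iff ceiling_le_iff)
    then have big: "card (verts H) * ln 4 + ln 2 \<le> eps / 2 * d" using eps by (simp add: field_simps)
    have epsDD: "eps / 2 * d \<le> eps / 2 * DD" using DD eps by (intro mult_left_mono) auto
    \<comment> \<open>Half of the allowance \<open>eps * D\<close> for \<open>- ln base\<close> goes
      to \<open>- ln delta\<close>, the other half to the number of guesses.\<close>
    define delta where "delta = exp (- (eps / 2 * DD))"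
    have K4: "0 \<le> card (verts H) * ln (4::real)" by simp
    have "ln 2 \<le> eps / 2 * DD" using big K4 epsDD by linarith
    then have "delta \<le> exp (- ln 2)" by (simp add: delta_def)
    then have delta: "0 < delta" "delta \<le> 1 / 2" by (auto simp: delta_def exp_minus)
    have "delta \<le> exp (- (eps / 2 * d))" using epsDD by (simp add: delta_def)
    also have "\<dots> = exp (- (eps / 2)) ^ d" by (simp add: exp_of_nat_mult[symmetric] mult.commute)
    also have "\<dots> \<le> r ^ d" using r by (intro power_mono) auto
    finally have delta_r: "delta \<le> r ^ d" .
    interpret torus_coding m d H lam delta theta kap g
      by (intro torus_coding.intro two_sided_torus torus_coding_axioms.intro m H lam ne delta theta kap g dd gap) auto
    have "ln asc.base = ln delta - card (verts H) * ln 4"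
      using delta by (simp add: asc.base_def ln_div ln_realpow)
    moreover have "ln delta = - (eps / 2 * DD)" by (simp add: delta_def)
    moreover have "0 \<le> ln (2::real)" by simp
    ultimately have base: "- ln asc.base \<le> eps * D"
      using big epsDD unfolding DD_def[symmetric] by linarith
    define S where "S = {f \<in> Hom (torus m d) H. large_gain D f}"
    have V: "verts (torus m d) = even_class m d \<union> odd_class m d" using V_eq by (simp add: torus_def)
    show "\<exists>S \<subseteq> Hom (torus m d) H.
       set_weight lam (torus m d) S \<le> 2 powr (- (c * real d)) * partition_function lam (torus m d) H \<and>
       (\<forall>f \<in> Hom (torus m d) H - S. \<exists>(A, B) \<in> max_pairs lam H. near_pair m d ((real m - c) ^ d) f A B)"
    proof (intro exI[of _ S] conjI ballI)
      show "S \<subseteq> Hom (torus m d) H" by (auto simp: S_def)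
      have finP: "finite (even_class m d \<union> odd_class m d \<rightarrow>\<^sub>E verts H)"
        using asc.fin by (intro finite_PiE) auto
      have "set_weight lam (torus m d) S
        \<le> (\<Sum>f\<in>{f \<in> even_class m d \<union> odd_class m d \<rightarrow>\<^sub>E verts H. large_gain D f}. \<Prod>x\<in>even_class m d \<union> odd_class m d. lam (f x))"
        unfolding set_weight_def col_weight_def V
      proof (rule sum_mono2)
        show "S \<subseteq> {f \<in> even_class m d \<union> odd_class m d \<rightarrow>\<^sub>E verts H. large_gain D f}"
          using Hom_torusD(1)[OF m] unfolding S_def V_eq by blast
        show "0 \<le> (\<Prod>x\<in>even_class m d \<union> odd_class m d. lam (f x))"
          if "f \<in> {f \<in> even_class m d \<union> odd_class m d \<rightarrow>\<^sub>E verts H. large_gain D f} - S" for f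
          using that lam by (intro prod_nonneg) (auto simp: PiE_iff less_imp_le)
      qed (use finP in auto)
      also have "\<dots> \<le> 2 * exp (- real D) * eta lam H ^ card (odd_class m d)"
        by (rule weight_large_gain)
      also have "\<dots> \<le> 2 powr (- (c * real d)) * partition_function lam (torus m d) H"
      proof (intro mult_mono partition_function_ge m H lam dd)
        have "c * d * ln 2 \<le> 1 / 4 * d * 1"
          using c ln_2_less_1 by (intro mult_mono) auto
        moreover have "8 \<le> real d" using dd(3) by simp
        ultimately have "ln 2 - real DD \<le> - (c * d * ln 2)"
          using DD ln_2_less_1 by linarith
        then have "exp (ln 2 - real DD) \<le> exp (- (c * d * ln 2))" by simp
        then show "2 * exp (- real D) \<le> 2 powr (- (c * real d))"
          unfolding DD_def[symmetric] by (simp add: powr_def exp_diff exp_minus divide_inverse)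
        show "0 \<le> eta lam H ^ card (odd_class m d)" using asc.eta_pos by simp
      qed auto
      finally show "set_weight lam (torus m d) S
        \<le> 2 powr (- (c * real d)) * partition_function lam (torus m d) H" .
    next
      fix f assume f: "f \<in> Hom (torus m d) H - S"
      define Q where "Q = C * (real d ^ 5 * (r * m) ^ d)"
      have "Q \<le> ((r * m + m) / 2) ^ d" "Q < real m ^ d / 2" using d1[OF dd(1)] by (auto simp: Q_def)
      moreover have "((r * m + m) / 2) ^ d \<le> (real m - c) ^ d"
        using c r by (intro power_mono) (auto simp: field_simps)
      ultimately have Q: "Q \<le> (real m - c) ^ d" "Q < card (odd_class m d)"
        using card_odd_class[OF m dd(4)] by auto
      have "f \<in> Hom (torus m d) H" "\<not> large_gain D f" using f by (auto simp: S_def)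
      from structure_bound[OF this theta_def g(1) base less_imp_le[OF eps(1)] eps(2-4) delta_r r(1),
          folded s_def, folded c1_def, folded C_def, folded Q_def]
      obtain A where A: "(A, CNbrs H A) \<in> max_pairs lam H" "near_pair m d Q f A (CNbrs H A)"
        using Q(2) unfolding near_pair_def by blast
      then have "near_pair m d ((real m - c) ^ d) f A (CNbrs H A)"
        using Q(1) unfolding near_pair_def by linarith
      then show "\<exists>(A, B) \<in> max_pairs lam H. near_pair m d ((real m - c) ^ d) f A B"
        using A(1) by blast
    qed
  qed
qed

theorem theorem1p1:
  fixes H :: "'h ugraph" and lam :: "'h \<Rightarrow> real" and m :: nat
  assumes "finite_loop_graph H"
    and "\<And>i. i \<in> verts H \<Longrightarrow> lam i > 0 \<and> lam i \<in> \<rat>"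
    and "even m" and "m \<ge> 2"
  shows "\<exists>(c::real) d0::nat. 0 < c \<and> c < real m \<and>
    (\<forall>d\<ge>1. \<exists>(D0 :: ((nat \<Rightarrow> nat) \<Rightarrow> 'h) set) (D :: 'h set \<times> 'h set \<Rightarrow> ((nat \<Rightarrow> nat) \<Rightarrow> 'h) set).
       Hom (torus m d) H = D0 \<union> (\<Union>p\<in>max_pairs lam H. D p) \<and>
       disjoint_family_on D (max_pairs lam H) \<and>
       (\<forall>p\<in>max_pairs lam H. D0 \<inter> D p = {}) \<and>
       (d \<ge> d0 \<longrightarrow>
          set_weight lam (torus m d) D0
            \<le> 2 powr (- (c * real d)) * partition_function lam (torus m d) H \<and>
          (\<forall>(A, B)\<in>max_pairs lam H. \<forall>f\<in>D (A, B).
             real (card {v \<in> even_class m d. f v \<notin> A}) \<le> (real m - c) ^ d \<and>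
             real (card {v \<in> odd_class m d. f v \<notin> B}) \<le> (real m - c) ^ d \<and>
             real (card {w \<in> odd_class m d. \<not> A \<subseteq> f ` nbhd (torus m d) w})
               \<le> (real m - c) ^ d \<and>
             real (card {w \<in> even_class m d. \<not> B \<subseteq> f ` nbhd (torus m d) w})
               \<le> (real m - c) ^ d)))"
proof -
  have lam: "\<And>i. i \<in> verts H \<Longrightarrow> 0 < lam i" using assms(2) by blast
  have m: "2 \<le> m" "even m" using assms by auto
  obtain c :: real and d0 :: nat where c: "0 < c" "c < m"
    and dich: "\<And>d. d \<ge> d0 \<Longrightarrow> d \<ge> 1 \<Longrightarrow> \<exists>S \<subseteq> Hom (torus m d) H.
       set_weight lam (torus m d) S \<le> 2 powr (- (c * real d)) * partition_function lam (torus m d) H \<and>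
       (\<forall>f \<in> Hom (torus m d) H - S. \<exists>(A, B) \<in> max_pairs lam H. near_pair m d ((real m - c) ^ d) f A B)"
  proof (cases "edges H = {}")
    case True
    have "\<exists>S \<subseteq> Hom (torus m d) H.
       set_weight lam (torus m d) S \<le> 2 powr (- (1 * real d)) * partition_function lam (torus m d) H \<and>
       (\<forall>f \<in> Hom (torus m d) H - S. \<exists>(A, B) \<in> max_pairs lam H. near_pair m d ((real m - 1) ^ d) f A B)"
      if "d \<ge> 1" for d
      using Hom_torus_empty[OF m that True] by (simp add: partition_function_def set_weight_def)
    \<comment> \<open>There are no colourings, so any positive \<open>c\<close> below
      \<open>m\<close> will do.\<close>
    then show ?thesis using that[of 1 0] m by simp
  next
    case False
    obtain c :: real and d0 :: nat where "0 < c" "c < m"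
      and "\<And>d. d \<ge> d0 \<Longrightarrow> \<exists>S \<subseteq> Hom (torus m d) H.
       set_weight lam (torus m d) S \<le> 2 powr (- (c * real d)) * partition_function lam (torus m d) H \<and>
       (\<forall>f \<in> Hom (torus m d) H - S. \<exists>(A, B) \<in> max_pairs lam H. near_pair m d ((real m - c) ^ d) f A B)"
      by (rule torus_dichotomy[OF assms(1) lam m False]) blast+
    then show ?thesis using that[of c d0] by blast
  qed
  show ?thesis
  proof (intro exI[of _ c] exI[of _ d0] conjI c allI impI)
    fix d :: nat assume d: "1 \<le> d"
    show "\<exists>(D0 :: ((nat \<Rightarrow> nat) \<Rightarrow> 'h) set) (D :: 'h set \<times> 'h set \<Rightarrow> ((nat \<Rightarrow> nat) \<Rightarrow> 'h) set).
       Hom (torus m d) H = D0 \<union> (\<Union>p\<in>max_pairs lam H. D p) \<and>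
       disjoint_family_on D (max_pairs lam H) \<and>
       (\<forall>p\<in>max_pairs lam H. D0 \<inter> D p = {}) \<and>
       (d \<ge> d0 \<longrightarrow>
          set_weight lam (torus m d) D0
            \<le> 2 powr (- (c * real d)) * partition_function lam (torus m d) H \<and>
          (\<forall>(A, B)\<in>max_pairs lam H. \<forall>f\<in>D (A, B).
             real (card {v \<in> even_class m d. f v \<notin> A}) \<le> (real m - c) ^ d \<and>
             real (card {v \<in> odd_class m d. f v \<notin> B}) \<le> (real m - c) ^ d \<and>
             real (card {w \<in> odd_class m d. \<not> A \<subseteq> f ` nbhd (torus m d) w})
               \<le> (real m - c) ^ d \<and>
             real (card {w \<in> even_class m d. \<not> B \<subseteq> f ` nbhd (torus m d) w})
               \<le> (real m - c) ^ d))"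
    proof (cases "d0 \<le> d")
      \<comment> \<open>Below \<open>d0\<close> only the partition is required, so all colourings go
        to \<open>D0\<close>.\<close>
      case False
      then show ?thesis
        by (intro exI[of _ "Hom (torus m d) H"] exI[of _ "\<lambda>_. {}"]) (auto simp: disjoint_family_on_def)
    next
      case True
      obtain S where S: "S \<subseteq> Hom (torus m d) H"
        "set_weight lam (torus m d) S \<le> 2 powr (- (c * real d)) * partition_function lam (torus m d) H"
        and near: "\<And>f. f \<in> Hom (torus m d) H - S \<Longrightarrow>
          \<exists>(A, B) \<in> max_pairs lam H. near_pair m d ((real m - c) ^ d) f A B"
        using dich[OF True d] by blast
      \<comment> \<open>A colouring may be close to several optimal pairs; choosing one for each
        makes the classes disjoint.\<close>
      obtain pair where pair: "\<And>f. f \<in> Hom (torus m d) H - S \<Longrightarrow> pair f \<in> max_pairs lam H \<and>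
          near_pair m d ((real m - c) ^ d) f (fst (pair f)) (snd (pair f))"
        using near by (metis (no_types, lifting) case_prod_beta)
      show ?thesis
      proof (intro exI[of _ S] exI[of _ "\<lambda>p. {f \<in> Hom (torus m d) H - S. pair f = p}"] conjI impI)
        show "Hom (torus m d) H = S \<union> (\<Union>p\<in>max_pairs lam H. {f \<in> Hom (torus m d) H - S. pair f = p})"
          using S pair by auto
        show "\<forall>(A, B)\<in>max_pairs lam H. \<forall>f\<in>{f \<in> Hom (torus m d) H - S. pair f = (A, B)}.
             real (card {v \<in> even_class m d. f v \<notin> A}) \<le> (real m - c) ^ d \<and>
             real (card {v \<in> odd_class m d. f v \<notin> B}) \<le> (real m - c) ^ d \<and>
             real (card {w \<in> odd_class m d. \<not> A \<subseteq> f ` nbhd (torus m d) w})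
               \<le> (real m - c) ^ d \<and>
             real (card {w \<in> even_class m d. \<not> B \<subseteq> f ` nbhd (torus m d) w})
               \<le> (real m - c) ^ d"
          using pair unfolding near_pair_def by fastforce
      qed (use S in \<open>auto simp: disjoint_family_on_def\<close>)
    qed
  qed
qed

end
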